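(* Let $\{X_n\}_{n\in\mathbb{Z}}\subset L_H^4$ be an $L^4$--$m$-approximable sequence with covariance operator $C$, where each $X_n$ is jointly measurable in $(t,\omega)$ and $\sup_{t\in[0,1]}E|X_1(t)|^2<\infty$. Let $\hat C=\hat C_N$ be the empirical covariance operator computed from $X_1,\dots,X_N$. Then there is a constant $U_X<\infty$, which does not depend on $N$, such that $$N\,E\|\hat C-C\|_{\mathcal S}^2\le U_X .$$ If the $X_n$ have zero mean, then one can choose $$U_X=\nu_4^4(X)+4\sqrt2\,\nu_4^3(X)\sum_{r=1}^\infty \nu_4\bigl(X_r-X_r^{(r)}\bigr).$$
   Context: $H=L^2([0,1],\mathcal B_{[0,1]},\lambda)$ with norm $\|f\|^2=\int_0^1|f(t)|^2dt$. All random elements live on a common probability space. $L_H^p$ is the space of $H$-valued random elements $X$ with $\nu_p(X)=(E\|X\|^p)^{1/p}<\infty$. $\|\cdot\|_{\mathcal S}$ is the Hilbert--Schmidt norm. $X$ denotes a random element distributed as $X_1$. $L^p$--$m$-approximability: a sequence $\{X_n\}_{n\in\mathbb Z}\subset L_H^p$ is $L^p$--$m$-approximable if $X_n=f(\varepsilon_n,\varepsilon_{n-1},\ldots)$ for all $n$, where $\{\varepsilon_i\}_{i\in\mathbb Z}$ are i.i.d. elements with values in a measurable space $S$ and $f:S^\infty\to H$ is measurable, and moreover $\sum_{m=1}^\infty\nu_p(X_m-X_m^{(m)})<\infty$, where $$X_n^{(m)}=f\bigl(\varepsilon_n,\ldots,\varepsilon_{n-m+1},\varepsilon_{n-m}^{(n)},\varepsilon_{n-m-1}^{(n)},\ldots\bigr)$$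 and, for each $n$, $\{\varepsilon_k^{(n)}\}_{k}$ is an independent copy of $\{\varepsilon_k\}_k$ (these copies for different $n$ being independent of each other and of $\{\varepsilon_k\}$). The covariance operator $C$ is the integral operator on $H$ with kernel $c(t,s)=\mathrm{Cov}(X_1(t),X_1(s))$. The empirical covariance operator $\hat C$ is the integral operator with kernel $$\hat c(t,s)=N^{-1}\sum_{n=1}^N\bigl(X_n(t)-\bar X_N(t)\bigr)\bigl(X_n(s)-\bar X_N(s)\bigr),\qquad \bar X_N=N^{-1}\sum_{n=1}^N X_n .$$ *)

theory Defs
  imports "HOL-Probability.Probability"
begin

abbreviation unit_interval :: "real measure" where
  "unit_interval \<equiv> restrict_space lborel {0..1}"

definition square_integrable :: "(real \<Rightarrow> real) \<Rightarrow> bool" where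
  "square_integrable g \<longleftrightarrow>
     g \<in> borel_measurable unit_interval \<and> integrable unit_interval (\<lambda>t. (g t)\<^sup>2)"

lemma square_integrable_zero: "square_integrable (\<lambda>_. 0)"
  by (simp add: square_integrable_def)

lemma square_integrable_mult:
  assumes "square_integrable f" "square_integrable g"
  shows "integrable unit_interval (\<lambda>t. f t * g t)"
proof (rule Bochner_Integration.integrable_bound)
  show "integrable unit_interval (\<lambda>t. (f t)\<^sup>2 + (g t)\<^sup>2)"
    using assms by (simp add: square_integrable_def)
  show "(\<lambda>t. f t * g t) \<in> borel_measurable unit_interval"
    using assms unfolding square_integrable_def by (intro borel_measurable_times) auto
  have "norm (a * b) \<le> norm (a\<^sup>2 + b\<^sup>2)" for a b :: real
  proof -
    have "2 * (\<bar>a\<bar> * \<bar>b\<bar>) \<le> \<bar>a\<bar>\<^sup>2 + \<bar>b\<bar>\<^sup>2"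
      using sum_squares_bound[of "\<bar>a\<bar>" "\<bar>b\<bar>"] by (simp only: mult.assoc)
    moreover have "0 \<le> \<bar>a\<bar> * \<bar>b\<bar>" by simp
    ultimately have "\<bar>a\<bar> * \<bar>b\<bar> \<le> a\<^sup>2 + b\<^sup>2" unfolding power2_abs by linarith
    then show ?thesis by (simp add: abs_mult)
  qed
  then show "AE t in unit_interval. norm (f t * g t) \<le> norm ((f t)\<^sup>2 + (g t)\<^sup>2)"
    by simp
qed

lemma square_integrable_scale:
  "square_integrable f \<Longrightarrow> square_integrable (\<lambda>t. r * f t)"
  unfolding square_integrable_def power_mult_distrib
  by (intro conjI borel_measurable_times borel_measurable_const integrable_mult_right) auto

lemma square_integrable_uminus:
  "square_integrable f \<Longrightarrow> square_integrable (\<lambda>t. - f t)"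
  using square_integrable_scale[of f "- 1"] by simp

lemma square_integrable_add:
  assumes "square_integrable f" "square_integrable g"
  shows "square_integrable (\<lambda>t. f t + g t)"
proof -
  have "integrable unit_interval (\<lambda>t. (f t)\<^sup>2 + (g t)\<^sup>2 + 2 * (f t * g t))"
    using assms square_integrable_mult[OF assms] by (simp add: square_integrable_def)
  then have "integrable unit_interval (\<lambda>t. (f t + g t)\<^sup>2)"
    by (simp add: power2_sum mult.assoc)
  moreover have "(\<lambda>t. f t + g t) \<in> borel_measurable unit_interval"
    using assms unfolding square_integrable_def by (intro borel_measurable_add) auto
  ultimately show ?thesis
    unfolding square_integrable_def by blast
qed

lemma square_integrable_diff:
  assumes "square_integrable f" "square_integrable g"
  shows "square_integrable (\<lambda>t. f t - g t)"
  using square_integrable_add[OF assms(1) square_integrable_uminus[OF assms(2)]] by simp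

text \<open>
  For a function that is not square integrable, \<open>abs_L2\<close> returns an unspecified element.
\<close>

quotient_type L2 = "real \<Rightarrow> real" / partial:
  "\<lambda>f g. square_integrable f \<and> square_integrable g \<and> (AE t in unit_interval. f t = g t)"
proof (rule part_equivpI)
  show "\<exists>f. square_integrable f \<and> square_integrable f \<and> (AE t in unit_interval. f t = f t)"
    using square_integrable_zero by auto
  show "symp (\<lambda>f g. square_integrable f \<and> square_integrable g \<and>
      (AE t in unit_interval. f t = g t))"
    by (auto intro!: sympI)
  show "transp (\<lambda>f g. square_integrable f \<and> square_integrable g \<and>
      (AE t in unit_interval. f t = g t))"
    by (auto intro!: transpI)
qed

instantiation L2 :: real_inner
begin

lift_definition zero_L2 :: L2 is "\<lambda>_. 0"
  by (simp add: square_integrable_zero)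

lift_definition plus_L2 :: "L2 \<Rightarrow> L2 \<Rightarrow> L2" is "\<lambda>f g t. f t + g t"
  by (auto intro: square_integrable_add)

lift_definition minus_L2 :: "L2 \<Rightarrow> L2 \<Rightarrow> L2" is "\<lambda>f g t. f t - g t"
  by (auto intro: square_integrable_diff)

lift_definition uminus_L2 :: "L2 \<Rightarrow> L2" is "\<lambda>f t. - f t"
  by (auto intro: square_integrable_uminus)

lift_definition scaleR_L2 :: "real \<Rightarrow> L2 \<Rightarrow> L2" is "\<lambda>r f t. r * f t"
  by (auto intro: square_integrable_scale)

lift_definition inner_L2 :: "L2 \<Rightarrow> L2 \<Rightarrow> real" is
  "\<lambda>f g. \<integral>t. f t * g t \<partial>unit_interval"
  by (rule integral_cong_AE) (auto simp: square_integrable_def)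

definition norm_L2 :: "L2 \<Rightarrow> real" where "norm_L2 x = sqrt (inner x x)"

definition sgn_L2 :: "L2 \<Rightarrow> L2" where "sgn_L2 x = inverse (norm x) *\<^sub>R x"

definition dist_L2 :: "L2 \<Rightarrow> L2 \<Rightarrow> real" where "dist_L2 x y = norm (x - y)"

definition uniformity_L2 :: "(L2 \<times> L2) filter" where
  "uniformity_L2 = (INF e\<in>{0<..}. principal {(x, y). dist x y < e})"

definition open_L2 :: "L2 set \<Rightarrow> bool" where
  "open_L2 U \<longleftrightarrow> (\<forall>x\<in>U. eventually (\<lambda>(x', y). x' = x \<longrightarrow> y \<in> U) uniformity)"

instance
proof
  fix x y z :: L2 and r s :: real
  show "x + y + z = x + (y + z)"
    by transfer (auto intro!: square_integrable_add simp: add.assoc)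
  show "x + y = y + x"
    by transfer (auto intro!: square_integrable_add simp: add.commute)
  show "0 + x = x"
    by transfer auto
  show "- x + x = 0"
    by transfer (auto intro!: square_integrable_zero)
  show "x - y = x + - y"
    by transfer (auto intro: square_integrable_diff)
  show "r *\<^sub>R (x + y) = r *\<^sub>R x + r *\<^sub>R y"
    by transfer (auto intro!: square_integrable_add square_integrable_scale
        simp: distrib_left)
  show "(r + s) *\<^sub>R x = r *\<^sub>R x + s *\<^sub>R x"
    by transfer (auto intro!: square_integrable_add square_integrable_scale
        simp: distrib_right)
  show "r *\<^sub>R s *\<^sub>R x = (r * s) *\<^sub>R x"
    by transfer (auto intro!: square_integrable_scale simp: mult.assoc)
  show "1 *\<^sub>R x = x"
    by transfer auto
  show "inner x y = inner y x"
    by transfer (simp add: mult.commute)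
  show "inner (x + y) z = inner x z + inner y z"
    by transfer (simp add: distrib_right square_integrable_mult)
  show "inner (r *\<^sub>R x) y = r * inner x y"
    by transfer (simp add: mult.assoc)
  show "0 \<le> inner x x"
    by transfer simp
  show "inner x x = 0 \<longleftrightarrow> x = 0"
  proof transfer
    fix f assume "square_integrable f \<and> square_integrable f \<and> (AE t in unit_interval. f t = f t)"
    then show "((\<integral>t. f t * f t \<partial>unit_interval) = 0) =
        (square_integrable f \<and> square_integrable (\<lambda>_. 0) \<and> (AE t in unit_interval. f t = 0))"
      using integral_nonneg_eq_0_iff_AE[of unit_interval "\<lambda>t. f t * f t"]
      by (simp add: square_integrable_mult square_integrable_zero)
  qed
qed (simp_all only: norm_L2_def sgn_L2_def dist_L2_def uniformity_L2_def open_L2_def)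

end

definition orthonormal_basis :: "'a::real_inner set \<Rightarrow> bool" where
  "orthonormal_basis B \<longleftrightarrow>
     pairwise orthogonal B \<and> (\<forall>e\<in>B. norm e = 1) \<and> closure (span B) = UNIV"

text \<open>
  In a Hilbert space an orthonormal basis exists, and for a bounded operator neither the
  convergence nor the value of \<open>\<Sum> \<parallel>T e\<parallel>\<^sup>2\<close> depends on which one is used.
\<close>

definition some_basis :: "'a::real_inner set" where
  "some_basis = (SOME B. orthonormal_basis B)"

definition Hilbert_Schmidt :: "('a::real_inner \<Rightarrow> 'b::real_inner) \<Rightarrow> bool" where
  "Hilbert_Schmidt T \<longleftrightarrow> bounded_linear T \<and> (\<lambda>e. (norm (T e))\<^sup>2) summable_on some_basis"

definition HS_norm :: "('a::real_inner \<Rightarrow> 'b::real_inner) \<Rightarrow> real" where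
  "HS_norm T = sqrt (\<Sum>\<^sub>\<infinity>e\<in>some_basis. (norm (T e))\<^sup>2)"

definition integral_operator :: "(real \<Rightarrow> real \<Rightarrow> real) \<Rightarrow> L2 \<Rightarrow> L2" where
  "integral_operator k h = abs_L2 (\<lambda>t. \<integral>s. k t s * rep_L2 h s \<partial>unit_interval)"

definition L_H :: "'w measure \<Rightarrow> real \<Rightarrow> ('w \<Rightarrow> L2) set" where
  "L_H M p = {X. X \<in> borel_measurable M \<and> integrable M (\<lambda>\<omega>. norm (X \<omega>) powr p)}"

definition nu :: "'w measure \<Rightarrow> real \<Rightarrow> ('w \<Rightarrow> L2) \<Rightarrow> real" where
  "nu M p X = (\<integral>\<omega>. norm (X \<omega>) powr p \<partial>M) powr (1 / p)"

text \<open>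
  For every \<open>n\<close>, \<open>\<epsilon>' n\<close> is the independent copy \<open>(\<epsilon>\<^sub>k\<^sup>(\<^sup>n\<^sup>))\<^sub>k\<close> of \<open>\<epsilon>\<close>. The index type \<open>int option\<close>
  lists the original sequence (\<open>None\<close>) together with all its copies.
\<close>

definition independent_copies ::
    "'w measure \<Rightarrow> 's measure \<Rightarrow> (int \<Rightarrow> 'w \<Rightarrow> 's) \<Rightarrow> (int \<Rightarrow> int \<Rightarrow> 'w \<Rightarrow> 's) \<Rightarrow> bool" where
  "independent_copies M S \<epsilon> \<epsilon>' \<longleftrightarrow>
     prob_space.indep_vars M (\<lambda>_. \<Pi>\<^sub>M k\<in>UNIV. S)
       (\<lambda>j \<omega> k. case j of None \<Rightarrow> \<epsilon> k \<omega> | Some n \<Rightarrow> \<epsilon>' n k \<omega>) (UNIV :: int option set) \<and>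
     (\<forall>n. distr M (\<Pi>\<^sub>M k\<in>UNIV. S) (\<lambda>\<omega> k. \<epsilon>' n k \<omega>) = distr M (\<Pi>\<^sub>M k\<in>UNIV. S) (\<lambda>\<omega> k. \<epsilon> k \<omega>))"

definition iid :: "'w measure \<Rightarrow> 's measure \<Rightarrow> (int \<Rightarrow> 'w \<Rightarrow> 's) \<Rightarrow> bool" where
  "iid M S \<epsilon> \<longleftrightarrow>
     prob_space.indep_vars M (\<lambda>_. S) \<epsilon> UNIV \<and> (\<forall>i j. distr M S (\<epsilon> i) = distr M S (\<epsilon> j))"

definition coupled ::
    "((nat \<Rightarrow> 's) \<Rightarrow> L2) \<Rightarrow> (int \<Rightarrow> 'w \<Rightarrow> 's) \<Rightarrow> (int \<Rightarrow> int \<Rightarrow> 'w \<Rightarrow> 's) \<Rightarrow> nat \<Rightarrow> int \<Rightarrow> 'w \<Rightarrow> L2"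
  where
  "coupled f \<epsilon> \<epsilon>' m n \<omega> =
     f (\<lambda>j. if j < m then \<epsilon> (n - int j) \<omega> else \<epsilon>' n (n - int j) \<omega>)"

text \<open>
  The real-valued \<open>nu\<close> is harmless below: \<open>coupled f \<epsilon> \<epsilon>' m n\<close> is distributed as \<open>X n\<close>, so the
  differences lie in \<open>L_H M p\<close>.
\<close>

definition Lp_m_approximable ::
    "'w measure \<Rightarrow> real \<Rightarrow> (int \<Rightarrow> 'w \<Rightarrow> L2) \<Rightarrow> 's measure \<Rightarrow> ((nat \<Rightarrow> 's) \<Rightarrow> L2) \<Rightarrow>
      (int \<Rightarrow> 'w \<Rightarrow> 's) \<Rightarrow> (int \<Rightarrow> int \<Rightarrow> 'w \<Rightarrow> 's) \<Rightarrow> bool" where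
  "Lp_m_approximable M p X S f \<epsilon> \<epsilon>' \<longleftrightarrow>
     (\<forall>n. X n \<in> L_H M p) \<and>
     iid M S \<epsilon> \<and> independent_copies M S \<epsilon> \<epsilon>' \<and>
     f \<in> borel_measurable (\<Pi>\<^sub>M j\<in>UNIV. S) \<and>
     (\<forall>n. \<forall>\<omega>\<in>space M. X n \<omega> = f (\<lambda>j. \<epsilon> (n - int j) \<omega>)) \<and>
     summable (\<lambda>r. nu M p (\<lambda>\<omega>. X (int (Suc r)) \<omega> - coupled f \<epsilon> \<epsilon>' (Suc r) (int (Suc r)) \<omega>))"

text \<open>
  Covariances at fixed points \<open>t\<close>, \<open>s\<close> need pointwise values, so they are computed from a
  measurable version \<open>x n t \<omega>\<close> of the sequence: \<open>X n \<omega>\<close> is the class of \<open>\<lambda>t. x n t \<omega>\<close>.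
\<close>

definition jointly_measurable_version ::
    "'w measure \<Rightarrow> (real \<Rightarrow> 'w \<Rightarrow> real) \<Rightarrow> ('w \<Rightarrow> L2) \<Rightarrow> bool" where
  "jointly_measurable_version M y Y \<longleftrightarrow>
     (\<lambda>(t, \<omega>). y t \<omega>) \<in> borel_measurable (unit_interval \<Otimes>\<^sub>M M) \<and>
     (\<forall>\<omega>\<in>space M. square_integrable (\<lambda>t. y t \<omega>) \<and> Y \<omega> = abs_L2 (\<lambda>t. y t \<omega>))"

definition cov_kernel :: "'w measure \<Rightarrow> (real \<Rightarrow> 'w \<Rightarrow> real) \<Rightarrow> real \<Rightarrow> real \<Rightarrow> real" where
  "cov_kernel M y t s =
     (\<integral>\<omega>. (y t \<omega> - (\<integral>\<omega>'. y t \<omega>' \<partial>M)) * (y s \<omega> - (\<integral>\<omega>'. y s \<omega>' \<partial>M)) \<partial>M)"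

definition cov_operator :: "'w measure \<Rightarrow> (real \<Rightarrow> 'w \<Rightarrow> real) \<Rightarrow> L2 \<Rightarrow> L2" where
  "cov_operator M y = integral_operator (cov_kernel M y)"

definition sample_mean :: "(int \<Rightarrow> real \<Rightarrow> 'w \<Rightarrow> real) \<Rightarrow> nat \<Rightarrow> real \<Rightarrow> 'w \<Rightarrow> real" where
  "sample_mean x N t \<omega> = (\<Sum>n=1..N. x (int n) t \<omega>) / real N"

definition emp_cov_kernel ::
    "(int \<Rightarrow> real \<Rightarrow> 'w \<Rightarrow> real) \<Rightarrow> nat \<Rightarrow> 'w \<Rightarrow> real \<Rightarrow> real \<Rightarrow> real" where
  "emp_cov_kernel x N \<omega> t s =
     (\<Sum>n=1..N. (x (int n) t \<omega> - sample_mean x N t \<omega>) * (x (int n) s \<omega> - sample_mean x N s \<omega>))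
       / real N"

definition emp_cov_operator ::
    "(int \<Rightarrow> real \<Rightarrow> 'w \<Rightarrow> real) \<Rightarrow> nat \<Rightarrow> 'w \<Rightarrow> L2 \<Rightarrow> L2" where
  "emp_cov_operator x N \<omega> = integral_operator (emp_cov_kernel x N \<omega>)"

end

theory Submission
  imports Defs
begin

text \<open>
  Write \<open>Z n = X n \<otimes> X n - C\<close>, \<open>A\<close> for the average of \<open>Z 1, \<dots>, Z N\<close> and \<open>b\<close> for the tensor square of
  the sample mean. When the mean is zero, the error of the empirical covariance operator is \<open>A - b\<close>.
  After projecting onto finitely many elements of an orthonormal basis all objects are finite
  vectors and matrices of real random variables, and a bound that does not depend on the projection
  passes to the limit by monotone convergence. The finite-dimensional bound is
  \<open>emp_error_bound\<close>, the passage to the limit is \<open>HS_norm_integral\<close>.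

  Dependence is controlled by cutting the innovations at a time \<open>k\<close> and replacing everything up to \<open>k\<close>
  by an independent copy. A function \<open>U\<close> of the past and a function \<open>V\<close> of everything satisfy
  \<open>E (U V) - E U E V = E ((U - U') (V - V')) / 2\<close>, where the primes denote the replacement
  (\<open>covariance_decouple_symmetric\<close>). The second factor is small by approximability, and since \<open>U\<close> and
  \<open>U'\<close> are independent, the first factor has variance at most \<open>2 E U\<^sup>2\<close>, so that the Cauchy--Schwarz
  inequality gives a factor \<open>1 / sqrt 2\<close> compared with a one-sided replacement. This yields
  \<open>N E \<parallel>A\<parallel>\<^sup>2 \<le> \<sigma>\<^sup>2 + 2 sqrt 2 \<sigma> t\<close> with \<open>\<sigma>\<^sup>2 = \<nu>\<^sup>4 - \<parallel>C\<parallel>\<^sup>2\<close> and \<open>t = \<nu> \<Delta>\<close>, where \<open>\<Delta>\<close> is the sum of the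
  coupling distances. For \<open>b = 0\<close> this would be better than the asserted
  constant; the room is what pays for centering at the sample mean.

  Jensen's inequality gives \<open>\<parallel>b\<parallel>\<^sup>2 \<le> \<langle>A, b\<rangle> + \<langle>C, b\<rangle>\<close>, hence the two bounds
  \<open>\<parallel>A - b\<parallel>\<^sup>2 \<le> \<parallel>A\<parallel>\<^sup>2 + 2 \<langle>C, b\<rangle>\<close> and \<open>\<parallel>A - b\<parallel>\<^sup>2 \<le> \<parallel>A\<parallel>\<^sup>2 - \<langle>A, b\<rangle> + \<langle>C, b\<rangle>\<close>
  (\<open>centered_covariance_bounds\<close>). The term \<open>\<langle>C, b\<rangle>\<close> is quadratic in the sequence and is treated like
  \<open>\<parallel>A\<parallel>\<^sup>2\<close>. The first bound suffices when \<open>t\<close> is at least a fixed multiple of \<open>\<parallel>C\<parallel>\<^sup>2\<close>. Otherwise the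
  second one is used: \<open>\<langle>A, b\<rangle>\<close> is a sum over triples of times whose terms with coinciding tensor indices
  contribute \<open>\<parallel>A\<parallel>\<^sup>2 / N\<close> in expectation, and every other term is decoupled by a cut just after the
  second largest of the times that occur in it (\<open>cubic_bound\<close>). Weak dependence makes
  the partial sums of \<open>Z\<close> grow like a square root, which keeps the resulting coefficient of \<open>t\<close> just
  below \<open>4 sqrt 2\<close> (\<open>centering_bound\<close>).

  A sequence with nonzero mean is centered coordinatewise; this leaves the empirical covariance and the
  coupling distances unchanged and at most doubles \<open>\<nu>\<close>, which gives a constant independent of \<open>N\<close>.
\<close>

section \<open>Random variables with finite second and fourth moments\<close>

text \<open>
  Products of two variables of class \<open>fourth_moment\<close> are of class \<open>second_moment\<close>, and products of two
  variables of class \<open>second_moment\<close> are integrable. Membership in the two classes therefore settles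
  integrability for every polynomial of degree at most four that occurs below.
\<close>

definition fourth_moment :: "'a measure \<Rightarrow> ('a \<Rightarrow> real) \<Rightarrow> bool" where
  "fourth_moment M a \<longleftrightarrow> a \<in> borel_measurable M \<and> integrable M (\<lambda>w. (a w) ^ 4)"

definition second_moment :: "'a measure \<Rightarrow> ('a \<Rightarrow> real) \<Rightarrow> bool" where
  "second_moment M a \<longleftrightarrow> a \<in> borel_measurable M \<and> integrable M (\<lambda>w. (a w)\<^sup>2)"

lemma fourth_momentD[measurable_dest]: "fourth_moment M a \<Longrightarrow> a \<in> borel_measurable M"
  by (simp add: fourth_moment_def)

lemma second_momentD[measurable_dest]: "second_moment M a \<Longrightarrow> a \<in> borel_measurable M"
  by (simp add: second_moment_def)

lemma abs_mult_le_squares: "\<bar>a * b\<bar> \<le> a\<^sup>2 + (b::real)\<^sup>2"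
proof -
  have "2 * (\<bar>a\<bar> * \<bar>b\<bar>) \<le> \<bar>a\<bar>\<^sup>2 + \<bar>b\<bar>\<^sup>2"
    using sum_squares_bound[of "\<bar>a\<bar>" "\<bar>b\<bar>"] by (simp only: mult.assoc)
  moreover have "0 \<le> \<bar>a\<bar> * \<bar>b\<bar>" by simp
  ultimately show ?thesis unfolding power2_abs abs_mult by linarith
qed

lemma integrable_second_mult:
  assumes a: "second_moment M a" and b: "second_moment M b"
  shows "integrable M (\<lambda>w. a w * b w)"
proof (rule Bochner_Integration.integrable_bound)
  show "integrable M (\<lambda>w. (a w)\<^sup>2 + (b w)\<^sup>2)" using assms by (simp add: second_moment_def)
  show "(\<lambda>w. a w * b w) \<in> borel_measurable M" using assms by measurable
  show "AE w in M. norm (a w * b w) \<le> norm ((a w)\<^sup>2 + (b w)\<^sup>2)"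
    using abs_mult_le_squares by simp
qed

lemma second_moment_cmult:
  assumes "second_moment M a" shows "second_moment M (\<lambda>w. c * a w)"
  using assms unfolding second_moment_def by (auto simp: power_mult_distrib)

lemma second_moment_add:
  assumes a: "second_moment M a" and b: "second_moment M b"
  shows "second_moment M (\<lambda>w. a w + b w)"
proof -
  have "integrable M (\<lambda>w. (a w)\<^sup>2 + (b w)\<^sup>2 + 2 * (a w * b w))"
    using integrable_second_mult[OF a b] a b by (simp add: second_moment_def)
  then show ?thesis using a b unfolding second_moment_def by (auto simp: power2_sum mult.assoc)
qed

lemma second_moment_zero: "second_moment M (\<lambda>w. 0)"
  by (simp add: second_moment_def)

lemma second_moment_sum:
  "(\<And>i. i \<in> I \<Longrightarrow> second_moment M (a i)) \<Longrightarrow> second_moment M (\<lambda>w. \<Sum>i\<in>I. a i w)"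
  by (induction I rule: infinite_finite_induct)
     (auto intro!: second_moment_add simp: second_moment_zero)

lemma second_moment_diff:
  assumes a: "second_moment M a" and b: "second_moment M b"
  shows "second_moment M (\<lambda>w. a w - b w)"
  using second_moment_add[OF a second_moment_cmult[OF b, of "-1"]] by simp

lemma second_moment_mult:
  assumes "fourth_moment M a" "fourth_moment M b"
  shows "second_moment M (\<lambda>w. a w * b w)"
proof -
  have "second_moment M (\<lambda>w. (a w)\<^sup>2)" "second_moment M (\<lambda>w. (b w)\<^sup>2)"
    using assms by (auto simp: second_moment_def fourth_moment_def power_mult[symmetric])
  from integrable_second_mult[OF this] show ?thesis
    using assms by (auto simp: second_moment_def power_mult_distrib dest: fourth_momentD)
qed

lemma fourth_moment_cmult:
  assumes "fourth_moment M a" shows "fourth_moment M (\<lambda>w. c * a w)"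
  using assms unfolding fourth_moment_def by (auto simp: power_mult_distrib)

lemma power4_sum_le: "(a + b) ^ 4 \<le> 8 * (a ^ 4 + (b::real) ^ 4)"
proof -
  have sq: "(x + y)\<^sup>2 \<le> 2 * (x\<^sup>2 + y\<^sup>2)" for x y :: real
    using sum_squares_bound[of x y] by (simp add: power2_sum)
  have "(a + b) ^ 4 = ((a + b)\<^sup>2)\<^sup>2" by simp
  also have "\<dots> \<le> (2 * (a\<^sup>2 + b\<^sup>2))\<^sup>2" by (intro power_mono sq) simp
  also have "\<dots> = 4 * (a\<^sup>2 + b\<^sup>2)\<^sup>2" unfolding power_mult_distrib by simp
  also have "\<dots> \<le> 4 * (2 * ((a\<^sup>2)\<^sup>2 + (b\<^sup>2)\<^sup>2))" by (intro mult_left_mono sq) simp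
  finally show ?thesis by simp
qed

lemma fourth_moment_add:
  assumes a: "fourth_moment M a" and b: "fourth_moment M b"
  shows "fourth_moment M (\<lambda>w. a w + b w)"
proof -
  note [measurable] = fourth_momentD[OF a] fourth_momentD[OF b]
  have "integrable M (\<lambda>w. (a w + b w) ^ 4)"
  proof (rule Bochner_Integration.integrable_bound)
    show "integrable M (\<lambda>w. 8 * ((a w) ^ 4 + (b w) ^ 4))"
      using assms by (simp add: fourth_moment_def)
    show "AE w in M. norm ((a w + b w) ^ 4) \<le> norm (8 * ((a w) ^ 4 + (b w) ^ 4))"
      using power4_sum_le by simp
  qed measurable
  then show ?thesis by (simp add: fourth_moment_def)
qed

lemma fourth_moment_diff:
  assumes a: "fourth_moment M a" and b: "fourth_moment M b"
  shows "fourth_moment M (\<lambda>w. a w - b w)"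
  using fourth_moment_add[OF a fourth_moment_cmult[OF b, of "-1"]] by simp

lemma fourth_moment_zero: "fourth_moment M (\<lambda>w. 0)"
  by (simp add: fourth_moment_def)

lemma fourth_moment_sum:
  "(\<And>i. i \<in> I \<Longrightarrow> fourth_moment M (a i)) \<Longrightarrow> fourth_moment M (\<lambda>w. \<Sum>i\<in>I. a i w)"
  by (induction I rule: infinite_finite_induct)
     (auto intro!: fourth_moment_add simp: fourth_moment_zero)

lemma (in finite_measure) second_moment_const: "second_moment M (\<lambda>w. c)"
  by (simp add: second_moment_def)

lemma (in finite_measure) fourth_moment_const: "fourth_moment M (\<lambda>w. c)"
  by (simp add: fourth_moment_def)

lemma (in finite_measure) second_moment_fourth:
  "fourth_moment M a \<Longrightarrow> second_moment M a"
  using second_moment_mult[OF _ fourth_moment_const[of 1]] by force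

lemma (in finite_measure) integrable_second:
  "second_moment M a \<Longrightarrow> integrable M a"
  using integrable_second_mult[OF _ second_moment_const[of 1]] by force

lemma fourth_moment_norm:
  assumes "finite B" "\<And>l. l \<in> B \<Longrightarrow> fourth_moment M (\<lambda>w. v w l)"
  shows "fourth_moment M (\<lambda>w. sqrt (\<Sum>l\<in>B. (v w l)\<^sup>2))"
proof -
  have "second_moment M (\<lambda>w. \<Sum>l\<in>B. v w l * v w l)"
    by (intro second_moment_sum second_moment_mult assms)
  moreover have "(sqrt (\<Sum>l\<in>B. (v w l)\<^sup>2)) ^ 4 = (\<Sum>l\<in>B. v w l * v w l)\<^sup>2" for w
  proof -
    have "(sqrt (\<Sum>l\<in>B. (v w l)\<^sup>2)) ^ 4 = ((sqrt (\<Sum>l\<in>B. (v w l)\<^sup>2))\<^sup>2)\<^sup>2" by simp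
    then show ?thesis by (simp add: sum_nonneg power2_eq_square)
  qed
  ultimately show ?thesis
    by (auto simp: second_moment_def fourth_moment_def power2_eq_square[symmetric])
qed

lemma second_moment_norm:
  assumes "finite B" "\<And>l. l \<in> B \<Longrightarrow> second_moment M (\<lambda>w. v w l)"
  shows "second_moment M (\<lambda>w. sqrt (\<Sum>l\<in>B. (v w l)\<^sup>2))"
proof -
  have "(\<lambda>w. sqrt (\<Sum>l\<in>B. (v w l)\<^sup>2)) \<in> borel_measurable M"
  proof -
    have "(\<lambda>w. \<Sum>l\<in>B. (v w l)\<^sup>2) \<in> borel_measurable M"
      using assms(2) by (intro borel_measurable_sum borel_measurable_power second_momentD)
    then show ?thesis by measurable
  qed
  moreover have "integrable M (\<lambda>w. (sqrt (\<Sum>l\<in>B. (v w l)\<^sup>2))\<^sup>2)"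
    using assms by (simp add: sum_nonneg second_moment_def)
  ultimately show ?thesis by (simp add: second_moment_def)
qed

text \<open>
  The Cauchy--Schwarz and Hoelder inequalities are stated with arbitrary upper bounds for the norms, so that
  \<open>\<alpha>\<close>, \<open>\<beta>\<close> and \<open>\<gamma>\<close> may be moments of the full Hilbert space norm while the variables belong to a
  finite-dimensional projection.
\<close>

lemma Cauchy_Schwarz_integral:
  assumes a: "second_moment M a" "(\<integral>w. (a w)\<^sup>2 \<partial>M) \<le> \<alpha>\<^sup>2" "0 \<le> \<alpha>"
    and b: "second_moment M b" "(\<integral>w. (b w)\<^sup>2 \<partial>M) \<le> \<beta>\<^sup>2" "0 \<le> \<beta>"
  shows "(\<integral>w. \<bar>a w * b w\<bar> \<partial>M) \<le> \<alpha> * \<beta>"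
proof -
  have zero: "(\<integral>w. \<bar>a w * b w\<bar> \<partial>M) = 0"
    if "second_moment M a" "(\<integral>w. (a w)\<^sup>2 \<partial>M) \<le> 0" for a b
  proof -
    have "(\<integral>w. (a w)\<^sup>2 \<partial>M) = 0" using that(2) by (intro antisym integral_nonneg) auto
    then have "AE w in M. (a w)\<^sup>2 = 0"
      using that(1) integral_nonneg_eq_0_iff_AE[of M "\<lambda>w. (a w)\<^sup>2"]
      by (auto simp: second_moment_def)
    then have "AE w in M. \<bar>a w * b w\<bar> = 0" by auto
    then show ?thesis by (rule integral_eq_zero_AE)
  qed
  show ?thesis
  proof (cases "\<alpha> = 0 \<or> \<beta> = 0")
    case True
    then show ?thesis using zero[of a b] zero[of b a] a b by (auto simp: mult.commute)
  next
    case False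
    then have pos: "0 < \<alpha>" "0 < \<beta>" using a b by auto
    have "\<bar>a w * b w\<bar> \<le> \<alpha> * \<beta> / 2 * ((a w)\<^sup>2 / \<alpha>\<^sup>2 + (b w)\<^sup>2 / \<beta>\<^sup>2)" for w
    proof -
      have "2 * (\<bar>a w\<bar> / \<alpha>) * (\<bar>b w\<bar> / \<beta>) \<le> (\<bar>a w\<bar> / \<alpha>)\<^sup>2 + (\<bar>b w\<bar> / \<beta>)\<^sup>2"
        by (rule sum_squares_bound)
      then have "\<alpha> * \<beta> / 2 * (2 * (\<bar>a w\<bar> / \<alpha>) * (\<bar>b w\<bar> / \<beta>)) \<le>
          \<alpha> * \<beta> / 2 * ((\<bar>a w\<bar> / \<alpha>)\<^sup>2 + (\<bar>b w\<bar> / \<beta>)\<^sup>2)"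
        using pos by (intro mult_left_mono) auto
      then show ?thesis using pos by (simp add: abs_mult power_divide)
    qed
    then have "(\<integral>w. \<bar>a w * b w\<bar> \<partial>M) \<le>
        (\<integral>w. \<alpha> * \<beta> / 2 * ((a w)\<^sup>2 / \<alpha>\<^sup>2 + (b w)\<^sup>2 / \<beta>\<^sup>2) \<partial>M)"
      using a b integrable_second_mult[OF a(1) b(1)]
      by (intro integral_mono) (auto simp: second_moment_def)
    also have "\<dots> = \<alpha> * \<beta> / 2 * ((\<integral>w. (a w)\<^sup>2 \<partial>M) / \<alpha>\<^sup>2 + (\<integral>w. (b w)\<^sup>2 \<partial>M) / \<beta>\<^sup>2)"
      using a b by (simp add: second_moment_def)
    also have "\<dots> \<le> \<alpha> * \<beta> / 2 * (\<alpha>\<^sup>2 / \<alpha>\<^sup>2 + \<beta>\<^sup>2 / \<beta>\<^sup>2)"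
      using a b pos by (intro mult_left_mono add_mono divide_right_mono) auto
    also have "\<dots> = \<alpha> * \<beta>" using pos by simp
    finally show ?thesis .
  qed
qed

lemma Hoelder_2_4_4_integral:
  assumes a: "second_moment M a" "(\<integral>w. (a w)\<^sup>2 \<partial>M) \<le> \<alpha>\<^sup>2" "0 \<le> \<alpha>"
    and b: "fourth_moment M b" "(\<integral>w. (b w) ^ 4 \<partial>M) \<le> \<beta> ^ 4" "0 \<le> \<beta>"
    and c: "fourth_moment M c" "(\<integral>w. (c w) ^ 4 \<partial>M) \<le> \<gamma> ^ 4" "0 \<le> \<gamma>"
  shows "(\<integral>w. \<bar>a w * (b w * c w)\<bar> \<partial>M) \<le> \<alpha> * (\<beta> * \<gamma>)"
proof (rule Cauchy_Schwarz_integral[OF a])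
  show "second_moment M (\<lambda>w. b w * c w)" by (rule second_moment_mult[OF b(1) c(1)])
  have s: "second_moment M (\<lambda>w. (b w)\<^sup>2)" "second_moment M (\<lambda>w. (c w)\<^sup>2)"
    using b c by (auto simp: second_moment_def fourth_moment_def power_mult[symmetric])
  have "(\<integral>w. \<bar>(b w)\<^sup>2 * (c w)\<^sup>2\<bar> \<partial>M) \<le> \<beta>\<^sup>2 * \<gamma>\<^sup>2"
    by (rule Cauchy_Schwarz_integral[OF s(1) _ _ s(2)]) (use b c in simp_all)
  then show "(\<integral>w. (b w * c w)\<^sup>2 \<partial>M) \<le> (\<beta> * \<gamma>)\<^sup>2" by (simp add: power_mult_distrib)
qed (use b c in simp)

lemma abs_sum_mult_le:
  "\<bar>\<Sum>p\<in>J. U p * V p\<bar> \<le> sqrt (\<Sum>p\<in>J. (U p)\<^sup>2) * sqrt (\<Sum>p\<in>J. (V p :: real)\<^sup>2)"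
proof -
  have "\<bar>\<Sum>p\<in>J. U p * V p\<bar> \<le> (\<Sum>p\<in>J. \<bar>U p\<bar> * \<bar>V p\<bar>)"
    by (rule order_trans[OF sum_abs]) (simp add: abs_mult)
  then show ?thesis using L2_set_mult_ineq[of U V J] by (simp add: L2_set_def)
qed

text \<open>
  Cauchy--Schwarz over pairs of indices: the matrix \<open>y l * v m\<close> has norm equal to the product of
  the norms of \<open>y\<close> and \<open>v\<close>.
\<close>

lemma abs_sum_trilinear_le:
  "\<bar>\<Sum>l\<in>B. \<Sum>m\<in>B. Z l m * (y l * v m)\<bar> \<le>
     sqrt (\<Sum>l\<in>B. \<Sum>m\<in>B. (Z l m)\<^sup>2) *
     (sqrt (\<Sum>l\<in>B. (y l)\<^sup>2) * sqrt (\<Sum>m\<in>B. (v m :: real)\<^sup>2))"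
proof -
  have "\<bar>\<Sum>(l, m)\<in>B\<times>B. Z l m * (y l * v m)\<bar> \<le>
     sqrt (\<Sum>(l, m)\<in>B\<times>B. (Z l m)\<^sup>2) * sqrt (\<Sum>(l, m)\<in>B\<times>B. (y l * v m)\<^sup>2)"
    using abs_sum_mult_le[of "\<lambda>(l, m). Z l m" "\<lambda>(l, m). y l * v m" "B \<times> B"]
    by (simp add: case_prod_unfold)
  also have "(\<Sum>(l, m)\<in>B\<times>B. (y l * v m)\<^sup>2) = (\<Sum>l\<in>B. (y l)\<^sup>2) * (\<Sum>m\<in>B. (v m)\<^sup>2)"
    by (simp add: power_mult_distrib sum_product sum.cartesian_product)
  finally show ?thesis by (simp add: sum.cartesian_product real_sqrt_mult)
qed

lemma Cauchy_Schwarz_vector: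
  assumes J: "finite J"
    and U: "\<And>p. p \<in> J \<Longrightarrow> second_moment M (\<lambda>w. U w p)"
      "(\<integral>w. (\<Sum>p\<in>J. (U w p)\<^sup>2) \<partial>M) \<le> \<alpha>\<^sup>2" "0 \<le> \<alpha>"
    and V: "\<And>p. p \<in> J \<Longrightarrow> second_moment M (\<lambda>w. V w p)"
      "(\<integral>w. (\<Sum>p\<in>J. (V w p)\<^sup>2) \<partial>M) \<le> \<beta>\<^sup>2" "0 \<le> \<beta>"
  shows "\<bar>\<integral>w. (\<Sum>p\<in>J. U w p * V w p) \<partial>M\<bar> \<le> \<alpha> * \<beta>"
proof -
  let ?a = "\<lambda>w. sqrt (\<Sum>p\<in>J. (U w p)\<^sup>2)" and ?b = "\<lambda>w. sqrt (\<Sum>p\<in>J. (V w p)\<^sup>2)"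
  have s: "second_moment M ?a" "second_moment M ?b"
    by (intro second_moment_norm J U V; assumption)+
  have "\<bar>\<integral>w. (\<Sum>p\<in>J. U w p * V w p) \<partial>M\<bar> \<le> (\<integral>w. \<bar>\<Sum>p\<in>J. U w p * V w p\<bar> \<partial>M)"
    by (rule integral_abs_bound)
  also have "\<dots> \<le> (\<integral>w. \<bar>?a w * ?b w\<bar> \<partial>M)"
    using integrable_second_mult[OF s] integrable_second_mult[OF U(1) V(1)]
    by (intro integral_mono integrable_abs Bochner_Integration.integrable_sum
          order_trans[OF abs_sum_mult_le abs_ge_self]) auto
  also have "\<dots> \<le> \<alpha> * \<beta>"
    by (rule Cauchy_Schwarz_integral[OF s(1) _ _ s(2)]) (use U V in \<open>simp_all add: sum_nonneg\<close>)
  finally show ?thesis .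
qed

lemma Hoelder_trilinear:
  assumes B: "finite B"
    and Z: "\<And>l m. l \<in> B \<Longrightarrow> m \<in> B \<Longrightarrow> second_moment M (\<lambda>w. Z w l m)"
      "(\<integral>w. (\<Sum>l\<in>B. \<Sum>m\<in>B. (Z w l m)\<^sup>2) \<partial>M) \<le> \<alpha>\<^sup>2" "0 \<le> \<alpha>"
    and y: "\<And>l. l \<in> B \<Longrightarrow> fourth_moment M (\<lambda>w. y w l)"
      "(\<integral>w. (\<Sum>l\<in>B. (y w l)\<^sup>2)\<^sup>2 \<partial>M) \<le> \<beta> ^ 4" "0 \<le> \<beta>"
    and v: "\<And>l. l \<in> B \<Longrightarrow> fourth_moment M (\<lambda>w. v w l)"
      "(\<integral>w. (\<Sum>l\<in>B. (v w l)\<^sup>2)\<^sup>2 \<partial>M) \<le> \<gamma> ^ 4" "0 \<le> \<gamma>"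
  shows "\<bar>\<integral>w. (\<Sum>l\<in>B. \<Sum>m\<in>B. Z w l m * (y w l * v w m)) \<partial>M\<bar> \<le> \<alpha> * (\<beta> * \<gamma>)"
proof -
  let ?a = "\<lambda>w. sqrt (\<Sum>l\<in>B. \<Sum>m\<in>B. (Z w l m)\<^sup>2)"
  let ?b = "\<lambda>w. sqrt (\<Sum>l\<in>B. (y w l)\<^sup>2)" and ?c = "\<lambda>w. sqrt (\<Sum>m\<in>B. (v w m)\<^sup>2)"
  have a: "second_moment M ?a"
    using second_moment_norm[of "B \<times> B" M "\<lambda>w (l, m). Z w l m"] B Z(1)
    by (auto simp: sum.cartesian_product case_prod_unfold)
  have b: "fourth_moment M ?b" and c: "fourth_moment M ?c"
    by (intro fourth_moment_norm B y v; assumption)+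
  have "\<bar>\<integral>w. (\<Sum>l\<in>B. \<Sum>m\<in>B. Z w l m * (y w l * v w m)) \<partial>M\<bar> \<le>
      (\<integral>w. \<bar>\<Sum>l\<in>B. \<Sum>m\<in>B. Z w l m * (y w l * v w m)\<bar> \<partial>M)"
    by (rule integral_abs_bound)
  also have "\<dots> \<le> (\<integral>w. \<bar>?a w * (?b w * ?c w)\<bar> \<partial>M)"
    using integrable_second_mult[OF a second_moment_mult[OF b c]]
      integrable_second_mult[OF Z(1) second_moment_mult[OF y(1) v(1)]]
    by (intro integral_mono integrable_abs Bochner_Integration.integrable_sum
          order_trans[OF abs_sum_trilinear_le abs_ge_self]) auto
  also have "\<dots> \<le> \<alpha> * (\<beta> * \<gamma>)"
  proof (rule Hoelder_2_4_4_integral[OF a _ _ b _ _ c])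
    have four: "(sqrt x) ^ 4 = x\<^sup>2" if "0 \<le> x" for x
      using that power_mult[of "sqrt x" 2 2] by simp
    show "(\<integral>w. (?b w) ^ 4 \<partial>M) \<le> \<beta> ^ 4" "(\<integral>w. (?c w) ^ 4 \<partial>M) \<le> \<gamma> ^ 4"
      using y v by (simp_all add: four sum_nonneg)
  qed (use Z y v in \<open>simp_all add: sum_nonneg\<close>)
  finally show ?thesis .
qed

text \<open>
  The difference of two tensor squares is the symmetrization of \<open>(x - y) \<otimes> (x + y)\<close>, and
  symmetrizing does not increase the norm.
\<close>

lemma tensor_square_diff_le:
  fixes x y :: "'i \<Rightarrow> real"
  shows "(\<Sum>l\<in>B. \<Sum>m\<in>B. (x l * x m - y l * y m)\<^sup>2) \<le>
    (\<Sum>l\<in>B. (x l - y l)\<^sup>2) * (\<Sum>l\<in>B. (x l + y l)\<^sup>2)"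
proof -
  have "(x l * x m - y l * y m)\<^sup>2 \<le>
      ((x l - y l)\<^sup>2 * (x m + y m)\<^sup>2 + (x l + y l)\<^sup>2 * (x m - y m)\<^sup>2) / 2" for l m
  proof -
    let ?p = "(x l - y l) * (x m + y m)" and ?q = "(x l + y l) * (x m - y m)"
    have e: "x l * x m - y l * y m = (?p + ?q) / 2" by (simp add: algebra_simps)
    have "((?p + ?q) / 2)\<^sup>2 \<le> (?p\<^sup>2 + ?q\<^sup>2) / 2"
      using sum_squares_bound[of ?p ?q] by (simp add: power_divide power2_sum)
    then show ?thesis unfolding e by (simp add: power_mult_distrib)
  qed
  then have "(\<Sum>l\<in>B. \<Sum>m\<in>B. (x l * x m - y l * y m)\<^sup>2) \<le>
      (\<Sum>l\<in>B. \<Sum>m\<in>B. ((x l - y l)\<^sup>2 * (x m + y m)\<^sup>2 + (x l + y l)\<^sup>2 * (x m - y m)\<^sup>2) / 2)"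
    by (intro sum_mono)
  also have "\<dots> = (\<Sum>l\<in>B. (x l - y l)\<^sup>2) * (\<Sum>l\<in>B. (x l + y l)\<^sup>2)"
    by (simp add: sum_divide_distrib[symmetric] sum.distrib sum_product[symmetric])
  finally show ?thesis .
qed

section \<open>Cutting an i.i.d. sequence at a time point\<close>

lemma integral_measure_preserving:
  fixes h :: "'b \<Rightarrow> real"
  assumes T: "T \<in> M \<rightarrow>\<^sub>M N" "distr M N T = N" and h: "h \<in> borel_measurable N"
  shows "(\<integral>w. h (T w) \<partial>M) = (\<integral>v. h v \<partial>N)"
  using integral_distr[OF T(1) h] T(2) by simp

lemma integrable_measure_preserving:
  fixes h :: "'b \<Rightarrow> real"
  assumes T: "T \<in> M \<rightarrow>\<^sub>M N" "distr M N T = N" and h: "h \<in> borel_measurable N"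
  shows "integrable M (\<lambda>w. h (T w)) \<longleftrightarrow> integrable N h"
  using integrable_distr_eq[OF T(1) h] T(2) by simp

lemma second_moment_measure_preserving:
  assumes T: "T \<in> M \<rightarrow>\<^sub>M N" "distr M N T = N" and h: "second_moment N h"
  shows "second_moment M (\<lambda>w. h (T w))"
  using h T(1) integrable_measure_preserving[OF T, of "\<lambda>v. (h v)\<^sup>2"]
  by (auto simp: second_moment_def)

lemma fourth_moment_measure_preserving:
  assumes T: "T \<in> M \<rightarrow>\<^sub>M N" "distr M N T = N" and h: "fourth_moment N h"
  shows "fourth_moment M (\<lambda>w. h (T w))"
  using h T(1) integrable_measure_preserving[OF T, of "\<lambda>v. (h v) ^ 4"]
  by (auto simp: fourth_moment_def)

text \<open>
  \<open>glue k w w'\<close> is the path \<open>w\<close> with its past up to time \<open>k\<close> replaced by that of \<open>w'\<close>. Applied to two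
  independent paths it produces the coupled sequence of approximability.
\<close>

definition glue :: "int \<Rightarrow> (int \<Rightarrow> 's) \<Rightarrow> (int \<Rightarrow> 's) \<Rightarrow> int \<Rightarrow> 's" where
  "glue k w w' = (\<lambda>j. if j \<le> k then w' j else w j)"

definition past_dependent :: "int \<Rightarrow> ((int \<Rightarrow> 's) \<Rightarrow> real) \<Rightarrow> bool" where
  "past_dependent k U \<longleftrightarrow> (\<forall>w w'. (\<forall>j\<le>k. w j = w' j) \<longrightarrow> U w = U w')"

locale iid_path = D: prob_space D for D :: "'s measure"
begin

abbreviation P :: "(int \<Rightarrow> 's) measure" where "P \<equiv> \<Pi>\<^sub>M j\<in>UNIV. D"
abbreviation PP :: "((int \<Rightarrow> 's) \<times> (int \<Rightarrow> 's)) measure" where "PP \<equiv> P \<Otimes>\<^sub>M P"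

sublocale P: prob_space P
  by (intro prob_space_PiM D.prob_space_axioms)

sublocale PP: pair_prob_space P P ..

lemma distr_reindex:
  assumes "inj \<phi>"
  shows "distr (\<Pi>\<^sub>M i\<in>UNIV. D) (\<Pi>\<^sub>M i\<in>UNIV. D) (\<lambda>w i. w (\<phi> i)) = (\<Pi>\<^sub>M i\<in>UNIV. D)"
  using distr_PiM_reindex[of UNIV "\<lambda>_. D" \<phi> UNIV] assms D.prob_space_axioms
  by (simp add: restrict_UNIV)

lemma measurable_reindex[measurable]:
  "(\<lambda>w i. w (\<phi> i)) \<in> (\<Pi>\<^sub>M i\<in>UNIV. D) \<rightarrow>\<^sub>M (\<Pi>\<^sub>M i\<in>UNIV. D)"
  by (intro measurable_PiM_single') (auto simp: space_PiM)

abbreviation split_pair :: "(bool \<times> int \<Rightarrow> 's) \<Rightarrow> (int \<Rightarrow> 's) \<times> (int \<Rightarrow> 's)" where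
  "split_pair w \<equiv> (\<lambda>j. w (False, j), \<lambda>j. w (True, j))"

lemma measurable_split_pair: "split_pair \<in> (\<Pi>\<^sub>M i\<in>UNIV. D) \<rightarrow>\<^sub>M PP"
  by (intro measurable_Pair measurable_reindex)

text \<open>
  A pair of independent i.i.d. paths is one i.i.d. family indexed by \<open>bool \<times> int\<close>; invariance
  properties of the pair then reduce to reindexing that family.
\<close>

lemma distr_split_pair: "distr (\<Pi>\<^sub>M i\<in>UNIV. D) PP split_pair = PP"
proof -
  let ?\<Theta> = "\<Pi>\<^sub>M i\<in>(UNIV :: (bool \<times> int) set). D"
  interpret \<Theta>: prob_space ?\<Theta> by (intro prob_space_PiM D.prob_space_axioms)
  have "\<Theta>.indep_vars (\<lambda>_. D) (\<lambda>i w. w i) UNIV"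
    by (subst \<Theta>.indep_vars_iff_distr_eq_PiM)
       (simp_all add: distr_PiM_component[OF D.prob_space_axioms] restrict_UNIV)
  then have i: "\<Theta>.indep_var (\<Pi>\<^sub>M i\<in>range (Pair False). D) (\<lambda>w. restrict w (range (Pair False)))
      (\<Pi>\<^sub>M i\<in>range (Pair True). D) (\<lambda>w. restrict w (range (Pair True)))"
    by (rule \<Theta>.indep_var_restrict) auto
  have c: "(\<lambda>v j. v (b, j)) \<in> (\<Pi>\<^sub>M i\<in>range (Pair b). D) \<rightarrow>\<^sub>M P" for b :: bool
  proof (rule measurable_PiM_single')
    show "(\<lambda>v. v (b, j)) \<in> (\<Pi>\<^sub>M i\<in>range (Pair b). D) \<rightarrow>\<^sub>M D" for j :: int
      by (rule measurable_component_singleton) simp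
    show "(\<lambda>v j. v (b, j)) \<in> space (\<Pi>\<^sub>M i\<in>range (Pair b). D) \<rightarrow> UNIV \<rightarrow>\<^sub>E space D"
      by (auto simp: space_PiM PiE_def)
  qed
  have "\<Theta>.indep_var P ((\<lambda>v j. v (False, j)) \<circ> (\<lambda>w. restrict w (range (Pair False))))
      P ((\<lambda>v j. v (True, j)) \<circ> (\<lambda>w. restrict w (range (Pair True))))"
    by (rule \<Theta>.indep_var_compose[OF i c c])
  then have "\<Theta>.indep_var P (\<lambda>w j. w (False, j)) P (\<lambda>w j. w (True, j))"
    by (simp add: comp_def)
  then have "distr ?\<Theta> P (\<lambda>w j. w (False, j)) \<Otimes>\<^sub>M distr ?\<Theta> P (\<lambda>w j. w (True, j)) =
      distr ?\<Theta> PP split_pair"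
    by (simp add: \<Theta>.indep_var_distribution_eq)
  then show ?thesis by (simp add: distr_reindex inj_on_def)
qed

lemma measurable_glue[measurable]:
  "(\<lambda>(w, w'). glue k w w') \<in> PP \<rightarrow>\<^sub>M P"
  unfolding glue_def case_prod_unfold
proof (rule measurable_PiM_single')
  show "(\<lambda>p j. if j \<le> k then snd p j else fst p j) \<in> space PP \<rightarrow> UNIV \<rightarrow>\<^sub>E space D"
    by (fastforce simp: space_PiM space_pair_measure PiE_iff)
qed measurable

lemma measurable_swap_pasts: "(\<lambda>(w, w'). (glue k w w', glue k w' w)) \<in> PP \<rightarrow>\<^sub>M PP"
proof -
  have "(\<lambda>(w, w'). glue k w w') \<circ> (\<lambda>(w, w'). (w', w)) \<in> PP \<rightarrow>\<^sub>M P"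
    by (rule measurable_comp[OF measurable_pair_swap' measurable_glue])
  also have "(\<lambda>(w, w'). glue k w w') \<circ> (\<lambda>(w, w'). (w', w)) = (\<lambda>(w, w'). glue k w' w)"
    by (rule ext) (simp only: comp_apply case_prod_unfold fst_conv snd_conv)
  finally have "(\<lambda>(w, w'). glue k w' w) \<in> PP \<rightarrow>\<^sub>M P" .
  from measurable_Pair[OF measurable_glue[of k] this] show ?thesis
    unfolding case_prod_unfold by this
qed

text \<open>
  Exchanging the pasts of two independent paths permutes the family indexed by \<open>bool \<times> int\<close>.
\<close>

lemma distr_swap_pasts: "distr PP PP (\<lambda>(w, w'). (glue k w w', glue k w' w)) = PP"
  (is "distr PP PP ?\<theta> = PP")
proof -
  let ?\<Theta> = "\<Pi>\<^sub>M i\<in>(UNIV :: (bool \<times> int) set). D"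
  define \<pi> :: "bool \<times> int \<Rightarrow> bool \<times> int" where
    "\<pi> = (\<lambda>(b, j). (if j \<le> k then \<not> b else b, j))"
  have inj: "inj \<pi>" by (auto simp: inj_on_def \<pi>_def split: if_splits)
  note m = measurable_swap_pasts[of k]
  have "distr PP PP ?\<theta> = distr (distr ?\<Theta> PP split_pair) PP ?\<theta>"
    by (simp add: distr_split_pair)
  also have "\<dots> = distr ?\<Theta> PP (?\<theta> \<circ> split_pair)"
    by (rule distr_distr[OF m measurable_split_pair])
  also have "?\<theta> \<circ> split_pair = split_pair \<circ> (\<lambda>w i. w (\<pi> i))"
    by (auto simp: glue_def \<pi>_def fun_eq_iff)
  also have "distr ?\<Theta> PP (split_pair \<circ> (\<lambda>w i. w (\<pi> i))) =
      distr (distr ?\<Theta> ?\<Theta> (\<lambda>w i. w (\<pi> i))) PP split_pair"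
    by (rule distr_distr[symmetric, OF measurable_split_pair measurable_reindex])
  also have "\<dots> = PP" by (simp add: distr_reindex[OF inj] distr_split_pair)
  finally show ?thesis .
qed

lemma distr_fst: "distr PP P fst = P"
  by (rule P.distr_pair_fst)

lemma distr_snd: "distr PP P snd = P"
proof -
  have *: "snd \<circ> (\<lambda>(x, y). (y, x)) = (fst :: (int \<Rightarrow> 's) \<times> (int \<Rightarrow> 's) \<Rightarrow> _)"
    by (rule ext) (simp add: case_prod_unfold)
  have "distr PP P snd = distr (distr PP PP (\<lambda>(x, y). (y, x))) P snd"
    using PP.distr_pair_swap by simp
  also have "\<dots> = distr PP P (snd \<circ> (\<lambda>(x, y). (y, x)))"
    by (rule distr_distr[OF measurable_snd measurable_pair_swap'])
  also have "\<dots> = P" unfolding * by (rule distr_fst)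
  finally show ?thesis .
qed

lemma distr_glue: "distr PP P (\<lambda>(w, w'). glue k w w') = P"
proof -
  have "distr PP P (\<lambda>(w, w'). glue k w w') =
      distr PP P (fst \<circ> (\<lambda>(w, w'). (glue k w w', glue k w' w)))"
    by (simp add: comp_def case_prod_unfold)
  also have "\<dots> = distr (distr PP PP (\<lambda>(w, w'). (glue k w w', glue k w' w))) P fst"
    by (rule distr_distr[symmetric, OF measurable_fst measurable_swap_pasts])
  finally show ?thesis by (simp add: distr_swap_pasts distr_fst)
qed

lemma past_dependent_glue:
  assumes "past_dependent k U"
  shows "U (glue k w w') = U w'"
  using assms unfolding past_dependent_def glue_def by force

lemma integral_product_PP:
  fixes U V :: "(int \<Rightarrow> 's) \<Rightarrow> real"
  assumes U: "integrable P U" and V: "integrable P V"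
  shows "integrable PP (\<lambda>(w, w'). U w * V w')"
    and "(\<integral>(w, w'). U w * V w' \<partial>PP) = (\<integral>w. U w \<partial>P) * (\<integral>w. V w \<partial>P)"
proof -
  note [measurable] = borel_measurable_integrable[OF U] borel_measurable_integrable[OF V]
  show i: "integrable PP (\<lambda>(w, w'). U w * V w')"
  proof (rule PP.Fubini_integrable)
    show "integrable P (\<lambda>x. \<integral>y. norm (case (x, y) of (w, w') \<Rightarrow> U w * V w') \<partial>P)"
      using U by (simp add: abs_mult)
    show "AE x in P. integrable P (\<lambda>y. case (x, y) of (w, w') \<Rightarrow> U w * V w')"
      using V by simp
  qed measurable
  show "(\<integral>(w, w'). U w * V w' \<partial>PP) = (\<integral>w. U w \<partial>P) * (\<integral>w. V w \<partial>P)"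
    using PP.integral_fst'[OF i] by simp
qed

text \<open>
  After exchanging pasts, \<open>U w\<close> becomes \<open>U\<close> of the second path while \<open>V (glue k w w')\<close> becomes \<open>V\<close> of
  the first one, so the two are independent; with \<open>U w'\<close> instead, both factors see the
  single path \<open>glue k w w'\<close>.
\<close>

lemma decouple_integral:
  assumes past: "past_dependent k U"
    and U: "integrable P U" and V: "integrable P V" and UV: "integrable P (\<lambda>w. U w * V w)"
  shows "integrable PP (\<lambda>(w, w'). U w * V (glue k w w'))" (is ?i1)
    and "(\<integral>(w, w'). U w * V (glue k w w') \<partial>PP) = (\<integral>w. U w \<partial>P) * (\<integral>w. V w \<partial>P)" (is ?e1)
    and "integrable PP (\<lambda>(w, w'). U w' * V (glue k w w'))" (is ?i2)
    and "(\<integral>(w, w'). U w' * V (glue k w w') \<partial>PP) = (\<integral>w. U w * V w \<partial>P)" (is ?e2)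
proof -
  note [measurable] = borel_measurable_integrable[OF U] borel_measurable_integrable[OF V]
  have *: "(\<lambda>x. case (case x of (w, w') \<Rightarrow> (glue k w w', glue k w' w)) of (w, w') \<Rightarrow> V w * U w')
      = (\<lambda>(w, w'). U w * V (glue k w w'))"
    by (auto simp: past_dependent_glue[OF past] mult.commute)
  have m: "(\<lambda>(w, w'). V w * U w') \<in> borel_measurable PP" by measurable
  show ?i1
    using integrable_measure_preserving[OF measurable_swap_pasts distr_swap_pasts m, of k]
      integral_product_PP(1)[OF V U] unfolding * by simp
  show ?e1
    using integral_measure_preserving[OF measurable_swap_pasts distr_swap_pasts m, of k]
      integral_product_PP(2)[OF V U] unfolding * by simp
  have **: "(\<lambda>x. U (case x of (w, w') \<Rightarrow> glue k w w') * V (case x of (w, w') \<Rightarrow> glue k w w'))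
      = (\<lambda>(w, w'). U w' * V (glue k w w'))"
    by (auto simp: past_dependent_glue[OF past])
  have m': "(\<lambda>w. U w * V w) \<in> borel_measurable P" by measurable
  show ?i2
    using integrable_measure_preserving[OF measurable_glue distr_glue m', of k] UV
    unfolding ** by simp
  show ?e2
    using integral_measure_preserving[OF measurable_glue distr_glue m', of k]
    unfolding ** by simp
qed

lemma covariance_decouple:
  assumes past: "past_dependent k U"
    and U: "integrable P U" and V: "integrable P V" and UV: "integrable P (\<lambda>w. U w * V w)"
  shows "(\<integral>w. U w * V w \<partial>P) - (\<integral>w. U w \<partial>P) * (\<integral>w. V w \<partial>P) =
    (\<integral>(w, w'). U w * (V w - V (glue k w w')) \<partial>PP)"
proof -
  note d = decouple_integral[OF assms]
  have m: "(\<lambda>w. U w * V w) \<in> borel_measurable P" using UV by measurable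
  have f: "integrable PP (\<lambda>(w, w'). U w * V w)" "(\<integral>(w, w'). U w * V w \<partial>PP) = (\<integral>w. U w * V w \<partial>P)"
    using integrable_measure_preserving[OF measurable_fst distr_fst m]
      integral_measure_preserving[OF measurable_fst distr_fst m] UV
    by (simp_all add: case_prod_unfold)
  have "(\<integral>(w, w'). U w * (V w - V (glue k w w')) \<partial>PP) =
    (\<integral>x. (case x of (w, w') \<Rightarrow> U w * V w) - (case x of (w, w') \<Rightarrow> U w * V (glue k w w')) \<partial>PP)"
    by (intro Bochner_Integration.integral_cong) (auto simp: right_diff_distrib)
  also have "\<dots> = (\<integral>w. U w * V w \<partial>P) - (\<integral>w. U w \<partial>P) * (\<integral>w. V w \<partial>P)"
    by (subst Bochner_Integration.integral_diff[OF f(1) d(1)]) (simp add: f d)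
  finally show ?thesis by simp
qed

text \<open>
  Of the four products on the right-hand side the two diagonal ones integrate to \<open>E (U V)\<close> and the two
  mixed ones to \<open>E U * E V\<close>. Compared with \<open>covariance_decouple\<close> the first factor becomes
  a difference of independent copies; its second moment is at most \<open>2 E U\<^sup>2\<close>, so dividing by two
  saves a factor \<open>sqrt 2\<close> in the Cauchy--Schwarz inequality.
\<close>

lemma covariance_decouple_symmetric:
  assumes past: "past_dependent k U"
    and U: "integrable P U" and V: "integrable P V" and UV: "integrable P (\<lambda>w. U w * V w)"
  shows "(\<integral>w. U w * V w \<partial>P) - (\<integral>w. U w \<partial>P) * (\<integral>w. V w \<partial>P) =
    (\<integral>(w, w'). (U w - U w') * (V w - V (glue k w w')) \<partial>PP) / 2"
proof -
  note d = decouple_integral[OF assms] and p = integral_product_PP[OF V U]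
  have m: "(\<lambda>w. U w * V w) \<in> borel_measurable P" using UV by measurable
  have f: "integrable PP (\<lambda>(w, w'). U w * V w)" "(\<integral>(w, w'). U w * V w \<partial>PP) = (\<integral>w. U w * V w \<partial>P)"
    using integrable_measure_preserving[OF measurable_fst distr_fst m]
      integral_measure_preserving[OF measurable_fst distr_fst m] UV
    by (simp_all add: case_prod_unfold)
  have "(\<integral>(w, w'). (U w - U w') * (V w - V (glue k w w')) \<partial>PP) =
    (\<integral>x. ((case x of (w, w') \<Rightarrow> U w * V w) - (case x of (w, w') \<Rightarrow> U w * V (glue k w w'))) -
      ((case x of (w, w') \<Rightarrow> V w * U w') - (case x of (w, w') \<Rightarrow> U w' * V (glue k w w'))) \<partial>PP)"
    by (intro Bochner_Integration.integral_cong) (auto simp: algebra_simps)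
  also have "\<dots> = 2 * ((\<integral>w. U w * V w \<partial>P) - (\<integral>w. U w \<partial>P) * (\<integral>w. V w \<partial>P))"
    by (subst Bochner_Integration.integral_diff Bochner_Integration.integral_diff
          | intro Bochner_Integration.integrable_diff f d p)+ (simp add: f d p)
  finally show ?thesis by simp
qed

abbreviation shift :: "int \<Rightarrow> (int \<Rightarrow> 's) \<Rightarrow> int \<Rightarrow> 's" where
  "shift n w \<equiv> \<lambda>j. w (j + n)"

lemma distr_shift: "distr P P (shift n) = P"
  by (rule distr_reindex) (auto simp: inj_on_def)

lemma measurable_shift_pair: "(\<lambda>(w, w'). (shift n w, shift n w')) \<in> PP \<rightarrow>\<^sub>M PP"
  unfolding case_prod_unfold
  by (intro measurable_Pair measurable_compose[OF measurable_fst measurable_reindex]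
        measurable_compose[OF measurable_snd measurable_reindex])

lemma distr_shift_pair: "distr PP PP (\<lambda>(w, w'). (shift n w, shift n w')) = PP"
  using pair_measure_distr[of "shift n" P P "shift n" P P] P.sigma_finite_measure_axioms
  by (simp add: distr_shift measurable_reindex)

end

section \<open>The numerical inequality behind the constant\<close>

lemma sqrt2_bounds: "141421 / 100000 \<le> sqrt 2" "sqrt 2 \<le> 141422 / 100000"
  by (rule real_le_rsqrt, simp add: power2_eq_square) (rule real_le_lsqrt, simp_all add: power2_eq_square)

text \<open>
  Here \<open>x\<close> stands for \<open>1 / N\<close> and the fourth moment is normalized to one. Since \<open>s + c \<le> sqrt 2\<close>, the
  first bound on \<open>Q\<close> is at most \<open>1 + c\<^sup>2 + 4 t\<close>, which is good enough when \<open>c\<^sup>2 \<le> (4 sqrt 2 - 4) t\<close>. In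
  the opposite case \<open>t\<close> is small compared with \<open>c\<^sup>2 = 1 - s\<^sup>2\<close>, so the variance factor
  \<open>s\<^sup>2 + 2 sqrt 2 s t\<close> is at most 1.14. The second bound then has the coefficient
  \<open>(1 - x) (5.6456 + 4.6716 x)\<close> of \<open>t\<close>, which is at most \<open>5.6456 < 4 sqrt 2\<close>.
\<close>

lemma centering_bound:
  fixes s c t x :: real
  assumes s: "0 \<le> s" and c: "0 \<le> c" and sc: "s\<^sup>2 + c\<^sup>2 = 1" and t: "0 \<le> t"
    and x: "0 \<le> x" "x \<le> 1"
    and QA: "Q \<le> s\<^sup>2 + 2 * sqrt 2 * s * t * (1 - x) + 2 * (c\<^sup>2 + sqrt 2 * c * t * (1 - x))"
    and QB: "Q \<le> (1 - x) * (s\<^sup>2 + 2 * sqrt 2 * s * t * (1 - x)) + (c\<^sup>2 + sqrt 2 * c * t * (1 - x))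
      + (1 - x) * t * (s + sqrt 2 * (1 - 2 * x) + 2 * x * (2 + s) + 15/100 * (1 - 2 * x)
          + x * (s\<^sup>2 + 2 * sqrt 2 * s * t) / (3/10))"
  shows "Q \<le> 1 + 4 * sqrt 2 * t"
proof -
  define q where "q = sqrt (2::real)"
  have qb: "141421 / 100000 \<le> q" "q \<le> 141422 / 100000" and q2: "q * q = 2"
    using sqrt2_bounds by (auto simp: q_def)
  have s1: "s \<le> 1" and c1: "c \<le> 1"
    using sc s c power2_le_imp_le[of s 1] power2_le_imp_le[of c 1] zero_le_power2[of s]
      zero_le_power2[of c] by auto
  have cs: "\<alpha> * s + \<beta> * c \<le> \<gamma>" if "\<alpha>\<^sup>2 + \<beta>\<^sup>2 \<le> \<gamma>\<^sup>2" "0 \<le> \<gamma>" for \<alpha> \<beta> \<gamma> :: real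
  proof (rule power2_le_imp_le)
    have "(\<alpha> * s + \<beta> * c)\<^sup>2 + (\<alpha> * c - \<beta> * s)\<^sup>2 = (\<alpha>\<^sup>2 + \<beta>\<^sup>2) * (s\<^sup>2 + c\<^sup>2)"
      by (simp add: power2_eq_square algebra_simps)
    then have "(\<alpha> * s + \<beta> * c)\<^sup>2 \<le> \<alpha>\<^sup>2 + \<beta>\<^sup>2"
      unfolding sc mult_1_right by (metis le_add_same_cancel1 zero_le_power2)
    then show "(\<alpha> * s + \<beta> * c)\<^sup>2 \<le> \<gamma>\<^sup>2" using that(1) by simp
  qed fact
  show ?thesis
  proof (cases "c\<^sup>2 \<le> (4 * q - 4) * t")
    case True
    have "s + c \<le> q" using cs[of 1 1 q] qb q2 by (simp add: power2_eq_square)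
    then have "2 * q * (s + c) * t \<le> 2 * q * q * t"
      using qb t by (intro mult_right_mono mult_left_mono) auto
    moreover have "2 * q * (s + c) * t * (1 - x) \<le> 2 * q * (s + c) * t"
      using qb s c t x by (intro mult_left_le) auto
    moreover have "Q \<le> s\<^sup>2 + 2 * c\<^sup>2 + 2 * q * (s + c) * t * (1 - x)"
      using QA unfolding q_def by (simp add: algebra_simps)
    moreover have "2 * q * q * t = 4 * t" using q2 by (simp add: mult.assoc)
    ultimately have "Q \<le> 1 + c\<^sup>2 + 4 * t" using sc by linarith
    then show ?thesis using True unfolding q_def by (simp add: algebra_simps)
  next
    case False
    \<comment> \<open>The exact factor is \<open>2 q / (4 q - 4) = (2 + q) / 2\<close>, which is slightly smaller than 1.7072.\<close>
    have "2 * q * t \<le> 17072 / 10000 * c\<^sup>2"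
    proof -
      have "1656 / 1000 * t \<le> (4 * q - 4) * t" using qb t by (intro mult_right_mono) auto
      moreover have "2 * q * t \<le> 17072/10000 * ((4 * q - 4) * t)"
      proof -
        have "2 * q \<le> 17072/10000 * (4 * q - 4)" using qb by simp
        from mult_right_mono[OF this t] show ?thesis by (simp add: algebra_simps)
      qed
      ultimately show ?thesis using False by simp
    qed
    from mult_left_mono[OF this s] have "2 * q * s * t \<le> 17072 / 10000 * s * c\<^sup>2"
      by (simp add: algebra_simps)
    then have "2 * q * s * t \<le> 17072 / 10000 * s * (1 - s\<^sup>2)"
      using sc by (simp add: eq_diff_eq[symmetric] add.commute)
    moreover have "s\<^sup>2 + 17072 / 10000 * s * (1 - s\<^sup>2) \<le> 114/100"
    proof -
      \<comment> \<open>The cubic on the left has its minimum on \<open>{0..1}\<close> near 0.804; dividing by \<open>(s - 0.804)\<^sup>2\<close> leaves a positive remainder.\<close>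
      have "114/100 - (s\<^sup>2 + 17072 / 10000 * s * (1 - s\<^sup>2)) =
        (s - 804/1000)\<^sup>2 * (17072/10000 * s + 17452/10000) +
        (118747968 - 44797952 * s - 224000 * s\<^sup>2) / 10000000000"
        by (simp add: power2_eq_square field_simps)
      moreover have "0 \<le> (s - 804/1000)\<^sup>2 * (17072/10000 * s + 17452/10000)"
        using s by simp
      moreover have "0 \<le> (118747968 - 44797952 * s - 224000 * s\<^sup>2) / 10000000000"
        using s s1 mult_right_mono[OF s1 s] by (simp add: power2_eq_square)
      ultimately show ?thesis by linarith
    qed
    ultimately have p: "s\<^sup>2 + 2 * q * s * t \<le> 114/100" by simp
    then have "x * (s\<^sup>2 + 2 * q * s * t) / (3/10) \<le> x * (38/10)"
      using mult_left_mono[OF p x(1)] by simp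
    then have "(1 - x) * t * (s + q * (1 - 2 * x) + 2 * x * (2 + s) + 15/100 * (1 - 2 * x)
          + x * (s\<^sup>2 + 2 * q * s * t) / (3/10)) \<le>
        (1 - x) * t * (s + q * (1 - 2 * x) + 2 * x * (2 + s) + 15/100 * (1 - 2 * x) + x * (38/10))"
      using x t by (intro mult_left_mono) auto
    with QB have "Q \<le> (1 - x) * (s\<^sup>2 + 2 * q * s * t * (1 - x)) + (c\<^sup>2 + q * c * t * (1 - x))
      + (1 - x) * t * (s + q * (1 - 2 * x) + 2 * x * (2 + s) + 15/100 * (1 - 2 * x) + x * (38/10))"
      unfolding q_def by linarith
    also have "\<dots> = ((1 - x) * s\<^sup>2 + c\<^sup>2) + t * ((1 - x) * ((2 * q + 1) * s + q * c + q + 15/100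
        + x * (- 2 * q * s + 2 * s - 2 * q + 75/10)))"
      by (simp add: field_simps power2_eq_square)
    also have "\<dots> \<le> 1 + t * (4 * q)"
    proof (rule add_mono)
      have "0 \<le> x * s\<^sup>2" using x by simp
      then show "(1 - x) * s\<^sup>2 + c\<^sup>2 \<le> 1" using sc by (simp add: algebra_simps)
      have "(2 * q + 1) * s + q * c \<le> 40813/10000"
        using qb q2 by (intro cs) (simp_all add: power2_eq_square algebra_simps)
      moreover have "x * (- 2 * q * s + 2 * s - 2 * q + 75/10) \<le> x * (46716/10000)"
      proof (rule mult_left_mono[OF _ x(1)])
        have "2 * s \<le> 2 * q * s" using qb s mult_right_mono[of 1 q s] by simp
        then show "- 2 * q * s + 2 * s - 2 * q + 75/10 \<le> 46716/10000" using qb by simp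
      qed
      ultimately have "(1 - x) * ((2 * q + 1) * s + q * c + q + 15/100
          + x * (- 2 * q * s + 2 * s - 2 * q + 75/10)) \<le> (1 - x) * (56456/10000 + x * (46716/10000))"
        using x qb by (intro mult_left_mono) auto
      also have "\<dots> \<le> 56456/10000"
        using x mult_nonneg_nonneg[OF x(1) x(1)] by (simp add: field_simps)
      also have "\<dots> \<le> 4 * q" using qb by simp
      finally show "t * ((1 - x) * ((2 * q + 1) * s + q * c + q + 15/100
          + x * (- 2 * q * s + 2 * s - 2 * q + 75/10))) \<le> t * (4 * q)"
        using t by (rule mult_left_mono)
    qed
    finally show ?thesis by (simp add: q_def mult_ac)
  qed
qed

lemma sum_real_upto: "(\<Sum>q=1..N. real q) = real N * (real N + 1) / 2"
  by (induction N) (auto simp: field_simps)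

text \<open>
  Dividing by \<open>a\<^sup>2\<close> reduces the claim to \<open>centering_bound\<close>. The square roots \<open>r k\<close> of the variances of
  the partial sums are made linear in \<open>k\<close> by the arithmetic-geometric mean inequality. Its weight
  15/100 has to be small, because it stays in the coefficient of \<open>t\<close> for large \<open>N\<close>, but not too
  small, because the other term it produces, of order \<open>1 / N\<close>, must be absorbed for every \<open>N\<close>.
\<close>

lemma centering_bound_scaled:
  fixes s c a t :: real and N :: nat
  assumes s: "0 \<le> s" and c: "0 \<le> c" and sc: "s\<^sup>2 + c\<^sup>2 = a\<^sup>2" and a: "0 \<le> a" and t: "0 \<le> t"
    and N: "1 \<le> N"
    and V: "V \<le> real N * s\<^sup>2 + 2 * sqrt 2 * s * t * (real N - 1)"
    and G: "G \<le> real N * c\<^sup>2 + sqrt 2 * c * t * (real N - 1)"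
    and r: "\<And>k. 0 \<le> r k \<and> (r k)\<^sup>2 \<le> real k * (s\<^sup>2 + 2 * sqrt 2 * s * t)"
    and K: "- K \<le> 2 * t * (\<Sum>q=1..N-1. r (q - 1) + real q * s + real (q - 1) * (sqrt 2 * a) + (2 * a + s))"
    and QA: "Q \<le> V / real N + 2 * (G / real N)"
    and QB: "Q \<le> V / real N - (V + K) / (real N)\<^sup>2 + G / real N"
  shows "Q \<le> a\<^sup>2 + 4 * sqrt 2 * a * t"
proof (cases "a = 0")
  case True
  then have "s = 0 \<and> c = 0" using sc by (simp add: sum_power2_eq_zero_iff)
  then have "V \<le> 0" "G \<le> 0" using V G by auto
  then have "V / real N + 2 * (G / real N) \<le> 0" using N by (simp add: divide_nonpos_pos add_nonpos_nonpos)
  then show ?thesis using QA True by simp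
next
  case False
  then have a0: "0 < a" using a by simp
  define x where "x = 1 / real N"
  have n: "real N * x = 1" using N by (simp add: x_def)
  have x: "0 < x" "x \<le> 1" using N by (auto simp: x_def)
  define p where "p = s\<^sup>2 + 2 * sqrt 2 * s * t"
  have p0: "0 \<le> p" using s t by (simp add: p_def)
  have rk: "r k \<le> 15/100 * a * real k + p / (6/10 * a)" for k
  proof (rule power2_le_imp_le)
    let ?u = "15/100 * a * real k" and ?v = "p / (6/10 * a)"
    have "(?u + ?v)\<^sup>2 = (?u - ?v)\<^sup>2 + 4 * (?u * ?v)" by (simp add: power2_eq_square algebra_simps)
    also have "4 * (?u * ?v) = real k * p" using a0 by simp
    finally show "(r k)\<^sup>2 \<le> (?u + ?v)\<^sup>2"
      using r[of k] zero_le_power2[of "?u - ?v"] unfolding p_def[symmetric] by linarith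
  qed (use a0 p0 in simp)
  have m: "real (N - 1) = real N - 1" using N by simp
  have "(\<Sum>q=1..N-1. r (q - 1) + real q * s + real (q - 1) * (sqrt 2 * a) + (2 * a + s)) \<le>
    (\<Sum>q=1..N-1. (15/100 * a * (real q - 1) + p / (6/10 * a)) + real q * s + (real q - 1) * (sqrt 2 * a) + (2 * a + s))"
  proof (rule sum_mono)
    fix q assume "q \<in> {1..N-1}"
    then have "real (q - 1) = real q - 1" by auto
    then show "r (q - 1) + real q * s + real (q - 1) * (sqrt 2 * a) + (2 * a + s) \<le>
      (15/100 * a * (real q - 1) + p / (6/10 * a)) + real q * s + (real q - 1) * (sqrt 2 * a) + (2 * a + s)"
      using rk[of "q - 1"] by simp
  qed
  also have "\<dots> = (\<Sum>q=1..N-1. real q * (15/100 * a + s + sqrt 2 * a) +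
      (p / (6/10 * a) + 2 * a + s - 15/100 * a - sqrt 2 * a))"
    by (intro sum.cong refl) (simp add: algebra_simps diff_divide_distrib)
  also have "\<dots> = (real N - 1) * real N / 2 * (15/100 * a + s + sqrt 2 * a) +
      (real N - 1) * (p / (6/10 * a) + 2 * a + s - 15/100 * a - sqrt 2 * a)"
  proof -
    have "(\<Sum>q=1..N-1. real q) = (real N - 1) * real N / 2"
      unfolding sum_real_upto m by simp
    then show ?thesis by (simp add: sum.distrib sum_distrib_right[symmetric] m del: One_nat_def)
  qed
  finally have "- K \<le> 2 * t * ((real N - 1) * real N / 2 * (15/100 * a + s + sqrt 2 * a) +
      (real N - 1) * (p / (6/10 * a) + 2 * a + s - 15/100 * a - sqrt 2 * a))"
    using K mult_left_mono[of _ _ "2 * t"] t by (smt (verit))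
  from mult_right_mono[OF this, of "x\<^sup>2"] have
    "- K * x\<^sup>2 \<le> 2 * t * ((real N - 1) * real N / 2 * (15/100 * a + s + sqrt 2 * a) +
      (real N - 1) * (p / (6/10 * a) + 2 * a + s - 15/100 * a - sqrt 2 * a)) * x\<^sup>2" by simp
  also have "\<dots> = t * ((real N * x - x) * (real N * x) * (15/100 * a + s + sqrt 2 * a)) +
      2 * t * ((real N * x - x) * x * (p / (6/10 * a) + 2 * a + s - 15/100 * a - sqrt 2 * a))"
    by (simp add: power2_eq_square algebra_simps diff_divide_distrib add_divide_distrib)
  also have "\<dots> = (1 - x) * t * (s + sqrt 2 * a * (1 - 2 * x) + 2 * x * (2 * a + s) + 15/100 * a * (1 - 2 * x)
          + x * p / (3/10 * a))"
    unfolding n using a0 by (simp add: field_simps)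
  finally have K': "- K * x\<^sup>2 \<le> (1 - x) * t * (s + sqrt 2 * a * (1 - 2 * x) + 2 * x * (2 * a + s)
      + 15/100 * a * (1 - 2 * x) + x * p / (3/10 * a))" .
  have V': "V * x \<le> s\<^sup>2 + 2 * sqrt 2 * s * t * (1 - x)"
  proof -
    have "V * x \<le> (real N * s\<^sup>2 + 2 * sqrt 2 * s * t * (real N - 1)) * x"
      using V x by (intro mult_right_mono) auto
    also have "\<dots> = (real N * x) * s\<^sup>2 + 2 * sqrt 2 * s * t * (real N * x - x)"
      by (simp add: algebra_simps)
    finally show ?thesis unfolding n by simp
  qed
  have G': "G * x \<le> c\<^sup>2 + sqrt 2 * c * t * (1 - x)"
  proof -
    have "G * x \<le> (real N * c\<^sup>2 + sqrt 2 * c * t * (real N - 1)) * x"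
      using G x by (intro mult_right_mono) auto
    also have "\<dots> = (real N * x) * c\<^sup>2 + sqrt 2 * c * t * (real N * x - x)"
      by (simp add: algebra_simps)
    finally show ?thesis unfolding n by simp
  qed
  have QA': "Q \<le> V * x + 2 * (G * x)" using QA by (simp add: x_def)
  have "V / real N - (V + K) / (real N)\<^sup>2 + G / real N = (1 - x) * (V * x) + - K * x\<^sup>2 + G * x"
    by (simp add: x_def power2_eq_square algebra_simps diff_divide_distrib add_divide_distrib)
  then have QB': "Q \<le> (1 - x) * (V * x) + - K * x\<^sup>2 + G * x" using QB by simp
  have "(1 - x) * (V * x) \<le> (1 - x) * (s\<^sup>2 + 2 * sqrt 2 * s * t * (1 - x))"
    using V' x by (intro mult_left_mono) auto
  with QB' K' G' have QB'': "Q \<le> (1 - x) * (s\<^sup>2 + 2 * sqrt 2 * s * t * (1 - x))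
      + (c\<^sup>2 + sqrt 2 * c * t * (1 - x)) + (1 - x) * t * (s + sqrt 2 * a * (1 - 2 * x)
      + 2 * x * (2 * a + s) + 15/100 * a * (1 - 2 * x) + x * p / (3/10 * a))"
    by linarith
  have QA'': "Q \<le> s\<^sup>2 + 2 * sqrt 2 * s * t * (1 - x) + 2 * (c\<^sup>2 + sqrt 2 * c * t * (1 - x))"
    by (rule order_trans[OF QA' add_mono[OF V' mult_left_mono[OF G']]]) simp
  have "Q / a\<^sup>2 \<le> 1 + 4 * sqrt 2 * (t / a)"
  proof (rule centering_bound[of "s / a" "c / a" "t / a" x])
    show "(s / a)\<^sup>2 + (c / a)\<^sup>2 = 1"
      using sc a0 by (simp add: power_divide add_divide_distrib[symmetric])
    have "Q / a\<^sup>2 \<le> (s\<^sup>2 + 2 * sqrt 2 * s * t * (1 - x) + 2 * (c\<^sup>2 + sqrt 2 * c * t * (1 - x))) / a\<^sup>2"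
      using QA'' by (intro divide_right_mono) auto
    also have "\<dots> = (s / a)\<^sup>2 + 2 * sqrt 2 * (s / a) * (t / a) * (1 - x) +
        2 * ((c / a)\<^sup>2 + sqrt 2 * (c / a) * (t / a) * (1 - x))"
      using a0 by (simp add: power2_eq_square field_simps)
    finally show "Q / a\<^sup>2 \<le> \<dots>" .
    have "Q / a\<^sup>2 \<le> ((1 - x) * (s\<^sup>2 + 2 * sqrt 2 * s * t * (1 - x))
      + (c\<^sup>2 + sqrt 2 * c * t * (1 - x)) + (1 - x) * t * (s + sqrt 2 * a * (1 - 2 * x)
      + 2 * x * (2 * a + s) + 15/100 * a * (1 - 2 * x) + x * p / (3/10 * a))) / a\<^sup>2"
      using QB'' by (intro divide_right_mono) auto
    also have "\<dots> = (1 - x) * ((s / a)\<^sup>2 + 2 * sqrt 2 * (s / a) * (t / a) * (1 - x)) +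
        ((c / a)\<^sup>2 + sqrt 2 * (c / a) * (t / a) * (1 - x)) +
        (1 - x) * (t / a) * (s / a + sqrt 2 * (1 - 2 * x) + 2 * x * (2 + s / a) +
          15/100 * (1 - 2 * x) + x * ((s / a)\<^sup>2 + 2 * sqrt 2 * (s / a) * (t / a)) / (3/10))"
      using a0 unfolding p_def by (simp add: power2_eq_square field_simps)
    finally show "Q / a\<^sup>2 \<le> \<dots>" .
  qed (use s c t a0 x in auto)
  then have "Q \<le> (1 + 4 * sqrt 2 * (t / a)) * a\<^sup>2" using a0 by (simp add: pos_divide_le_eq)
  also have "\<dots> = a\<^sup>2 + 4 * sqrt 2 * a * t" using a0 by (simp add: power2_eq_square field_simps)
  finally show ?thesis .
qed

section \<open>Hilbert--Schmidt algebra of finite matrices\<close>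

definition hs_inner :: "'i set \<Rightarrow> ('i \<Rightarrow> 'i \<Rightarrow> real) \<Rightarrow> ('i \<Rightarrow> 'i \<Rightarrow> real) \<Rightarrow> real" where
  "hs_inner B K L = (\<Sum>l\<in>B. \<Sum>m\<in>B. K l m * L l m)"

definition tensor :: "('i \<Rightarrow> real) \<Rightarrow> ('i \<Rightarrow> real) \<Rightarrow> 'i \<Rightarrow> 'i \<Rightarrow> real" where
  "tensor x y = (\<lambda>l m. x l * y m)"

lemma hs_inner_add_left:
  "hs_inner B (\<lambda>l m. K l m + K' l m) L = hs_inner B K L + hs_inner B K' L"
  by (simp add: hs_inner_def distrib_right sum.distrib)

lemma hs_inner_add_right:
  "hs_inner B K (\<lambda>l m. L l m + L' l m) = hs_inner B K L + hs_inner B K L'"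
  by (simp add: hs_inner_def distrib_left sum.distrib)

lemma hs_inner_diff_right:
  "hs_inner B K (\<lambda>l m. L l m - L' l m) = hs_inner B K L - hs_inner B K L'"
  by (simp add: hs_inner_def right_diff_distrib sum_subtractf)

lemma hs_inner_diff_left:
  "hs_inner B (\<lambda>l m. K l m - K' l m) L = hs_inner B K L - hs_inner B K' L"
  by (simp add: hs_inner_def left_diff_distrib sum_subtractf)

lemma hs_inner_cmult_left: "hs_inner B (\<lambda>l m. r * K l m) L = r * hs_inner B K L"
  by (simp add: hs_inner_def sum_distrib_left mult.assoc)

lemma hs_inner_cmult_right: "hs_inner B K (\<lambda>l m. r * L l m) = r * hs_inner B K L"
  by (simp add: hs_inner_def sum_distrib_left mult_ac)

lemma hs_inner_zero: "hs_inner B (\<lambda>l m. 0) L = 0" "hs_inner B K (\<lambda>l m. 0) = 0"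
  by (simp_all add: hs_inner_def)

lemma hs_inner_sum_left:
  "hs_inner B (\<lambda>l m. \<Sum>i\<in>I. K i l m) L = (\<Sum>i\<in>I. hs_inner B (K i) L)"
  by (induction I rule: infinite_finite_induct)
     (simp_all add: hs_inner_add_left hs_inner_zero)

lemma hs_inner_sum_right:
  "hs_inner B K (\<lambda>l m. \<Sum>i\<in>I. L i l m) = (\<Sum>i\<in>I. hs_inner B K (L i))"
  by (induction I rule: infinite_finite_induct)
     (simp_all add: hs_inner_add_right hs_inner_zero)

lemma hs_inner_commute: "hs_inner B K L = hs_inner B L K"
  by (simp add: hs_inner_def mult.commute)

lemma hs_inner_self: "hs_inner B K K = (\<Sum>l\<in>B. \<Sum>m\<in>B. (K l m)\<^sup>2)"
  by (simp add: hs_inner_def power2_eq_square)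

lemma hs_inner_self_nonneg: "0 \<le> hs_inner B K K"
  by (simp add: hs_inner_self sum_nonneg)

lemma hs_inner_tensor_swap:
  assumes "\<And>l m. K l m = K m l"
  shows "hs_inner B K (tensor x y) = hs_inner B K (tensor y x)"
  unfolding hs_inner_def tensor_def
  by (subst sum.swap) (simp add: assms mult.commute)

lemma hs_inner_tensor_tensor:
  "hs_inner B (tensor x x) (tensor y y) = (\<Sum>l\<in>B. x l * y l)\<^sup>2"
  by (simp add: hs_inner_def tensor_def power2_eq_square sum_product mult_ac)

lemma tensor_add_left: "tensor (\<lambda>l. x l + x' l) y = (\<lambda>l m. tensor x y l m + tensor x' y l m)"
  by (simp add: tensor_def distrib_right)

lemma tensor_add_right: "tensor x (\<lambda>l. y l + y' l) = (\<lambda>l m. tensor x y l m + tensor x y' l m)"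
  by (simp add: tensor_def distrib_left)

lemma tensor_sum_left: "tensor (\<lambda>l. \<Sum>i\<in>I. x i l) y = (\<lambda>l m. \<Sum>i\<in>I. tensor (x i) y l m)"
  by (simp add: tensor_def sum_distrib_right)

text \<open>
  Jensen's inequality for the uniform distribution on \<open>{1..N}\<close>.
\<close>

lemma square_mean_le_mean_square:
  fixes a :: "nat \<Rightarrow> real"
  assumes "1 \<le> N"
  shows "((\<Sum>n=1..N. a n) / real N)\<^sup>2 \<le> (\<Sum>n=1..N. (a n)\<^sup>2) / real N"
proof -
  have "(\<Sum>n=1..N. a n)\<^sup>2 \<le> real N * (\<Sum>n=1..N. (a n)\<^sup>2)"
    using Cauchy_Schwarz_ineq_sum[of a "\<lambda>_. 1" "{1..N}"] by (simp add: mult.commute)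
  then have "(\<Sum>n=1..N. a n)\<^sup>2 / (real N)\<^sup>2 \<le> real N * (\<Sum>n=1..N. (a n)\<^sup>2) / (real N)\<^sup>2"
    by (intro divide_right_mono) auto
  then show ?thesis using assms by (simp add: power_divide power2_eq_square)
qed

text \<open>
  With \<open>b = tensor Xb Xb\<close> one has \<open>E = A - b\<close>, and \<open>A + c\<close> is the uncentered empirical covariance.
  Jensen's inequality gives \<open>\<parallel>b\<parallel>\<^sup>2 \<le> \<langle>A + c, b\<rangle>\<close>. Inserting this once into
  \<open>\<parallel>A\<parallel>\<^sup>2 - 2 \<langle>A, b\<rangle> + \<parallel>b\<parallel>\<^sup>2\<close> yields the second bound, inserting it twice and discarding
  \<open>- \<parallel>b\<parallel>\<^sup>2\<close> yields the first.
\<close>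

lemma centered_covariance_bounds:
  fixes X :: "nat \<Rightarrow> 'i \<Rightarrow> real" and c :: "'i \<Rightarrow> 'i \<Rightarrow> real"
  assumes N: "1 \<le> N"
  defines "Xb \<equiv> \<lambda>l. (\<Sum>n=1..N. X n l) / real N"
  defines "A \<equiv> \<lambda>l m. (\<Sum>n=1..N. tensor (X n) (X n) l m - c l m) / real N"
  defines "E \<equiv> \<lambda>l m. (\<Sum>n=1..N. (X n l - Xb l) * (X n m - Xb m)) / real N - c l m"
  shows "hs_inner B E E \<le> hs_inner B A A + 2 * hs_inner B c (tensor Xb Xb)"
    and "hs_inner B E E \<le> hs_inner B A A - hs_inner B A (tensor Xb Xb) + hs_inner B c (tensor Xb Xb)"
proof -
  let ?b = "tensor Xb Xb"
  have n0: "real N \<noteq> 0" using N by simp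
  have S: "(\<Sum>n=1..N. X n l) = real N * Xb l" for l using n0 by (simp add: Xb_def)
  have E: "E = (\<lambda>l m. A l m - ?b l m)"
  proof (intro ext)
    fix l m
    have "(\<Sum>n=1..N. (X n l - Xb l) * (X n m - Xb m)) =
        (\<Sum>n=1..N. X n l * X n m) - Xb m * (\<Sum>n=1..N. X n l) - Xb l * (\<Sum>n=1..N. X n m) + real N * (Xb l * Xb m)"
      by (simp add: algebra_simps sum.distrib sum_subtractf sum_distrib_left)
    also have "\<dots> = (\<Sum>n=1..N. X n l * X n m) - real N * (Xb l * Xb m)"
      unfolding S by (simp add: algebra_simps)
    finally show "E l m = A l m - ?b l m"
      using n0 by (simp add: E_def A_def tensor_def sum_subtractf diff_divide_distrib)
  qed
  have AC: "(\<lambda>l m. A l m + c l m) = (\<lambda>l m. (1 / real N) * (\<Sum>n=1..N. tensor (X n) (X n) l m))"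
    using n0 by (simp add: A_def fun_eq_iff sum_subtractf diff_divide_distrib)
  have "hs_inner B ?b ?b = (\<Sum>l\<in>B. Xb l * Xb l)\<^sup>2" by (rule hs_inner_tensor_tensor)
  also have "(\<Sum>l\<in>B. Xb l * Xb l) = (\<Sum>n=1..N. \<Sum>l\<in>B. X n l * Xb l) / real N"
    using N by (subst sum.swap) (simp add: sum_distrib_right[symmetric] S sum_divide_distrib n0 del: One_nat_def)
  also have "(\<dots>)\<^sup>2 \<le> (\<Sum>n=1..N. (\<Sum>l\<in>B. X n l * Xb l)\<^sup>2) / real N"
    by (rule square_mean_le_mean_square[OF N])
  also have "\<dots> = hs_inner B (\<lambda>l m. A l m + c l m) ?b"
    unfolding AC hs_inner_cmult_left hs_inner_sum_left hs_inner_tensor_tensor by simp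
  finally have J: "hs_inner B ?b ?b \<le> hs_inner B A ?b + hs_inner B c ?b"
    by (simp only: hs_inner_add_left)
  have e: "hs_inner B E E = hs_inner B A A - 2 * hs_inner B A ?b + hs_inner B ?b ?b"
    unfolding E hs_inner_diff_left hs_inner_diff_right by (simp add: hs_inner_commute[of B ?b A])
  show "hs_inner B E E \<le> hs_inner B A A - hs_inner B A ?b + hs_inner B c ?b"
    using e J by simp
  show "hs_inner B E E \<le> hs_inner B A A + 2 * hs_inner B c ?b"
    using e J hs_inner_self_nonneg[of B ?b] by simp
qed

lemma tensor_sum_expansion:
  fixes X :: "nat \<Rightarrow> 'i \<Rightarrow> real"
  assumes Z: "\<And>l m. Z l m = Z m l"
  shows "hs_inner B Z (tensor (\<lambda>l. \<Sum>n=1..k. X n l) (\<lambda>l. \<Sum>n=1..k. X n l)) =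
    (\<Sum>n=1..k. hs_inner B Z (tensor (X n) (X n))) +
    2 * (\<Sum>j=1..k. hs_inner B Z (tensor (\<lambda>l. \<Sum>n=1..j-1. X n l) (X j)))"
proof (induction k)
  case 0
  then show ?case by (simp add: hs_inner_def tensor_def)
next
  case (Suc k)
  let ?S = "\<lambda>l. \<Sum>n=1..k. X n l"
  have "(\<lambda>l. \<Sum>n=1..Suc k. X n l) = (\<lambda>l. ?S l + X (Suc k) l)" by simp
  then have "hs_inner B Z (tensor (\<lambda>l. \<Sum>n=1..Suc k. X n l) (\<lambda>l. \<Sum>n=1..Suc k. X n l)) =
    hs_inner B Z (tensor ?S ?S) + 2 * hs_inner B Z (tensor ?S (X (Suc k)))
      + hs_inner B Z (tensor (X (Suc k)) (X (Suc k)))"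
    using hs_inner_tensor_swap[of Z B "X (Suc k)" ?S] Z
    by (simp only: tensor_add_left tensor_add_right hs_inner_add_right)
  then show ?case using Suc by simp
qed

text \<open>
  The terms of the cubic sum whose two tensor indices coincide form the first two summands on the
  right; all other terms are grouped by their latest time index \<open>k\<close>, which belongs to a single vector in
  the first group, to a matrix in the second one and to both a matrix and a vector in the third one.
\<close>

lemma cubic_sum_expansion:
  fixes X :: "nat \<Rightarrow> 'i \<Rightarrow> real" and c :: "'i \<Rightarrow> 'i \<Rightarrow> real"
  assumes c: "\<And>l m. c l m = c m l"
  defines "Z \<equiv> \<lambda>n l m. tensor (X n) (X n) l m - c l m"
  defines "R \<equiv> \<lambda>k l m. \<Sum>n=1..k. Z n l m"
  defines "S \<equiv> \<lambda>k l. \<Sum>n=1..k. X n l"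
  shows "hs_inner B (R N) (tensor (S N) (S N)) = hs_inner B (R N) (R N) + real N * hs_inner B (R N) c +
    2 * (\<Sum>k=1..N. hs_inner B (R (k-1)) (tensor (S (k-1)) (X k)) +
        (\<Sum>j=1..k-1. hs_inner B (Z k) (tensor (S (j-1)) (X j))) +
        hs_inner B (Z k) (tensor (S (k-1)) (X k)))"
proof (induction N)
  case 0
  then show ?case by (simp add: hs_inner_def R_def S_def tensor_def)
next
  case (Suc k)
  have Zs: "Z n l m = Z n m l" for n l m using c by (simp add: Z_def tensor_def mult.commute)
  have Rs: "R n l m = R n m l" for n l m using Zs by (simp add: R_def)
  have XX: "tensor (X n) (X n) = (\<lambda>l m. Z n l m + c l m)" for n by (simp add: Z_def fun_eq_iff)
  have R: "R (Suc k) = (\<lambda>l m. R k l m + Z (Suc k) l m)" by (simp add: R_def fun_eq_iff)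
  have S: "S (Suc k) = (\<lambda>l. S k l + X (Suc k) l)" by (simp add: S_def fun_eq_iff)
  have sw: "hs_inner B K (tensor (X (Suc k)) (S k)) = hs_inner B K (tensor (S k) (X (Suc k)))"
    if "\<And>l m. K l m = K m l" for K by (rule hs_inner_tensor_swap[OF that])
  have ZSS: "hs_inner B (Z (Suc k)) (tensor (S k) (S k)) =
     hs_inner B (Z (Suc k)) (R k) + real k * hs_inner B (Z (Suc k)) c +
     2 * (\<Sum>j=1..k. hs_inner B (Z (Suc k)) (tensor (S (j-1)) (X j)))"
    unfolding S_def using tensor_sum_expansion[of "Z (Suc k)" B X k] Zs
    by (simp add: XX hs_inner_add_right sum.distrib R_def hs_inner_sum_right)
  have "hs_inner B (R (Suc k)) (tensor (S (Suc k)) (S (Suc k))) =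
      hs_inner B (R k) (tensor (S k) (S k)) + 2 * hs_inner B (R k) (tensor (S k) (X (Suc k)))
      + hs_inner B (R k) (Z (Suc k)) + hs_inner B (R k) c
      + hs_inner B (Z (Suc k)) (tensor (S k) (S k))
      + 2 * hs_inner B (Z (Suc k)) (tensor (S k) (X (Suc k)))
      + hs_inner B (Z (Suc k)) (Z (Suc k)) + hs_inner B (Z (Suc k)) c"
    using sw[OF Rs] sw[OF Zs]
    by (simp only: R S tensor_add_left tensor_add_right hs_inner_add_right hs_inner_add_left XX)
  moreover have "hs_inner B (R (Suc k)) (R (Suc k)) = hs_inner B (R k) (R k) +
      2 * hs_inner B (R k) (Z (Suc k)) + hs_inner B (Z (Suc k)) (Z (Suc k))"
    using hs_inner_commute[of B "Z (Suc k)" "R k"]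
    by (simp only: R hs_inner_add_right hs_inner_add_left)
  moreover have "hs_inner B (R (Suc k)) c = hs_inner B (R k) c + hs_inner B (Z (Suc k)) c"
    by (simp only: R hs_inner_add_left)
  ultimately show ?case using Suc.IH ZSS hs_inner_commute[of B "Z (Suc k)" "R k"]
    by (simp add: algebra_simps)
qed

section \<open>Finite-dimensional Bernoulli shifts\<close>

lemma sum_reversed: "(\<Sum>q=1..k. h (Suc k - q)) = (\<Sum>r=1..k. h (r::nat) :: real)"
  by (rule sum.reindex_bij_witness[of _ "\<lambda>r. Suc k - r" "\<lambda>q. Suc k - q"]) auto

text \<open>
  The coordinates \<open>g l\<close>, \<open>l \<in> B\<close>, of a centered causal function of an i.i.d. sequence. The number \<open>\<delta> r\<close> bounds
  the fourth-moment distance between the vector at time \<open>r\<close> and its copy with a fresh past up to time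
  zero. All three constants are upper bounds only, because projections of one infinite-dimensional
  sequence share them.
\<close>

locale bernoulli_process = iid_path D for D :: "'s measure" +
  fixes B :: "'i set" and g :: "'i \<Rightarrow> (nat \<Rightarrow> 's) \<Rightarrow> real" and \<nu> :: real and \<delta> :: "nat \<Rightarrow> real" and \<Delta> :: real
  assumes finite_B: "finite B"
    and g: "\<And>l. l \<in> B \<Longrightarrow> fourth_moment (\<Pi>\<^sub>M j\<in>UNIV. D) (g l)"
    and mean_g: "\<And>l. l \<in> B \<Longrightarrow> (\<integral>v. g l v \<partial>(\<Pi>\<^sub>M j\<in>UNIV. D)) = 0"
    and \<nu>: "0 \<le> \<nu>" "(\<integral>v. (\<Sum>l\<in>B. (g l v)\<^sup>2)\<^sup>2 \<partial>(\<Pi>\<^sub>M j\<in>UNIV. D)) \<le> \<nu> ^ 4"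
    and \<delta>: "\<And>r. 0 \<le> \<delta> r"
      "\<And>r. 1 \<le> r \<Longrightarrow> (\<integral>(w, w'). (\<Sum>l\<in>B. (g l (\<lambda>j. w (int r - int j)) -
          g l (\<lambda>j. glue 0 w w' (int r - int j)))\<^sup>2)\<^sup>2 \<partial>PP) \<le> \<delta> r ^ 4"
    and \<Delta>: "\<And>k. (\<Sum>r=1..k. \<delta> r) \<le> \<Delta>"
begin

definition X :: "nat \<Rightarrow> (int \<Rightarrow> 's) \<Rightarrow> 'i \<Rightarrow> real" where
  "X n w l = g l (\<lambda>j. w (int n - int j))"

definition c :: "'i \<Rightarrow> 'i \<Rightarrow> real" where
  "c l m = (\<integral>v. g l v * g m v \<partial>(\<Pi>\<^sub>M j\<in>UNIV. D))"

definition Z :: "nat \<Rightarrow> (int \<Rightarrow> 's) \<Rightarrow> 'i \<Rightarrow> 'i \<Rightarrow> real" where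
  "Z n w l m = tensor (X n w) (X n w) l m - c l m"

definition R :: "nat \<Rightarrow> (int \<Rightarrow> 's) \<Rightarrow> 'i \<Rightarrow> 'i \<Rightarrow> real" where
  "R k w l m = (\<Sum>n=1..k. Z n w l m)"

definition S :: "nat \<Rightarrow> (int \<Rightarrow> 's) \<Rightarrow> 'i \<Rightarrow> real" where
  "S k w l = (\<Sum>n=1..k. X n w l)"

text \<open>
  \<open>\<sigma>\<close> bounds the norm of \<open>Z n\<close> in mean square. Keeping \<open>\<sigma>\<^sup>2 + \<gamma>\<^sup>2 = \<nu>\<^sup>4\<close> exact, instead of bounding both
  numbers by \<open>\<nu>\<^sup>2\<close>, is essential for the final constant.
\<close>

definition \<sigma> :: real where "\<sigma> = sqrt (\<nu> ^ 4 - hs_inner B c c)"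

definition \<gamma> :: real where "\<gamma> = sqrt (hs_inner B c c)"

lemma \<Delta>_nonneg: "0 \<le> \<Delta>" using \<Delta>[of 0] by simp

lemma measurable_window: "(\<lambda>w j. w (int n - int j)) \<in> P \<rightarrow>\<^sub>M (\<Pi>\<^sub>M j\<in>UNIV. D)"
  by (rule measurable_reindex)

lemma distr_window:
  "distr P (\<Pi>\<^sub>M j\<in>(UNIV::nat set). D) (\<lambda>w j. w (int n - int j)) = (\<Pi>\<^sub>M j\<in>UNIV. D)"
  by (rule distr_reindex) (auto simp: inj_on_def)

lemma g_measurable[measurable]: "l \<in> B \<Longrightarrow> g l \<in> borel_measurable (\<Pi>\<^sub>M j\<in>UNIV. D)"
  using g by (rule fourth_momentD)

lemma fourth_X: "l \<in> B \<Longrightarrow> fourth_moment P (\<lambda>w. X n w l)"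
  unfolding X_def using g by (rule fourth_moment_measure_preserving[OF measurable_window distr_window])

lemma integral_X: "l \<in> B \<Longrightarrow> (\<integral>w. X n w l \<partial>P) = 0"
  using integral_measure_preserving[OF measurable_window[of n] distr_window[of n] g_measurable, of l]
  unfolding X_def by (simp only: mean_g)

lemma integral_XX: "l \<in> B \<Longrightarrow> m \<in> B \<Longrightarrow> (\<integral>w. X n w l * X n w m \<partial>P) = c l m"
  unfolding X_def c_def
  by (intro integral_measure_preserving[OF measurable_window distr_window]
      borel_measurable_times g_measurable)

lemma X_norm4: "(\<integral>w. (\<Sum>l\<in>B. (X n w l)\<^sup>2)\<^sup>2 \<partial>P) \<le> \<nu> ^ 4"
proof -
  have "(\<lambda>v. (\<Sum>l\<in>B. (g l v)\<^sup>2)\<^sup>2) \<in> borel_measurable (\<Pi>\<^sub>M j\<in>UNIV. D)"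
    by (intro borel_measurable_power borel_measurable_sum g_measurable)
  from integral_measure_preserving[OF measurable_window[of n] distr_window[of n] this]
  have "(\<integral>w. (\<Sum>l\<in>B. (X n w l)\<^sup>2)\<^sup>2 \<partial>P) = (\<integral>v. (\<Sum>l\<in>B. (g l v)\<^sup>2)\<^sup>2 \<partial>(\<Pi>\<^sub>M j\<in>UNIV. D))"
    unfolding X_def .
  with \<nu>(2) show ?thesis by (simp only:)
qed

lemma past_X: "n \<le> k \<Longrightarrow> past_dependent (int k) (\<lambda>w. X n w l)"
  unfolding past_dependent_def X_def by (intro allI impI arg_cong[where f="g l"] ext) auto

lemma past_mult:
  fixes U V :: "(int \<Rightarrow> 's) \<Rightarrow> real"
  assumes "past_dependent k U" "past_dependent k V"
  shows "past_dependent k (\<lambda>w. U w * V w)"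
  unfolding past_dependent_def
proof (intro allI impI)
  fix w w' :: "int \<Rightarrow> 's" assume "\<forall>j\<le>k. w j = w' j"
  then have "U w = U w'" "V w = V w'" using assms unfolding past_dependent_def by blast+
  then show "U w * V w = U w' * V w'" by simp
qed

lemma past_Z: "n \<le> k \<Longrightarrow> past_dependent (int k) (\<lambda>w. Z n w l m)"
proof -
  assume "n \<le> k"
  then have "past_dependent (int k) (\<lambda>w. X n w l)" "past_dependent (int k) (\<lambda>w. X n w m)"
    by (rule past_X)+
  then have "past_dependent (int k) (\<lambda>w. X n w l * X n w m)" by (rule past_mult)
  then show ?thesis unfolding past_dependent_def Z_def tensor_def by (intro allI impI arg_cong2[where f="(-)"]) auto
qed

lemma past_R: "n \<le> k \<Longrightarrow> past_dependent (int k) (\<lambda>w. R n w l m)"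
  unfolding R_def past_dependent_def
proof (intro allI impI sum.cong refl)
  fix i and w w' :: "int \<Rightarrow> 's" assume *: "n \<le> k" "\<forall>j\<le>int k. w j = w' j" "i \<in> {1..n}"
  then have "past_dependent (int k) (\<lambda>w. Z i w l m)" by (intro past_Z) auto
  with * show "Z i w l m = Z i w' l m" unfolding past_dependent_def by blast
qed

lemma second_Z: "l \<in> B \<Longrightarrow> m \<in> B \<Longrightarrow> second_moment P (\<lambda>w. Z n w l m)"
  unfolding Z_def tensor_def
  by (intro second_moment_diff second_moment_mult fourth_X P.second_moment_const)

lemma second_R: "l \<in> B \<Longrightarrow> m \<in> B \<Longrightarrow> second_moment P (\<lambda>w. R k w l m)"
  unfolding R_def by (intro second_moment_sum second_Z)

lemma fourth_S: "l \<in> B \<Longrightarrow> fourth_moment P (\<lambda>w. S k w l)"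
  unfolding S_def by (intro fourth_moment_sum fourth_X)

lemma integral_Z: "l \<in> B \<Longrightarrow> m \<in> B \<Longrightarrow> (\<integral>w. Z n w l m \<partial>P) = 0"
  unfolding Z_def tensor_def
  by (subst Bochner_Integration.integral_diff)
     (simp_all add: integral_XX P.prob_space integrable_second_mult P.second_moment_fourth fourth_X)

lemma integrable_hs:
  assumes "\<And>l m. l \<in> B \<Longrightarrow> m \<in> B \<Longrightarrow> second_moment Q (\<lambda>w. K w l m)"
    and "\<And>l m. l \<in> B \<Longrightarrow> m \<in> B \<Longrightarrow> second_moment Q (\<lambda>w. L w l m)"
  shows "integrable Q (\<lambda>w. hs_inner B (K w) (L w))"
  unfolding hs_inner_def by (intro Bochner_Integration.integrable_sum integrable_second_mult assms)

lemma second_tensor: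
  assumes "\<And>l. l \<in> B \<Longrightarrow> fourth_moment Q (\<lambda>w. x w l)" "\<And>l. l \<in> B \<Longrightarrow> fourth_moment Q (\<lambda>w. y w l)"
    "l \<in> B" "m \<in> B"
  shows "second_moment Q (\<lambda>w. tensor (x w) (y w) l m)"
  unfolding tensor_def by (intro second_moment_mult assms)

lemma integral_Z_const: "(\<integral>w. hs_inner B (Z n w) K \<partial>P) = 0"
  unfolding hs_inner_def
  by (simp add: Bochner_Integration.integral_sum P.integrable_second second_Z integral_Z)

lemma c_sym: "c l m = c m l"
  by (simp add: c_def mult.commute)

text \<open>
  \<open>C\<close> is the mean of \<open>X n \<otimes> X n\<close>, so its norm is subtracted when the second moment is centered.
\<close>

lemma Z_norm2: "(\<integral>w. hs_inner B (Z n w) (Z n w) \<partial>P) \<le> \<nu> ^ 4 - hs_inner B c c"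
proof -
  have eq: "hs_inner B (Z n w) (Z n w) = (\<Sum>l\<in>B. (X n w l)\<^sup>2)\<^sup>2 - 2 * hs_inner B (Z n w) c - hs_inner B c c" for w
  proof -
    have "(\<Sum>l\<in>B. (X n w l)\<^sup>2)\<^sup>2 = hs_inner B (tensor (X n w) (X n w)) (tensor (X n w) (X n w))"
      by (simp add: hs_inner_tensor_tensor power2_eq_square)
    also have "tensor (X n w) (X n w) = (\<lambda>l m. Z n w l m + c l m)" by (simp add: Z_def fun_eq_iff)
    finally show ?thesis
      by (simp add: hs_inner_add_left hs_inner_add_right hs_inner_commute[of B c "Z n w"])
  qed
  have i1: "integrable P (\<lambda>w. (\<Sum>l\<in>B. (X n w l)\<^sup>2)\<^sup>2)"
  proof -
    have "second_moment P (\<lambda>w. \<Sum>l\<in>B. X n w l * X n w l)"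
      by (intro second_moment_sum second_moment_mult fourth_X)
    then show ?thesis by (simp add: second_moment_def power2_eq_square)
  qed
  have i2: "integrable P (\<lambda>w. hs_inner B (Z n w) c)"
    by (intro integrable_hs second_Z P.second_moment_const)
  have "(\<integral>w. hs_inner B (Z n w) (Z n w) \<partial>P) = (\<integral>w. (\<Sum>l\<in>B. (X n w l)\<^sup>2)\<^sup>2 \<partial>P) - hs_inner B c c"
    unfolding eq using i1 i2 by (simp add: integral_Z_const P.prob_space)
  then show ?thesis using X_norm4[of n] by simp
qed

lemma sigma_gamma: "0 \<le> \<sigma>" "0 \<le> \<gamma>" "\<gamma>\<^sup>2 = hs_inner B c c" "\<sigma>\<^sup>2 + \<gamma>\<^sup>2 = (\<nu>\<^sup>2)\<^sup>2"
  "(\<integral>w. (\<Sum>l\<in>B. \<Sum>m\<in>B. (Z n w l m)\<^sup>2) \<partial>P) \<le> \<sigma>\<^sup>2"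
proof -
  have "0 \<le> (\<integral>w. hs_inner B (Z n w) (Z n w) \<partial>P)"
    by (intro integral_nonneg_AE AE_I2 hs_inner_self_nonneg)
  with Z_norm2[of n] have *: "0 \<le> \<nu> ^ 4 - hs_inner B c c" by simp
  have "0 \<le> hs_inner B c c" by (rule hs_inner_self_nonneg)
  with * show "0 \<le> \<sigma>" "0 \<le> \<gamma>" "\<gamma>\<^sup>2 = hs_inner B c c" "\<sigma>\<^sup>2 + \<gamma>\<^sup>2 = (\<nu>\<^sup>2)\<^sup>2"
    "(\<integral>w. (\<Sum>l\<in>B. \<Sum>m\<in>B. (Z n w l m)\<^sup>2) \<partial>P) \<le> \<sigma>\<^sup>2"
    using Z_norm2[of n] by (simp_all add: \<sigma>_def \<gamma>_def hs_inner_self[symmetric])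
qed

lemma moment_fst: "second_moment P h \<Longrightarrow> second_moment PP (\<lambda>(w, w'). h w)"
  "fourth_moment P h \<Longrightarrow> fourth_moment PP (\<lambda>(w, w'). h w)"
  using second_moment_measure_preserving[OF measurable_fst distr_fst, of h]
    fourth_moment_measure_preserving[OF measurable_fst distr_fst, of h]
  by (simp_all add: case_prod_unfold)

lemma moment_snd: "second_moment P h \<Longrightarrow> second_moment PP (\<lambda>(w, w'). h w')"
  using second_moment_measure_preserving[OF measurable_snd distr_snd, of h]
  by (simp_all add: case_prod_unfold)

lemma moment_glue: "second_moment P h \<Longrightarrow> second_moment PP (\<lambda>(w, w'). h (glue k w w'))"
  "fourth_moment P h \<Longrightarrow> fourth_moment PP (\<lambda>(w, w'). h (glue k w w'))"
  using second_moment_measure_preserving[OF measurable_glue distr_glue, of h k]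
    fourth_moment_measure_preserving[OF measurable_glue distr_glue, of h k]
  by (simp_all add: case_prod_unfold)

text \<open>
  Shifting time by \<open>k\<close> moves the cut to time zero, and only the lag \<open>n - k\<close> remains.
\<close>

lemma coupling_moment4:
  assumes "k < n"
  shows "(\<integral>(w, w'). (\<Sum>l\<in>B. (X n w l - X n (glue (int k) w w') l)\<^sup>2)\<^sup>2 \<partial>PP) \<le> \<delta> (n - k) ^ 4"
proof -
  let ?h = "\<lambda>(w, w'). (\<Sum>l\<in>B. (g l (\<lambda>j. w (int (n - k) - int j)) -
      g l (\<lambda>j. glue 0 w w' (int (n - k) - int j)))\<^sup>2)\<^sup>2"
  have m: "?h \<in> borel_measurable PP"
  proof -
    have "(\<lambda>x. g l (\<lambda>j. fst x (int (n - k) - int j))) \<in> borel_measurable PP" if "l \<in> B" for l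
      using that by (intro measurable_compose[OF measurable_fst]
          measurable_compose[OF measurable_window g_measurable])
    moreover have "(\<lambda>x. g l (\<lambda>j. glue 0 (fst x) (snd x) (int (n - k) - int j))) \<in> borel_measurable PP"
      if "l \<in> B" for l
      using measurable_compose[OF measurable_glue[of 0]
          measurable_compose[OF measurable_window g_measurable[OF that]]]
      by (simp add: case_prod_unfold)
    ultimately show ?thesis
      unfolding case_prod_unfold
      by (intro borel_measurable_power borel_measurable_sum borel_measurable_diff)
  qed
  have e1: "int (n - k) - int j + int k = int n - int j" for j using assms by simp
  have e2: "(int (n - k) - int j \<le> 0) = (int n - int j \<le> int k)" for j using assms by auto
  have "(\<lambda>(w, w'). (\<Sum>l\<in>B. (X n w l - X n (glue (int k) w w') l)\<^sup>2)\<^sup>2) =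
    (\<lambda>x. ?h (case x of (w, w') \<Rightarrow> (shift (int k) w, shift (int k) w')))"
    by (simp only: X_def glue_def case_prod_unfold fst_conv snd_conv e1 e2)
  then have "(\<integral>(w, w'). (\<Sum>l\<in>B. (X n w l - X n (glue (int k) w w') l)\<^sup>2)\<^sup>2 \<partial>PP) = (\<integral>x. ?h x \<partial>PP)"
    using integral_measure_preserving[OF measurable_shift_pair distr_shift_pair m, of "int k"] by simp
  also have "\<dots> \<le> \<delta> (n - k) ^ 4" using assms by (intro \<delta>) simp
  finally show ?thesis .
qed

end

section \<open>Covariance bounds across a cut\<close>

lemma divide_sqrt2: "y / sqrt 2 = sqrt 2 * y / 2"
proof -
  have "sqrt 2 * y / 2 = sqrt 2 * y / (sqrt 2 * sqrt 2)" by (simp only: real_sqrt_mult_self abs_numeral)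
  also have "\<dots> = y / sqrt 2" by (rule mult_divide_mult_cancel_left) simp
  finally show ?thesis by (rule sym)
qed

lemma power2_sum_le: "(x + y)\<^sup>2 \<le> 2 * (x\<^sup>2 + (y::real)\<^sup>2)"
  using sum_squares_bound[of x y] by (simp add: power2_sum)

context bernoulli_process begin

lemma X_norm2: "(\<integral>w. (\<Sum>l\<in>B. (X n w l)\<^sup>2) \<partial>P) \<le> \<nu>\<^sup>2"
proof -
  have s: "second_moment P (\<lambda>w. \<Sum>l\<in>B. X n w l * X n w l)"
    by (intro second_moment_sum second_moment_mult fourth_X)
  have "(\<integral>w. \<bar>(\<Sum>l\<in>B. X n w l * X n w l) * 1\<bar> \<partial>P) \<le> \<nu>\<^sup>2 * 1"
    by (rule Cauchy_Schwarz_integral[OF s _ _ P.second_moment_const])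
       (use X_norm4[of n] in \<open>simp_all add: P.prob_space power2_eq_square[symmetric]\<close>)
  then show ?thesis by (simp add: power2_eq_square sum_nonneg)
qed

lemma coupling_moment2:
  assumes "k < n"
  shows "(\<integral>(w, w'). (\<Sum>l\<in>B. (X n w l - X n (glue (int k) w w') l)\<^sup>2) \<partial>PP) \<le> (\<delta> (n - k))\<^sup>2"
proof -
  have d: "fourth_moment PP (\<lambda>(w, w'). X n w l - X n (glue (int k) w w') l)" if "l \<in> B" for l
    using fourth_moment_diff[OF moment_fst(2) moment_glue(2), OF fourth_X fourth_X, OF that that]
    by (simp add: case_prod_unfold)
  have s: "second_moment PP (\<lambda>x. \<Sum>l\<in>B. (case x of (w, w') \<Rightarrow> X n w l - X n (glue (int k) w w') l) *
      (case x of (w, w') \<Rightarrow> X n w l - X n (glue (int k) w w') l))"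
    by (intro second_moment_sum second_moment_mult d)
  have "(\<integral>x. \<bar>(\<Sum>l\<in>B. (case x of (w, w') \<Rightarrow> X n w l - X n (glue (int k) w w') l) *
      (case x of (w, w') \<Rightarrow> X n w l - X n (glue (int k) w w') l)) * 1\<bar> \<partial>PP) \<le> (\<delta> (n - k))\<^sup>2 * 1"
    by (rule Cauchy_Schwarz_integral[OF s _ _ PP.P.second_moment_const])
       (use coupling_moment4[OF assms] in
         \<open>simp_all add: PP.P.prob_space power2_eq_square[symmetric] case_prod_unfold\<close>)
  then show ?thesis by (simp add: power2_eq_square sum_nonneg case_prod_unfold)
qed

text \<open>
  \<open>C\<close> cancels in the difference, which is a difference of tensor squares. The factor two is the bound
  \<open>2 \<nu>\<close> for the norm of the sum of the two coupled vectors in \<open>L\<^sup>4\<close>.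
\<close>

lemma Z_coupling:
  assumes "k < n"
  shows "(\<integral>(w, w'). (\<Sum>l\<in>B. \<Sum>m\<in>B. (Z n w l m - Z n (glue (int k) w w') l m)\<^sup>2) \<partial>PP) \<le>
    (2 * \<nu> * \<delta> (n - k))\<^sup>2"
proof -
  let ?y = "\<lambda>x l. X n (glue (int k) (fst x) (snd x)) l" and ?x = "\<lambda>x l. X n (fst x) l"
  let ?d = "\<lambda>x. \<Sum>l\<in>B. (?x x l - ?y x l)\<^sup>2" and ?p = "\<lambda>x. \<Sum>l\<in>B. (?x x l + ?y x l)\<^sup>2"
  let ?a = "\<lambda>x. (\<Sum>l\<in>B. (?x x l)\<^sup>2)\<^sup>2" and ?b = "\<lambda>x. (\<Sum>l\<in>B. (?y x l)\<^sup>2)\<^sup>2"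
  have x: "fourth_moment PP (\<lambda>x. ?x x l)" and y: "fourth_moment PP (\<lambda>x. ?y x l)" if "l \<in> B" for l
    using moment_fst(2)[OF fourth_X[OF that]] moment_glue(2)[OF fourth_X[OF that]]
    by (simp_all add: case_prod_unfold)
  have sd: "second_moment PP ?d" unfolding power2_eq_square
    by (intro second_moment_sum second_moment_mult fourth_moment_diff x y)
  have sp: "second_moment PP ?p" unfolding power2_eq_square
    by (intro second_moment_sum second_moment_mult fourth_moment_add x y)
  have sa: "second_moment PP (\<lambda>x. \<Sum>l\<in>B. (?x x l)\<^sup>2)" and sb: "second_moment PP (\<lambda>x. \<Sum>l\<in>B. (?y x l)\<^sup>2)"
    unfolding power2_eq_square by (intro second_moment_sum second_moment_mult x y; assumption)+
  have ia: "integrable PP ?a" and ib: "integrable PP ?b" and ip: "integrable PP (\<lambda>x. (?p x)\<^sup>2)"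
    using sa sb sp by (simp_all add: second_moment_def)
  have m: "(\<lambda>w. (\<Sum>l\<in>B. (X n w l)\<^sup>2)\<^sup>2) \<in> borel_measurable P"
    by (intro borel_measurable_power borel_measurable_sum fourth_momentD[OF fourth_X])
  have Ea: "(\<integral>x. ?a x \<partial>PP) \<le> \<nu> ^ 4"
    using integral_measure_preserving[OF measurable_fst distr_fst m] X_norm4[of n] by simp
  have Eb: "(\<integral>x. ?b x \<partial>PP) \<le> \<nu> ^ 4"
    using integral_measure_preserving[OF measurable_glue distr_glue m, of "int k"] X_norm4[of n]
    by (simp add: case_prod_unfold)
  have pw: "(?p x)\<^sup>2 \<le> 8 * (?a x + ?b x)" for x
  proof -
    have "?p x \<le> (\<Sum>l\<in>B. 2 * ((?x x l)\<^sup>2 + (?y x l)\<^sup>2))" by (intro sum_mono power2_sum_le)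
    then have "(?p x)\<^sup>2 \<le> (2 * ((\<Sum>l\<in>B. (?x x l)\<^sup>2) + (\<Sum>l\<in>B. (?y x l)\<^sup>2)))\<^sup>2"
      by (intro power_mono) (simp_all add: sum_distrib_left sum.distrib sum_nonneg)
    also have "\<dots> = 4 * ((\<Sum>l\<in>B. (?x x l)\<^sup>2) + (\<Sum>l\<in>B. (?y x l)\<^sup>2))\<^sup>2"
      unfolding power_mult_distrib by simp
    also have "\<dots> \<le> 4 * (2 * (?a x + ?b x))" by (intro mult_left_mono power2_sum_le) simp
    finally show ?thesis by simp
  qed
  have "(\<integral>x. (?p x)\<^sup>2 \<partial>PP) \<le> (\<integral>x. 8 * (?a x + ?b x) \<partial>PP)"
    using ip ia ib pw by (intro integral_mono) auto
  also have "\<dots> = 8 * ((\<integral>x. ?a x \<partial>PP) + (\<integral>x. ?b x \<partial>PP))" using ia ib by simp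
  also have "\<dots> \<le> (4 * \<nu>\<^sup>2)\<^sup>2" using Ea Eb by simp
  finally have Ep: "(\<integral>x. (?p x)\<^sup>2 \<partial>PP) \<le> (4 * \<nu>\<^sup>2)\<^sup>2" .
  have Ed: "(\<integral>x. (?d x)\<^sup>2 \<partial>PP) \<le> ((\<delta> (n - k))\<^sup>2)\<^sup>2"
    using coupling_moment4[OF assms] by (simp add: case_prod_unfold)
  have "(\<integral>(w, w'). (\<Sum>l\<in>B. \<Sum>m\<in>B. (Z n w l m - Z n (glue (int k) w w') l m)\<^sup>2) \<partial>PP) \<le>
      (\<integral>x. \<bar>?d x * ?p x\<bar> \<partial>PP)"
  proof (rule integral_mono)
    have "second_moment PP (\<lambda>x. Z n (fst x) l m - Z n (glue (int k) (fst x) (snd x)) l m)"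
      if "l \<in> B" "m \<in> B" for l m
      using second_moment_diff[OF moment_fst(1) moment_glue(1), OF second_Z second_Z, OF that that]
      by (simp add: case_prod_unfold)
    then show "integrable PP (\<lambda>(w, w'). \<Sum>l\<in>B. \<Sum>m\<in>B. (Z n w l m - Z n (glue (int k) w w') l m)\<^sup>2)"
      by (simp add: case_prod_unfold second_moment_def)
    show "integrable PP (\<lambda>x. \<bar>?d x * ?p x\<bar>)" by (intro integrable_abs integrable_second_mult sd sp)
    fix x
    have "(case x of (w, w') \<Rightarrow> \<Sum>l\<in>B. \<Sum>m\<in>B. (Z n w l m - Z n (glue (int k) w w') l m)\<^sup>2) =
        (\<Sum>l\<in>B. \<Sum>m\<in>B. (?x x l * ?x x m - ?y x l * ?y x m)\<^sup>2)"
      by (simp add: Z_def tensor_def case_prod_unfold)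
    also have "\<dots> \<le> ?d x * ?p x" by (rule tensor_square_diff_le)
    finally show "(case x of (w, w') \<Rightarrow> \<Sum>l\<in>B. \<Sum>m\<in>B. (Z n w l m - Z n (glue (int k) w w') l m)\<^sup>2) \<le>
        \<bar>?d x * ?p x\<bar>" by simp
  qed
  also have "\<dots> \<le> (\<delta> (n - k))\<^sup>2 * (4 * \<nu>\<^sup>2)"
    by (rule Cauchy_Schwarz_integral[OF sd Ed _ sp Ep]) auto
  finally show ?thesis by (simp add: power_mult_distrib mult_ac)
qed

text \<open>
  The symmetric decoupling identity, summed over coordinates, followed by the Cauchy--Schwarz inequality.
\<close>

lemma covariance_bound:
  assumes J: "finite J" and past: "\<And>p. p \<in> J \<Longrightarrow> past_dependent k (\<lambda>w. U w p)"
    and U: "\<And>p. p \<in> J \<Longrightarrow> second_moment P (\<lambda>w. U w p)"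
      "(\<integral>w. (\<Sum>p\<in>J. (U w p)\<^sup>2) \<partial>P) \<le> \<alpha>\<^sup>2" "0 \<le> \<alpha>"
    and V: "\<And>p. p \<in> J \<Longrightarrow> second_moment P (\<lambda>w. V w p)"
      "\<And>p. p \<in> J \<Longrightarrow> (\<integral>w. V w p \<partial>P) = 0"
      "(\<integral>(w, w'). (\<Sum>p\<in>J. (V w p - V (glue k w w') p)\<^sup>2) \<partial>PP) \<le> \<beta>\<^sup>2" "0 \<le> \<beta>"
  shows "\<bar>\<integral>w. (\<Sum>p\<in>J. U w p * V w p) \<partial>P\<bar> \<le> \<alpha> * \<beta> / sqrt 2"
proof -
  let ?U = "\<lambda>x p. U (fst x) p - U (snd x) p"
  let ?V = "\<lambda>x p. V (fst x) p - V (glue k (fst x) (snd x)) p"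
  have sU: "second_moment PP (\<lambda>x. ?U x p)" if "p \<in> J" for p
    using second_moment_diff[OF moment_fst(1)[OF U(1)[OF that]] moment_snd[OF U(1)[OF that]]]
    by (simp add: case_prod_unfold)
  have sV: "second_moment PP (\<lambda>x. ?V x p)" if "p \<in> J" for p
    using second_moment_diff[OF moment_fst(1)[OF V(1)[OF that]] moment_glue(1)[OF V(1)[OF that]]]
    by (simp add: case_prod_unfold)
  have EU: "(\<integral>x. (?U x p)\<^sup>2 \<partial>PP) \<le> 2 * (\<integral>w. (U w p)\<^sup>2 \<partial>P)" if p: "p \<in> J" for p
  proof -
    have i: "integrable P (\<lambda>w. U w p)" "integrable P (\<lambda>w. (U w p)\<^sup>2)"
      using P.integrable_second[OF U(1)[OF p]] U(1)[OF p] by (auto simp: second_moment_def)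
    note m = borel_measurable_integrable[OF i(2)]
    have i1: "integrable PP (\<lambda>x. (U (fst x) p)\<^sup>2)" "integrable PP (\<lambda>x. (U (snd x) p)\<^sup>2)"
      using integrable_measure_preserving[OF measurable_fst distr_fst m]
        integrable_measure_preserving[OF measurable_snd distr_snd m] i(2) by simp_all
    have e1: "(\<integral>x. (U (fst x) p)\<^sup>2 \<partial>PP) = (\<integral>w. (U w p)\<^sup>2 \<partial>P)"
        "(\<integral>x. (U (snd x) p)\<^sup>2 \<partial>PP) = (\<integral>w. (U w p)\<^sup>2 \<partial>P)"
      using integral_measure_preserving[OF measurable_fst distr_fst m]
        integral_measure_preserving[OF measurable_snd distr_snd m] by simp_all
    have i2: "integrable PP (\<lambda>x. U (fst x) p * U (snd x) p)"
      and e2: "(\<integral>x. U (fst x) p * U (snd x) p \<partial>PP) = (\<integral>w. U w p \<partial>P) * (\<integral>w. U w p \<partial>P)"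
      using integral_product_PP[OF i(1) i(1)] by (simp_all add: case_prod_unfold)
    have "(\<integral>x. (?U x p)\<^sup>2 \<partial>PP) =
        (\<integral>x. ((U (fst x) p)\<^sup>2 + (U (snd x) p)\<^sup>2) - 2 * (U (fst x) p * U (snd x) p) \<partial>PP)"
      by (simp add: power2_diff mult.assoc)
    also have "\<dots> = 2 * (\<integral>w. (U w p)\<^sup>2 \<partial>P) - 2 * ((\<integral>w. U w p \<partial>P) * (\<integral>w. U w p \<partial>P))"
      using i1 i2 by (simp add: e1 e2)
    finally show ?thesis by simp
  qed
  have "(\<integral>w. (\<Sum>p\<in>J. U w p * V w p) \<partial>P) = (\<Sum>p\<in>J. \<integral>w. U w p * V w p \<partial>P)"
    by (intro Bochner_Integration.integral_sum integrable_second_mult U V)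
  also have "\<dots> = (\<Sum>p\<in>J. (\<integral>x. ?U x p * ?V x p \<partial>PP) / 2)"
  proof (rule sum.cong[OF refl])
    fix p assume p: "p \<in> J"
    show "(\<integral>w. U w p * V w p \<partial>P) = (\<integral>x. ?U x p * ?V x p \<partial>PP) / 2"
      using covariance_decouple_symmetric[OF past P.integrable_second[OF U(1)]
          P.integrable_second[OF V(1)] integrable_second_mult[OF U(1) V(1)], OF p p p p p] V(2)[OF p]
      by (simp add: case_prod_unfold)
  qed
  also have "\<dots> = (\<integral>x. (\<Sum>p\<in>J. ?U x p * ?V x p) \<partial>PP) / 2"
    unfolding sum_divide_distrib[symmetric]
    by (subst Bochner_Integration.integral_sum) (auto intro!: integrable_second_mult sU sV)
  finally have e: "(\<integral>w. (\<Sum>p\<in>J. U w p * V w p) \<partial>P) = (\<integral>x. (\<Sum>p\<in>J. ?U x p * ?V x p) \<partial>PP) / 2" .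
  have "\<bar>\<integral>x. (\<Sum>p\<in>J. ?U x p * ?V x p) \<partial>PP\<bar> \<le> (sqrt 2 * \<alpha>) * \<beta>"
  proof (rule Cauchy_Schwarz_vector[OF J sU _ _ sV])
    have "(\<integral>x. (\<Sum>p\<in>J. (?U x p)\<^sup>2) \<partial>PP) = (\<Sum>p\<in>J. \<integral>x. (?U x p)\<^sup>2 \<partial>PP)"
      using sU by (intro Bochner_Integration.integral_sum) (simp add: second_moment_def)
    also have "\<dots> \<le> (\<Sum>p\<in>J. 2 * (\<integral>w. (U w p)\<^sup>2 \<partial>P))" by (intro sum_mono EU)
    also have "\<dots> = 2 * (\<integral>w. (\<Sum>p\<in>J. (U w p)\<^sup>2) \<partial>P)"
      using U(1) by (subst Bochner_Integration.integral_sum) (auto simp: second_moment_def sum_distrib_left)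
    also have "\<dots> \<le> (sqrt 2 * \<alpha>)\<^sup>2" using U(2) by (simp add: power_mult_distrib)
    finally show "(\<integral>x. (\<Sum>p\<in>J. (?U x p)\<^sup>2) \<partial>PP) \<le> (sqrt 2 * \<alpha>)\<^sup>2" .
  qed (use U V in \<open>simp_all add: case_prod_unfold\<close>)
  then have "\<bar>\<integral>w. (\<Sum>p\<in>J. U w p * V w p) \<partial>P\<bar> \<le> sqrt 2 * \<alpha> * \<beta> / 2" unfolding e by simp
  also have "\<dots> = \<alpha> * \<beta> / sqrt 2" by (simp add: divide_sqrt2)
  finally show ?thesis .
qed

lemma hs_covariance_bound:
  assumes past: "\<And>l m. l \<in> B \<Longrightarrow> m \<in> B \<Longrightarrow> past_dependent k (\<lambda>w. U w l m)"
    and U: "\<And>l m. l \<in> B \<Longrightarrow> m \<in> B \<Longrightarrow> second_moment P (\<lambda>w. U w l m)"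
      "(\<integral>w. hs_inner B (U w) (U w) \<partial>P) \<le> \<alpha>\<^sup>2" "0 \<le> \<alpha>"
    and kn: "k = int k'" "k' < n"
  shows "\<bar>\<integral>w. hs_inner B (U w) (Z n w) \<partial>P\<bar> \<le> sqrt 2 * \<alpha> * (\<nu> * \<delta> (n - k'))"
proof -
  have "\<bar>\<integral>w. (\<Sum>p\<in>B \<times> B. U w (fst p) (snd p) * Z n w (fst p) (snd p)) \<partial>P\<bar> \<le>
      \<alpha> * (2 * \<nu> * \<delta> (n - k')) / sqrt 2"
  proof (rule covariance_bound)
    show "(\<integral>w. (\<Sum>p\<in>B \<times> B. (U w (fst p) (snd p))\<^sup>2) \<partial>P) \<le> \<alpha>\<^sup>2"
      using U(2) by (simp add: hs_inner_self sum.cartesian_product case_prod_unfold)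
    show "(\<integral>(w, w'). (\<Sum>p\<in>B \<times> B. (Z n w (fst p) (snd p) - Z n (glue k w w') (fst p) (snd p))\<^sup>2) \<partial>PP)
        \<le> (2 * \<nu> * \<delta> (n - k'))\<^sup>2"
      using Z_coupling[OF kn(2)] kn(1) by (simp add: sum.cartesian_product case_prod_unfold)
  qed (use finite_B past U second_Z integral_Z \<nu>(1) \<delta>(1) in auto)
  then show ?thesis
    by (simp add: hs_inner_def sum.cartesian_product case_prod_unfold divide_sqrt2 mult_ac)
qed

lemma ZZ_bound:
  assumes "k < n"
  shows "\<bar>\<integral>w. hs_inner B (Z k w) (Z n w) \<partial>P\<bar> \<le> sqrt 2 * \<sigma> * (\<nu> * \<delta> (n - k))"
  by (rule hs_covariance_bound[where k = "int k"])
     (use assms sigma_gamma(1) sigma_gamma(5)[of k] in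
       \<open>auto intro: past_Z second_Z simp: hs_inner_self\<close>)

text \<open>
  The cut is placed after \<open>X k\<close>, so that only \<open>Z n\<close> is replaced and the symmetric identity applies
  with the square integrable past variable \<open>X i \<otimes> X k\<close>.
\<close>

lemma ZXX_bound:
  assumes "i \<le> k" "k < n"
  shows "\<bar>\<integral>w. hs_inner B (Z n w) (tensor (X i w) (X k w)) \<partial>P\<bar> \<le> sqrt 2 * \<nu>\<^sup>2 * (\<nu> * \<delta> (n - k))"
proof -
  have a: "second_moment P (\<lambda>w. \<Sum>l\<in>B. (X j w l)\<^sup>2)" for j
    unfolding power2_eq_square by (intro second_moment_sum second_moment_mult fourth_X)
  have e: "hs_inner B (tensor (X i w) (X k w)) (tensor (X i w) (X k w)) =
      \<bar>(\<Sum>l\<in>B. (X i w l)\<^sup>2) * (\<Sum>l\<in>B. (X k w l)\<^sup>2)\<bar>" for w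
  proof -
    have "hs_inner B (tensor (X i w) (X k w)) (tensor (X i w) (X k w)) =
        (\<Sum>l\<in>B. (X i w l)\<^sup>2) * (\<Sum>l\<in>B. (X k w l)\<^sup>2)"
      by (simp add: hs_inner_def tensor_def sum_product power2_eq_square mult_ac)
    then show ?thesis by (simp add: sum_nonneg)
  qed
  have "\<bar>\<integral>w. hs_inner B (tensor (X i w) (X k w)) (Z n w) \<partial>P\<bar> \<le> sqrt 2 * \<nu>\<^sup>2 * (\<nu> * \<delta> (n - k))"
  proof (rule hs_covariance_bound[where k = "int k"])
    show "past_dependent (int k) (\<lambda>w. tensor (X i w) (X k w) l m)" for l m
      unfolding tensor_def using assms by (intro past_mult past_X) auto
    show "(\<integral>w. hs_inner B (tensor (X i w) (X k w)) (tensor (X i w) (X k w)) \<partial>P) \<le> (\<nu>\<^sup>2)\<^sup>2"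
      unfolding e power2_eq_square[of "\<nu>\<^sup>2"]
      by (rule Cauchy_Schwarz_integral[OF a _ _ a]) (use X_norm4 in simp_all)
  qed (use assms in \<open>auto intro!: second_tensor fourth_X\<close>)
  then show ?thesis by (simp add: hs_inner_commute)
qed

lemma cXX_bound:
  assumes "k < n"
  shows "\<bar>\<integral>w. hs_inner B c (tensor (X k w) (X n w)) \<partial>P\<bar> \<le> \<gamma> * (\<nu> * \<delta> (n - k)) / sqrt 2"
proof -
  let ?U = "\<lambda>w m. \<Sum>l\<in>B. c l m * X k w l"
  have "\<bar>\<integral>w. (\<Sum>m\<in>B. ?U w m * X n w m) \<partial>P\<bar> \<le> (\<gamma> * \<nu>) * \<delta> (n - k) / sqrt 2"
  proof (rule covariance_bound[where k = "int k"])
    show "past_dependent (int k) (\<lambda>w. ?U w m)" for m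
      unfolding past_dependent_def
    proof (intro allI impI sum.cong refl arg_cong2[where f = "(*)"])
      fix w w' :: "int \<Rightarrow> 's" and l assume "\<forall>j\<le>int k. w j = w' j" then show "X k w l = X k w' l"
        using past_X[of k k l] unfolding past_dependent_def by blast
    qed
    show "second_moment P (\<lambda>w. ?U w m)" if "m \<in> B" for m
      by (intro second_moment_sum second_moment_cmult P.second_moment_fourth fourth_X)
    have pw: "(\<Sum>m\<in>B. (?U w m)\<^sup>2) \<le> \<gamma>\<^sup>2 * (\<Sum>l\<in>B. (X k w l)\<^sup>2)" for w
    proof -
      have "(?U w m)\<^sup>2 \<le> (\<Sum>l\<in>B. (c l m)\<^sup>2) * (\<Sum>l\<in>B. (X k w l)\<^sup>2)" for m
        using Cauchy_Schwarz_ineq_sum[of "\<lambda>l. c l m" "X k w" B] .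
      then have "(\<Sum>m\<in>B. (?U w m)\<^sup>2) \<le> (\<Sum>m\<in>B. (\<Sum>l\<in>B. (c l m)\<^sup>2) * (\<Sum>l\<in>B. (X k w l)\<^sup>2))"
        by (intro sum_mono)
      also have "\<dots> = \<gamma>\<^sup>2 * (\<Sum>l\<in>B. (X k w l)\<^sup>2)"
        unfolding sigma_gamma(3) hs_inner_self by (subst sum.swap) (simp add: sum_distrib_right)
      finally show ?thesis .
    qed
    have i: "integrable P (\<lambda>w. \<Sum>l\<in>B. (X k w l)\<^sup>2)"
      unfolding power2_eq_square
      by (intro Bochner_Integration.integrable_sum integrable_second_mult P.second_moment_fourth fourth_X)
    have "(\<integral>w. (\<Sum>m\<in>B. (?U w m)\<^sup>2) \<partial>P) \<le> (\<integral>w. \<gamma>\<^sup>2 * (\<Sum>l\<in>B. (X k w l)\<^sup>2) \<partial>P)"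
    proof (rule integral_mono[OF _ _ pw])
      show "integrable P (\<lambda>w. \<Sum>m\<in>B. (?U w m)\<^sup>2)"
        unfolding power2_eq_square
        by (intro Bochner_Integration.integrable_sum integrable_second_mult second_moment_sum
            second_moment_cmult P.second_moment_fourth fourth_X)
    qed (use i in simp)
    also have "\<dots> \<le> (\<gamma> * \<nu>)\<^sup>2"
      using i X_norm2[of k] by (simp add: power_mult_distrib mult_left_mono)
    finally show "(\<integral>w. (\<Sum>m\<in>B. (?U w m)\<^sup>2) \<partial>P) \<le> (\<gamma> * \<nu>)\<^sup>2" .
  qed (use finite_B \<nu>(1) \<delta>(1) sigma_gamma(2) coupling_moment2[OF assms] in
      \<open>auto intro: P.second_moment_fourth fourth_X simp: integral_X\<close>)
  moreover have "(\<Sum>m\<in>B. ?U w m * X n w m) = hs_inner B c (tensor (X k w) (X n w))" for w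
    unfolding hs_inner_def tensor_def by (subst sum.swap) (simp add: sum_distrib_left mult_ac)
  ultimately show ?thesis by (simp add: mult_ac)
qed

text \<open>
  The past factor \<open>K (X i)\<close> has only moments of order 4/3, so the symmetric identity and the
  Cauchy--Schwarz inequality are not available. The one-sided identity with Hoelder exponents
  2, 4, 4 is used instead.
\<close>

lemma trilinear_bound:
  assumes "k < n"
    and pastK: "\<And>l m. l \<in> B \<Longrightarrow> m \<in> B \<Longrightarrow> past_dependent (int k) (\<lambda>w. K w l m)"
    and K: "\<And>l m. l \<in> B \<Longrightarrow> m \<in> B \<Longrightarrow> second_moment P (\<lambda>w. K w l m)"
      "(\<integral>w. hs_inner B (K w) (K w) \<partial>P) \<le> \<alpha>\<^sup>2" "0 \<le> \<alpha>"
    and i: "i \<le> k"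
  shows "\<bar>\<integral>w. hs_inner B (K w) (tensor (X i w) (X n w)) \<partial>P\<bar> \<le> \<alpha> * (\<nu> * \<delta> (n - k))"
proof -
  let ?d = "\<lambda>x m. X n (fst x) m - X n (glue (int k) (fst x) (snd x)) m"
  have d: "fourth_moment PP (\<lambda>x. ?d x m)" if "m \<in> B" for m
    using fourth_moment_diff[OF moment_fst(2) moment_glue(2), OF fourth_X fourth_X, OF that that]
    by (simp add: case_prod_unfold)
  have Kf: "second_moment PP (\<lambda>x. K (fst x) l m)" if "l \<in> B" "m \<in> B" for l m
    using moment_fst(1)[OF K(1)[OF that]] by (simp add: case_prod_unfold)
  have Xf: "fourth_moment PP (\<lambda>x. X i (fst x) l)" if "l \<in> B" for l
    using moment_fst(2)[OF fourth_X[OF that]] by (simp add: case_prod_unfold)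
  have entry: "(\<integral>w. K w l m * (X i w l * X n w m) \<partial>P) =
      (\<integral>x. K (fst x) l m * (X i (fst x) l * ?d x m) \<partial>PP)" if "l \<in> B" "m \<in> B" for l m
  proof -
    have s: "second_moment P (\<lambda>w. X i w l)" "second_moment P (\<lambda>w. X n w m)"
      by (intro P.second_moment_fourth fourth_X that)+
    have "integrable P (\<lambda>w. K w l m * (X i w l * X n w m))"
      by (intro integrable_second_mult K second_moment_mult fourth_X that)
    then have iu: "integrable P (\<lambda>w. (K w l m * X i w l) * X n w m)" by (simp add: mult.assoc)
    have pu: "past_dependent (int k) (\<lambda>w. K w l m * X i w l)"
      by (intro past_mult pastK past_X that i)
    show ?thesis
      using covariance_decouple[OF pu integrable_second_mult[OF K(1)[OF that] s(1)]
          P.integrable_second[OF s(2)] iu] integral_X[OF that(2), of n]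
      by (simp add: case_prod_unfold mult.assoc)
  qed
  have "(\<integral>w. hs_inner B (K w) (tensor (X i w) (X n w)) \<partial>P) =
      (\<Sum>l\<in>B. \<Sum>m\<in>B. \<integral>w. K w l m * (X i w l * X n w m) \<partial>P)"
    unfolding hs_inner_def tensor_def
    by (simp add: Bochner_Integration.integral_sum Bochner_Integration.integrable_sum
        integrable_second_mult K second_moment_mult fourth_X)
  also have "\<dots> = (\<Sum>l\<in>B. \<Sum>m\<in>B. \<integral>x. K (fst x) l m * (X i (fst x) l * ?d x m) \<partial>PP)"
    by (intro sum.cong refl entry)
  also have "\<dots> = (\<integral>x. (\<Sum>l\<in>B. \<Sum>m\<in>B. K (fst x) l m * (X i (fst x) l * ?d x m)) \<partial>PP)"
    by (simp add: Bochner_Integration.integral_sum Bochner_Integration.integrable_sum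
        integrable_second_mult Kf second_moment_mult Xf d)
  also have "\<bar>\<dots>\<bar> \<le> \<alpha> * (\<nu> * \<delta> (n - k))"
  proof (rule Hoelder_trilinear[OF finite_B Kf _ _ Xf _ _ d])
    have "(\<lambda>w. hs_inner B (K w) (K w)) \<in> borel_measurable P"
      by (intro borel_measurable_integrable integrable_hs K)
    from integral_measure_preserving[OF measurable_fst distr_fst this] K(2)
    show "(\<integral>x. (\<Sum>l\<in>B. \<Sum>m\<in>B. (K (fst x) l m)\<^sup>2) \<partial>PP) \<le> \<alpha>\<^sup>2" by (simp add: hs_inner_self)
    have m: "(\<lambda>w. (\<Sum>l\<in>B. (X i w l)\<^sup>2)\<^sup>2) \<in> borel_measurable P"
      by (intro borel_measurable_power borel_measurable_sum fourth_momentD[OF fourth_X])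
    from integral_measure_preserving[OF measurable_fst distr_fst this] X_norm4[of i]
    show "(\<integral>x. (\<Sum>l\<in>B. (X i (fst x) l)\<^sup>2)\<^sup>2 \<partial>PP) \<le> \<nu> ^ 4" by simp
    show "(\<integral>x. (\<Sum>m\<in>B. (?d x m)\<^sup>2)\<^sup>2 \<partial>PP) \<le> \<delta> (n - k) ^ 4"
      using coupling_moment4[OF assms(1)] by (simp add: case_prod_unfold)
  qed (use K \<nu> \<delta> in auto)
  finally show ?thesis .
qed

text \<open>
  The latest time occurs in the matrix and in a vector, so the cut is placed after \<open>X i\<close>, and the increment
  of the product \<open>Z n (X n)\<close> is split by the product rule. The increment of \<open>Z n\<close> contributes \<open>2 \<nu>\<^sup>2\<close>,
  the increment of \<open>X n\<close> contributes \<open>\<sigma>\<close>.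
\<close>

lemma XZX_bound:
  assumes "i < n"
  shows "\<bar>\<integral>w. hs_inner B (Z n w) (tensor (X i w) (X n w)) \<partial>P\<bar> \<le> (2 * \<nu>\<^sup>2 + \<sigma>) * (\<nu> * \<delta> (n - i))"
proof -
  let ?G = "\<lambda>x. glue (int i) (fst x) (snd x)"
  let ?d = "\<lambda>x m. X n (fst x) m - X n (?G x) m"
  let ?D = "\<lambda>x l m. Z n (fst x) l m - Z n (?G x) l m"
  have d: "fourth_moment PP (\<lambda>x. ?d x m)" if "m \<in> B" for m
    using fourth_moment_diff[OF moment_fst(2) moment_glue(2), OF fourth_X fourth_X, OF that that]
    by (simp add: case_prod_unfold)
  have dZ: "second_moment PP (\<lambda>x. ?D x l m)" if "l \<in> B" "m \<in> B" for l m
    using second_moment_diff[OF moment_fst(1) moment_glue(1), OF second_Z second_Z, OF that that]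
    by (simp add: case_prod_unfold)
  have gZ: "second_moment PP (\<lambda>x. Z n (?G x) l m)" if "l \<in> B" "m \<in> B" for l m
    using moment_glue(1)[OF second_Z[OF that]] by (simp add: case_prod_unfold)
  have Xf: "fourth_moment PP (\<lambda>x. X j (fst x) l)" if "l \<in> B" for j l
    using moment_fst(2)[OF fourth_X[OF that]] by (simp add: case_prod_unfold)
  have i1: "integrable PP (\<lambda>x. ?D x l m * (X i (fst x) l * X n (fst x) m))"
    if "l \<in> B" "m \<in> B" for l m
    by (intro integrable_second_mult second_moment_mult dZ Xf that)
  have i2: "integrable PP (\<lambda>x. Z n (?G x) l m * (X i (fst x) l * ?d x m))"
    if "l \<in> B" "m \<in> B" for l m
    by (intro integrable_second_mult second_moment_mult gZ Xf d that)
  have entry: "(\<integral>w. Z n w l m * (X i w l * X n w m) \<partial>P) =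
      (\<integral>x. ?D x l m * (X i (fst x) l * X n (fst x) m) \<partial>PP) +
      (\<integral>x. Z n (?G x) l m * (X i (fst x) l * ?d x m) \<partial>PP)" if lm: "l \<in> B" "m \<in> B" for l m
  proof -
    have s: "second_moment P (\<lambda>w. X i w l)" "second_moment P (\<lambda>w. X n w m)"
      by (intro P.second_moment_fourth fourth_X lm)+
    have "integrable P (\<lambda>w. Z n w l m * (X i w l * X n w m))"
      by (intro integrable_second_mult second_Z second_moment_mult fourth_X lm)
    then have iu: "integrable P (\<lambda>w. X i w l * (Z n w l m * X n w m))" by (simp add: mult_ac)
    have "(\<integral>w. Z n w l m * (X i w l * X n w m) \<partial>P) = (\<integral>w. X i w l * (Z n w l m * X n w m) \<partial>P)"
      by (simp add: mult_ac)
    also have "\<dots> = (\<integral>x. X i (fst x) l * (Z n (fst x) l m * X n (fst x) m - Z n (?G x) l m * X n (?G x) m) \<partial>PP)"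
      using covariance_decouple[OF past_X[of i i l] P.integrable_second[OF s(1)]
          integrable_second_mult[OF second_Z[OF lm] s(2)] iu] integral_X[OF lm(1), of i]
      by (simp add: case_prod_unfold)
    also have "\<dots> = (\<integral>x. ?D x l m * (X i (fst x) l * X n (fst x) m) +
        Z n (?G x) l m * (X i (fst x) l * ?d x m) \<partial>PP)"
      by (simp add: algebra_simps)
    finally show ?thesis using i1[OF lm] i2[OF lm] by simp
  qed
  have "(\<integral>w. hs_inner B (Z n w) (tensor (X i w) (X n w)) \<partial>P) =
      (\<Sum>l\<in>B. \<Sum>m\<in>B. \<integral>w. Z n w l m * (X i w l * X n w m) \<partial>P)"
    unfolding hs_inner_def tensor_def
    by (simp add: Bochner_Integration.integral_sum Bochner_Integration.integrable_sum
        integrable_second_mult second_Z second_moment_mult fourth_X)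
  also have "\<dots> = (\<Sum>l\<in>B. \<Sum>m\<in>B. (\<integral>x. ?D x l m * (X i (fst x) l * X n (fst x) m) \<partial>PP) +
      (\<integral>x. Z n (?G x) l m * (X i (fst x) l * ?d x m) \<partial>PP))"
    by (intro sum.cong refl entry)
  also have "\<dots> = (\<integral>x. (\<Sum>l\<in>B. \<Sum>m\<in>B. ?D x l m * (X i (fst x) l * X n (fst x) m)) \<partial>PP) +
      (\<integral>x. (\<Sum>l\<in>B. \<Sum>m\<in>B. Z n (?G x) l m * (X i (fst x) l * ?d x m)) \<partial>PP)"
    by (simp add: sum.distrib Bochner_Integration.integral_sum Bochner_Integration.integrable_sum i1 i2)
  finally have e: "(\<integral>w. hs_inner B (Z n w) (tensor (X i w) (X n w)) \<partial>P) = \<dots>" .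
  have m: "(\<lambda>w. (\<Sum>l\<in>B. (X j w l)\<^sup>2)\<^sup>2) \<in> borel_measurable P" for j
    by (intro borel_measurable_power borel_measurable_sum fourth_momentD[OF fourth_X])
  have X4: "(\<integral>x. (\<Sum>l\<in>B. (X j (fst x) l)\<^sup>2)\<^sup>2 \<partial>PP) \<le> \<nu> ^ 4" for j
    using integral_measure_preserving[OF measurable_fst distr_fst m] X_norm4[of j] by simp
  have "\<bar>\<integral>x. (\<Sum>l\<in>B. \<Sum>m\<in>B. ?D x l m * (X i (fst x) l * X n (fst x) m)) \<partial>PP\<bar> \<le>
      (2 * \<nu> * \<delta> (n - i)) * (\<nu> * \<nu>)"
    by (rule Hoelder_trilinear[OF finite_B dZ _ _ Xf X4 _ Xf X4])
       (use Z_coupling[OF assms] \<nu> \<delta> in \<open>simp_all add: case_prod_unfold\<close>)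
  moreover have "\<bar>\<integral>x. (\<Sum>l\<in>B. \<Sum>m\<in>B. Z n (?G x) l m * (X i (fst x) l * ?d x m)) \<partial>PP\<bar> \<le>
      \<sigma> * (\<nu> * \<delta> (n - i))"
  proof (rule Hoelder_trilinear[OF finite_B gZ _ _ Xf X4 _ d])
    have "(\<lambda>w. \<Sum>l\<in>B. \<Sum>m\<in>B. (Z n w l m)\<^sup>2) \<in> borel_measurable P"
      by (intro borel_measurable_power borel_measurable_sum second_momentD[OF second_Z])
    from integral_measure_preserving[OF measurable_glue distr_glue this, of "int i"] sigma_gamma(5)[of n]
    show "(\<integral>x. (\<Sum>l\<in>B. \<Sum>m\<in>B. (Z n (?G x) l m)\<^sup>2) \<partial>PP) \<le> \<sigma>\<^sup>2" by (simp add: case_prod_unfold)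
  qed (use coupling_moment4[OF assms] \<nu> \<delta> sigma_gamma in \<open>simp_all add: case_prod_unfold\<close>)
  ultimately show ?thesis unfolding e by (simp add: algebra_simps power2_eq_square)
qed

end

section \<open>The finite-dimensional error bound\<close>

lemma sum_triangle:
  fixes F :: "nat \<Rightarrow> nat \<Rightarrow> real"
  shows "(\<Sum>k=1..N. \<Sum>q=1..k-1. F q (k - q)) = (\<Sum>q=1..N-1. \<Sum>r=1..N-q. F q r)"
  unfolding sum.Sigma[OF finite_atLeastAtMost ballI[OF finite_atLeastAtMost]]
  by (rule sum.reindex_bij_witness[of _ "\<lambda>(q, r). (q + r, q)" "\<lambda>(k, q). (q, k - q)"]) auto

context bernoulli_process begin

lemma sum_delta_le: "(\<Sum>q=1..k. \<delta> (Suc k - q)) \<le> \<Delta>"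
  using \<Delta>[of k] sum_reversed[of \<delta> k] by simp

lemma R_Suc: "R (Suc k) w = (\<lambda>l m. R k w l m + Z (Suc k) w l m)"
  by (simp add: R_def fun_eq_iff)

lemma R_0: "R 0 w = (\<lambda>l m. 0)"
  by (simp add: R_def fun_eq_iff)

lemma S_Suc: "S (Suc k) w = (\<lambda>l. S k w l + X (Suc k) w l)"
  by (simp add: S_def fun_eq_iff)

lemma RZ_bound: "\<bar>\<integral>w. hs_inner B (R k w) (Z (Suc k) w) \<partial>P\<bar> \<le> sqrt 2 * \<sigma> * (\<nu> * \<Delta>)"
proof -
  have "(\<integral>w. hs_inner B (R k w) (Z (Suc k) w) \<partial>P) =
      (\<integral>w. (\<Sum>n=1..k. hs_inner B (Z n w) (Z (Suc k) w)) \<partial>P)"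
    unfolding R_def by (simp only: hs_inner_sum_left)
  also have "\<dots> = (\<Sum>n=1..k. \<integral>w. hs_inner B (Z n w) (Z (Suc k) w) \<partial>P)"
    by (intro Bochner_Integration.integral_sum integrable_hs second_Z)
  finally have "\<bar>(\<integral>w. hs_inner B (R k w) (Z (Suc k) w) \<partial>P)\<bar> = \<bar>\<dots>\<bar>"
    by (rule arg_cong[where f=abs])
  also have "\<dots> \<le> (\<Sum>n=1..k. sqrt 2 * \<sigma> * (\<nu> * \<delta> (Suc k - n)))"
    by (intro order_trans[OF sum_abs] sum_mono ZZ_bound) auto
  also have "\<dots> = sqrt 2 * \<sigma> * (\<nu> * (\<Sum>n=1..k. \<delta> (Suc k - n)))"
    by (simp add: sum_distrib_left)
  also have "\<dots> \<le> sqrt 2 * \<sigma> * (\<nu> * \<Delta>)"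
    by (intro mult_left_mono sum_delta_le) (use sigma_gamma \<nu> in auto)
  finally show ?thesis .
qed

text \<open>
  Every further summand adds its own second moment and twice its covariance with the past, and
  that covariance is bounded by the summed coupling distances uniformly in \<open>k\<close>. Hence the second
  moment grows linearly.
\<close>

lemma R_norm:
  "(\<integral>w. hs_inner B (R (Suc k) w) (R (Suc k) w) \<partial>P) \<le>
    real (Suc k) * \<sigma>\<^sup>2 + 2 * sqrt 2 * \<sigma> * (\<nu> * \<Delta>) * real k"
proof (induction k)
  case 0
  have "R (Suc 0) w = Z (Suc 0) w" for w by (simp add: R_def fun_eq_iff)
  then show ?case using sigma_gamma(5)[of "Suc 0"] by (simp add: hs_inner_self)
next
  case (Suc k)
  have i: "integrable P (\<lambda>w. hs_inner B (R n w) (R n w))" "integrable P (\<lambda>w. hs_inner B (R n w) (Z m w))"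
    "integrable P (\<lambda>w. hs_inner B (Z m w) (Z m w))" for n m
    by (intro integrable_hs second_R second_Z; assumption)+
  have "hs_inner B (R (Suc (Suc k)) w) (R (Suc (Suc k)) w) = hs_inner B (R (Suc k) w) (R (Suc k) w) +
      2 * hs_inner B (R (Suc k) w) (Z (Suc (Suc k)) w) + hs_inner B (Z (Suc (Suc k)) w) (Z (Suc (Suc k)) w)" for w
    unfolding R_Suc[of "Suc k"] hs_inner_add_left hs_inner_add_right
    using hs_inner_commute[of B "Z (Suc (Suc k)) w" "R (Suc k) w"] by simp
  then have "(\<integral>w. hs_inner B (R (Suc (Suc k)) w) (R (Suc (Suc k)) w) \<partial>P) =
      (\<integral>w. hs_inner B (R (Suc k) w) (R (Suc k) w) \<partial>P) +
      2 * (\<integral>w. hs_inner B (R (Suc k) w) (Z (Suc (Suc k)) w) \<partial>P) +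
      (\<integral>w. hs_inner B (Z (Suc (Suc k)) w) (Z (Suc (Suc k)) w) \<partial>P)"
    using i by simp
  also have "\<dots> \<le> (real (Suc k) * \<sigma>\<^sup>2 + 2 * sqrt 2 * \<sigma> * (\<nu> * \<Delta>) * real k) +
      2 * (sqrt 2 * \<sigma> * (\<nu> * \<Delta>)) + \<sigma>\<^sup>2"
    using Suc.IH RZ_bound[of "Suc k"] sigma_gamma(5)[of "Suc (Suc k)"]
    by (intro add_mono mult_left_mono) (auto simp: hs_inner_self abs_le_iff)
  finally show ?case by (simp add: algebra_simps)
qed

lemma R_norm_le:
  "(\<integral>w. hs_inner B (R k w) (R k w) \<partial>P) \<le> real k * (\<sigma>\<^sup>2 + 2 * sqrt 2 * \<sigma> * (\<nu> * \<Delta>))"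
proof (cases k)
  case 0
  then show ?thesis by (simp add: R_0 hs_inner_zero)
next
  case (Suc j)
  have "0 \<le> 2 * sqrt 2 * \<sigma> * (\<nu> * \<Delta>)" using sigma_gamma(1) \<nu>(1) \<Delta>_nonneg by simp
  then show ?thesis using R_norm[of j] unfolding Suc by (simp add: algebra_simps)
qed

lemma cSX_bound: "\<bar>\<integral>w. hs_inner B c (tensor (S k w) (X (Suc k) w)) \<partial>P\<bar> \<le> \<gamma> * (\<nu> * \<Delta>) / sqrt 2"
proof -
  have "(\<integral>w. hs_inner B c (tensor (S k w) (X (Suc k) w)) \<partial>P) =
      (\<integral>w. (\<Sum>n=1..k. hs_inner B c (tensor (X n w) (X (Suc k) w))) \<partial>P)"
    unfolding S_def by (simp only: hs_inner_sum_right tensor_sum_left)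
  also have "\<dots> = (\<Sum>n=1..k. \<integral>w. hs_inner B c (tensor (X n w) (X (Suc k) w)) \<partial>P)"
    by (intro Bochner_Integration.integral_sum integrable_hs second_tensor fourth_X P.second_moment_const)
  finally have "\<bar>(\<integral>w. hs_inner B c (tensor (S k w) (X (Suc k) w)) \<partial>P)\<bar> = \<bar>\<dots>\<bar>"
    by (rule arg_cong[where f=abs])
  also have "\<dots> \<le> (\<Sum>n=1..k. \<gamma> * (\<nu> * \<delta> (Suc k - n)) / sqrt 2)"
    by (intro order_trans[OF sum_abs] sum_mono cXX_bound) auto
  also have "\<dots> = \<gamma> * (\<nu> * (\<Sum>n=1..k. \<delta> (Suc k - n))) / sqrt 2"
    by (simp add: sum_distrib_left sum_divide_distrib)
  also have "\<dots> \<le> \<gamma> * (\<nu> * \<Delta>) / sqrt 2"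
    by (intro divide_right_mono mult_left_mono sum_delta_le) (use sigma_gamma \<nu> in auto)
  finally show ?thesis .
qed

lemma cSS_bound:
  "(\<integral>w. hs_inner B c (tensor (S (Suc k) w) (S (Suc k) w)) \<partial>P) \<le>
    real (Suc k) * \<gamma>\<^sup>2 + sqrt 2 * \<gamma> * (\<nu> * \<Delta>) * real k"
proof -
  have cXX: "(\<integral>w. hs_inner B c (tensor (X n w) (X n w)) \<partial>P) = \<gamma>\<^sup>2" for n
  proof -
    have "(\<integral>w. hs_inner B c (tensor (X n w) (X n w)) \<partial>P) =
        (\<Sum>l\<in>B. \<Sum>m\<in>B. c l m * (\<integral>w. X n w l * X n w m \<partial>P))"
      unfolding hs_inner_def tensor_def
      by (simp add: Bochner_Integration.integral_sum Bochner_Integration.integrable_sum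
          integrable_second_mult P.second_moment_fourth fourth_X)
    also have "\<dots> = \<gamma>\<^sup>2" unfolding sigma_gamma(3) hs_inner_def by (simp add: integral_XX)
    finally show ?thesis .
  qed
  have i: "integrable P (\<lambda>w. hs_inner B c (tensor (S n w) (S n w)))"
    "integrable P (\<lambda>w. hs_inner B c (tensor (S n w) (X m w)))"
    "integrable P (\<lambda>w. hs_inner B c (tensor (X m w) (X m w)))" for n m
    by (intro integrable_hs second_tensor fourth_S fourth_X P.second_moment_const; assumption)+
  show ?thesis
  proof (induction k)
    case 0
    have "S (Suc 0) w = X (Suc 0) w" for w by (simp add: S_def fun_eq_iff)
    then show ?case by (simp add: cXX)
  next
    case (Suc k)
    let ?n = "Suc (Suc k)"
    have "hs_inner B c (tensor (S ?n w) (S ?n w)) = hs_inner B c (tensor (S (Suc k) w) (S (Suc k) w)) +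
        2 * hs_inner B c (tensor (S (Suc k) w) (X ?n w)) + hs_inner B c (tensor (X ?n w) (X ?n w))" for w
      unfolding S_Suc[of "Suc k"] tensor_add_left tensor_add_right hs_inner_add_right
      using hs_inner_tensor_swap[of c B "X ?n w" "S (Suc k) w"] c_sym by simp
    then have "(\<integral>w. hs_inner B c (tensor (S ?n w) (S ?n w)) \<partial>P) =
        (\<integral>w. hs_inner B c (tensor (S (Suc k) w) (S (Suc k) w)) \<partial>P) +
        2 * (\<integral>w. hs_inner B c (tensor (S (Suc k) w) (X ?n w)) \<partial>P) + \<gamma>\<^sup>2"
      using i by (simp add: cXX)
    also have "\<dots> \<le> (real (Suc k) * \<gamma>\<^sup>2 + sqrt 2 * \<gamma> * (\<nu> * \<Delta>) * real k) +
        2 * (\<gamma> * (\<nu> * \<Delta>) / sqrt 2) + \<gamma>\<^sup>2"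
      using Suc.IH cSX_bound[of "Suc k"] by (intro add_mono mult_left_mono) (auto simp: abs_le_iff)
    finally show ?case by (simp add: divide_sqrt2 algebra_simps)
  qed
qed

text \<open>
  The square root of the bound in \<open>R_norm_le\<close> for the second moment of \<open>R k\<close>.
\<close>

definition \<rho> :: "nat \<Rightarrow> real" where
  "\<rho> k = sqrt (real k * (\<sigma>\<^sup>2 + 2 * sqrt 2 * \<sigma> * (\<nu> * \<Delta>)))"

lemma rho: "0 \<le> \<rho> k \<and> (\<rho> k)\<^sup>2 = real k * (\<sigma>\<^sup>2 + 2 * sqrt 2 * \<sigma> * (\<nu> * \<Delta>))"
  using sigma_gamma(1) \<nu>(1) \<Delta>_nonneg by (simp add: \<rho>_def)

text \<open>
  The product of the partial sums \<open>R k\<close> and \<open>S k\<close> is split by the larger of the two time indices. Terms in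
  which the vector index is larger are summed over the matrix index into \<open>R (q - 1)\<close>, in order to use
  that its norm grows only like a square root.
\<close>

lemma RS_expansion:
  "hs_inner B (R k w) (tensor (S k w) y) =
    (\<Sum>q=1..k. hs_inner B (R (q - 1) w) (tensor (X q w) y) + (\<Sum>i=1..q. hs_inner B (Z q w) (tensor (X i w) y)))"
proof (induction k)
  case 0
  then show ?case by (simp add: R_0 hs_inner_zero)
next
  case (Suc k)
  have "hs_inner B (R (Suc k) w) (tensor (S (Suc k) w) y) = hs_inner B (R k w) (tensor (S k w) y) +
      hs_inner B (R k w) (tensor (X (Suc k) w) y) + hs_inner B (Z (Suc k) w) (tensor (S (Suc k) w) y)"
    unfolding R_Suc hs_inner_add_left unfolding S_Suc tensor_add_left hs_inner_add_right by simp
  also have "hs_inner B (Z (Suc k) w) (tensor (S (Suc k) w) y) =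
      (\<Sum>i=1..Suc k. hs_inner B (Z (Suc k) w) (tensor (X i w) y))"
    unfolding S_def by (simp only: hs_inner_sum_right tensor_sum_left)
  finally show ?case using Suc.IH by simp
qed

text \<open>
  The summand with latest time \<open>k\<close> in \<open>cubic_sum_expansion\<close>.
\<close>

definition cross_terms :: "nat \<Rightarrow> (int \<Rightarrow> 's) \<Rightarrow> real" where
  "cross_terms k w = hs_inner B (R (k-1) w) (tensor (S (k-1) w) (X k w)) +
     (\<Sum>j=1..k-1. hs_inner B (Z k w) (tensor (S (j-1) w) (X j w))) +
     hs_inner B (Z k w) (tensor (S (k-1) w) (X k w))"

text \<open>
  The coefficient of \<open>\<nu> * \<delta> (k - q)\<close> collected by all cuts at time \<open>q\<close>. The four summands come from the
  vector at time \<open>q\<close> against all earlier matrices, the matrix at time \<open>q\<close> against all vectors up to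
  \<open>q\<close>, the vector pairs with larger index \<open>q\<close>, and the terms whose latest time occurs twice.
\<close>

definition cut_weight :: "nat \<Rightarrow> real" where
  "cut_weight q = \<rho> (q - 1) + real q * \<sigma> + real (q - 1) * (sqrt 2 * \<nu>\<^sup>2) + (2 * \<nu>\<^sup>2 + \<sigma>)"

lemma cut_weight_nonneg: "0 \<le> cut_weight q"
  using rho sigma_gamma(1) by (simp add: cut_weight_def)

lemma integrable_cross_terms: "integrable P (cross_terms k)"
  unfolding cross_terms_def
  by (intro Bochner_Integration.integrable_add Bochner_Integration.integrable_sum integrable_hs
      second_R second_Z second_tensor fourth_S fourth_X)

lemma cross_terms_bound: "\<bar>\<integral>w. cross_terms k w \<partial>P\<bar> \<le> (\<Sum>q=1..k-1. cut_weight q * (\<nu> * \<delta> (k - q)))"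
proof -
  let ?d = "\<lambda>q. \<nu> * \<delta> (k - q)"
  have d0: "0 \<le> ?d q" for q using \<nu>(1) \<delta>(1) by simp
  have i: "integrable P (\<lambda>w. hs_inner B (R a w) (tensor (X b w) (X e w)))"
      "integrable P (\<lambda>w. hs_inner B (R a w) (tensor (S b w) (X e w)))"
      "integrable P (\<lambda>w. hs_inner B (Z a w) (tensor (X b w) (X e w)))"
      "integrable P (\<lambda>w. hs_inner B (Z a w) (tensor (S b w) (X e w)))" for a b e
    by (intro integrable_hs second_R second_Z second_tensor fourth_S fourth_X; assumption)+
  have T1: "\<bar>\<integral>w. hs_inner B (R (k-1) w) (tensor (S (k-1) w) (X k w)) \<partial>P\<bar> \<le>
      (\<Sum>q=1..k-1. \<rho> (q - 1) * ?d q + real q * \<sigma> * ?d q)"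
  proof -
    have "(\<integral>w. hs_inner B (R (k-1) w) (tensor (S (k-1) w) (X k w)) \<partial>P) =
      (\<Sum>q=1..k-1. (\<integral>w. hs_inner B (R (q - 1) w) (tensor (X q w) (X k w)) \<partial>P) +
        (\<Sum>i=1..q. \<integral>w. hs_inner B (Z q w) (tensor (X i w) (X k w)) \<partial>P))"
      unfolding RS_expansion by (simp add: Bochner_Integration.integral_sum i)
    then have "\<bar>(\<integral>w. hs_inner B (R (k-1) w) (tensor (S (k-1) w) (X k w)) \<partial>P)\<bar> = \<bar>\<dots>\<bar>"
      by (rule arg_cong[where f=abs])
    also have "\<dots> \<le> (\<Sum>q=1..k-1. \<rho> (q - 1) * ?d q + (\<Sum>i=1..q. \<sigma> * ?d q))"
    proof (intro order_trans[OF sum_abs] sum_mono order_trans[OF abs_triangle_ineq] add_mono)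
      fix q assume q: "q \<in> {1..k-1}"
      show "\<bar>\<integral>w. hs_inner B (R (q - 1) w) (tensor (X q w) (X k w)) \<partial>P\<bar> \<le> \<rho> (q - 1) * ?d q"
        by (rule trilinear_bound) (use q rho[of "q - 1"] R_norm_le[of "q - 1"] in
            \<open>auto intro!: past_R second_R\<close>)
      fix i assume "i \<in> {1..q}"
      then show "\<bar>\<integral>w. hs_inner B (Z q w) (tensor (X i w) (X k w)) \<partial>P\<bar> \<le> \<sigma> * ?d q"
        by (intro trilinear_bound) (use q sigma_gamma(1) sigma_gamma(5)[of q] in
            \<open>auto intro!: past_Z second_Z simp: hs_inner_self\<close>)
    qed
    finally show ?thesis by (simp add: mult.assoc)
  qed
  have T2: "\<bar>\<integral>w. (\<Sum>j=1..k-1. hs_inner B (Z k w) (tensor (S (j-1) w) (X j w))) \<partial>P\<bar> \<le>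
      (\<Sum>q=1..k-1. real (q - 1) * (sqrt 2 * \<nu>\<^sup>2) * ?d q)"
  proof -
    have "(\<integral>w. (\<Sum>j=1..k-1. hs_inner B (Z k w) (tensor (S (j-1) w) (X j w))) \<partial>P) =
        (\<integral>w. (\<Sum>j=1..k-1. \<Sum>i=1..j-1. hs_inner B (Z k w) (tensor (X i w) (X j w))) \<partial>P)"
      unfolding S_def by (simp only: hs_inner_sum_right tensor_sum_left)
    also have "\<dots> = (\<Sum>j=1..k-1. \<Sum>i=1..j-1. \<integral>w. hs_inner B (Z k w) (tensor (X i w) (X j w)) \<partial>P)"
      by (simp add: Bochner_Integration.integral_sum i)
    finally have "\<bar>(\<integral>w. (\<Sum>j=1..k-1. hs_inner B (Z k w) (tensor (S (j-1) w) (X j w))) \<partial>P)\<bar> = \<bar>\<dots>\<bar>"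
      by (rule arg_cong[where f=abs])
    also have "\<dots> \<le> (\<Sum>j=1..k-1. \<Sum>i=1..j-1. sqrt 2 * \<nu>\<^sup>2 * ?d j)"
      by (intro order_trans[OF sum_abs] sum_mono ZXX_bound) auto
    finally show ?thesis by (simp add: mult.assoc)
  qed
  have T3: "\<bar>\<integral>w. hs_inner B (Z k w) (tensor (S (k-1) w) (X k w)) \<partial>P\<bar> \<le>
      (\<Sum>q=1..k-1. (2 * \<nu>\<^sup>2 + \<sigma>) * ?d q)"
  proof -
    have "(\<integral>w. hs_inner B (Z k w) (tensor (S (k-1) w) (X k w)) \<partial>P) =
        (\<integral>w. (\<Sum>i=1..k-1. hs_inner B (Z k w) (tensor (X i w) (X k w))) \<partial>P)"
      unfolding S_def by (simp only: hs_inner_sum_right tensor_sum_left)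
    also have "\<dots> = (\<Sum>i=1..k-1. \<integral>w. hs_inner B (Z k w) (tensor (X i w) (X k w)) \<partial>P)"
      by (simp add: Bochner_Integration.integral_sum i)
    finally have "\<bar>(\<integral>w. hs_inner B (Z k w) (tensor (S (k-1) w) (X k w)) \<partial>P)\<bar> = \<bar>\<dots>\<bar>"
      by (rule arg_cong[where f=abs])
    also have "\<dots> \<le> (\<Sum>q=1..k-1. (2 * \<nu>\<^sup>2 + \<sigma>) * ?d q)"
      by (intro order_trans[OF sum_abs] sum_mono XZX_bound) auto
    finally show ?thesis .
  qed
  have "(\<integral>w. cross_terms k w \<partial>P) = (\<integral>w. hs_inner B (R (k-1) w) (tensor (S (k-1) w) (X k w)) \<partial>P) +
      (\<integral>w. (\<Sum>j=1..k-1. hs_inner B (Z k w) (tensor (S (j-1) w) (X j w))) \<partial>P) +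
      (\<integral>w. hs_inner B (Z k w) (tensor (S (k-1) w) (X k w)) \<partial>P)"
    unfolding cross_terms_def by (simp add: i)
  then have "\<bar>(\<integral>w. cross_terms k w \<partial>P)\<bar> = \<bar>\<dots>\<bar>"
    by (rule arg_cong[where f=abs])
  also have "\<dots> \<le> (\<Sum>q=1..k-1. \<rho> (q - 1) * ?d q + real q * \<sigma> * ?d q) +
      (\<Sum>q=1..k-1. real (q - 1) * (sqrt 2 * \<nu>\<^sup>2) * ?d q) + (\<Sum>q=1..k-1. (2 * \<nu>\<^sup>2 + \<sigma>) * ?d q)"
    by (intro order_trans[OF abs_triangle_ineq] add_mono T1 T2 T3)
  also have "\<dots> = (\<Sum>q=1..k-1. cut_weight q * ?d q)"
    by (simp add: sum.distrib[symmetric] cut_weight_def algebra_simps)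
  finally show ?thesis .
qed

lemma cubic_bound:
  "\<bar>(\<integral>w. hs_inner B (R N w) (tensor (S N w) (S N w)) \<partial>P) - (\<integral>w. hs_inner B (R N w) (R N w) \<partial>P)\<bar> \<le>
    2 * (\<nu> * \<Delta>) * (\<Sum>q=1..N-1. cut_weight q)"
proof -
  have e: "hs_inner B (R N w) (tensor (S N w) (S N w)) = hs_inner B (R N w) (R N w) +
      real N * hs_inner B (R N w) c + 2 * (\<Sum>k=1..N. cross_terms k w)" for w
    using cubic_sum_expansion[where c=c and B=B and N=N and X="\<lambda>n. X n w", OF c_sym]
    unfolding cross_terms_def R_def S_def Z_def by blast
  have Rc: "(\<integral>w. hs_inner B (R N w) c \<partial>P) = 0"
    unfolding R_def hs_inner_sum_left
    by (subst Bochner_Integration.integral_sum)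
       (simp_all add: integral_Z_const integrable_hs second_Z P.second_moment_const)
  have i: "integrable P (\<lambda>w. hs_inner B (R N w) (R N w))" "integrable P (\<lambda>w. hs_inner B (R N w) c)"
    by (intro integrable_hs second_R P.second_moment_const; assumption)+
  have "(\<integral>w. hs_inner B (R N w) (tensor (S N w) (S N w)) \<partial>P) =
      (\<integral>w. hs_inner B (R N w) (R N w) \<partial>P) + 2 * (\<Sum>k=1..N. \<integral>w. cross_terms k w \<partial>P)"
    unfolding e by (simp add: i integrable_cross_terms Rc Bochner_Integration.integral_sum)
  then have "\<bar>(\<integral>w. hs_inner B (R N w) (tensor (S N w) (S N w)) \<partial>P) - (\<integral>w. hs_inner B (R N w) (R N w) \<partial>P)\<bar>
      = 2 * \<bar>\<Sum>k=1..N. \<integral>w. cross_terms k w \<partial>P\<bar>" by simp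
  also have "2 * \<bar>\<Sum>k=1..N. \<integral>w. cross_terms k w \<partial>P\<bar> \<le> 2 * (\<nu> * \<Delta>) * (\<Sum>q=1..N-1. cut_weight q)"
  proof -
    have "\<bar>\<Sum>k=1..N. \<integral>w. cross_terms k w \<partial>P\<bar> \<le> (\<Sum>k=1..N. \<Sum>q=1..k-1. cut_weight q * (\<nu> * \<delta> (k - q)))"
    by (intro order_trans[OF sum_abs] sum_mono cross_terms_bound)
  also have "\<dots> = (\<Sum>q=1..N-1. \<Sum>r=1..N-q. cut_weight q * (\<nu> * \<delta> r))"
    by (rule sum_triangle)
  also have "\<dots> = (\<Sum>q=1..N-1. cut_weight q * (\<nu> * (\<Sum>r=1..N-q. \<delta> r)))"
    by (simp add: sum_distrib_left)
  also have "\<dots> \<le> (\<Sum>q=1..N-1. cut_weight q * (\<nu> * \<Delta>))"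
    by (intro sum_mono mult_left_mono \<Delta> cut_weight_nonneg \<nu>)
    also have "\<dots> = (\<Sum>q=1..N-1. cut_weight q) * (\<nu> * \<Delta>)" by (simp add: sum_distrib_right)
    finally show ?thesis by (simp add: mult_ac)
  qed
  finally show ?thesis .
qed

definition emp_error :: "nat \<Rightarrow> (int \<Rightarrow> 's) \<Rightarrow> 'i \<Rightarrow> 'i \<Rightarrow> real" where
  "emp_error N w l m = (\<Sum>n=1..N. (X n w l - (\<Sum>n=1..N. X n w l) / real N) *
     (X n w m - (\<Sum>n=1..N. X n w m) / real N)) / real N - c l m"

text \<open>
  \<open>V\<close>, \<open>G\<close> and \<open>H\<close> are the expectations of \<open>\<parallel>A\<parallel>\<^sup>2\<close>, \<open>\<langle>C, b\<rangle>\<close> and \<open>\<langle>A, b\<rangle>\<close> up to powers of \<open>N\<close>.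
  The pathwise bounds of \<open>centered_covariance_bounds\<close> turn into the two alternatives that
  \<open>centering_bound_scaled\<close> combines.
\<close>

theorem emp_error_bound:
  assumes N: "1 \<le> N"
  shows "integrable P (\<lambda>w. hs_inner B (emp_error N w) (emp_error N w))"
    and "real N * (\<integral>w. hs_inner B (emp_error N w) (emp_error N w) \<partial>P) \<le>
      \<nu> ^ 4 + 4 * sqrt 2 * \<nu> ^ 3 * \<Delta>"
proof -
  have n0: "real N > 0" using N by simp
  have "second_moment P (\<lambda>w. emp_error N w l m)" if "l \<in> B" "m \<in> B" for l m
  proof -
    have f: "fourth_moment P (\<lambda>w. X n w l - (1 / real N) * (\<Sum>n=1..N. X n w l))" if "l \<in> B" for n l
      by (intro fourth_moment_diff fourth_moment_cmult fourth_moment_sum fourth_X that)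
    have "second_moment P (\<lambda>w. (1 / real N) * (\<Sum>n=1..N. (X n w l - (1 / real N) * (\<Sum>n=1..N. X n w l)) *
       (X n w m - (1 / real N) * (\<Sum>n=1..N. X n w m))) - c l m)"
      by (intro second_moment_diff second_moment_cmult second_moment_sum second_moment_mult f
          P.second_moment_const that)
    then show ?thesis unfolding emp_error_def by simp
  qed
  then show iE: "integrable P (\<lambda>w. hs_inner B (emp_error N w) (emp_error N w))"
    by (intro integrable_hs)
  define V where "V = (\<integral>w. hs_inner B (R N w) (R N w) \<partial>P)"
  define G where "G = (\<integral>w. hs_inner B c (tensor (S N w) (S N w)) \<partial>P)"
  define H where "H = (\<integral>w. hs_inner B (R N w) (tensor (S N w) (S N w)) \<partial>P)"
  have i: "integrable P (\<lambda>w. hs_inner B (R N w) (R N w))"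
    "integrable P (\<lambda>w. hs_inner B c (tensor (S N w) (S N w)))"
    "integrable P (\<lambda>w. hs_inner B (R N w) (tensor (S N w) (S N w)))"
    by (intro integrable_hs second_tensor second_R fourth_S P.second_moment_const; assumption)+
  have A: "(\<lambda>l m. (\<Sum>n=1..N. tensor (X n w) (X n w) l m - c l m) / real N) =
      (\<lambda>l m. (1 / real N) * R N w l m)" for w
    by (simp add: R_def Z_def fun_eq_iff)
  have b: "tensor (\<lambda>l. (\<Sum>n=1..N. X n w l) / real N) (\<lambda>l. (\<Sum>n=1..N. X n w l) / real N) =
      (\<lambda>l m. (1 / (real N)\<^sup>2) * tensor (S N w) (S N w) l m)" for w
    by (simp add: S_def tensor_def fun_eq_iff power2_eq_square)
  note pw = centered_covariance_bounds[OF N, where X="\<lambda>n. X n w" and B=B and c=c for w,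
      folded emp_error_def, unfolded A b hs_inner_cmult_left hs_inner_cmult_right]
  let ?Q = "\<integral>w. hs_inner B (emp_error N w) (emp_error N w) \<partial>P"
  have E: "emp_error N w = (\<lambda>l m. (\<Sum>n=1..N. (X n w l - (\<Sum>n=1..N. X n w l) / real N) *
     (X n w m - (\<Sum>n=1..N. X n w m) / real N)) / real N - c l m)" for w
    by (simp add: emp_error_def fun_eq_iff)
  have "?Q \<le> (\<integral>w. 1 / real N * (1 / real N * hs_inner B (R N w) (R N w)) +
      2 * (1 / (real N)\<^sup>2 * hs_inner B c (tensor (S N w) (S N w))) \<partial>P)"
    using i iE pw(1) unfolding E by (intro integral_mono) auto
  also have "\<dots> = V / (real N)\<^sup>2 + 2 * (G / (real N)\<^sup>2)"
    using i by (simp add: V_def G_def power2_eq_square)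
  finally have "real N * ?Q \<le> real N * (V / (real N)\<^sup>2 + 2 * (G / (real N)\<^sup>2))"
    using n0 by (intro mult_left_mono) auto
  also have "\<dots> = V / real N + 2 * (G / real N)"
    using n0 by (simp add: power2_eq_square field_simps)
  finally have QA: "real N * ?Q \<le> V / real N + 2 * (G / real N)" .
  have "?Q \<le> (\<integral>w. 1 / real N * (1 / real N * hs_inner B (R N w) (R N w)) -
      1 / real N * (1 / (real N)\<^sup>2 * hs_inner B (R N w) (tensor (S N w) (S N w))) +
      1 / (real N)\<^sup>2 * hs_inner B c (tensor (S N w) (S N w)) \<partial>P)"
    using i iE pw(2) unfolding E by (intro integral_mono) (auto simp: mult.left_commute)
  also have "\<dots> = V / (real N)\<^sup>2 - H / (real N) ^ 3 + G / (real N)\<^sup>2"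
    using i by (simp add: V_def G_def H_def power2_eq_square power3_eq_cube)
  finally have "real N * ?Q \<le> real N * (V / (real N)\<^sup>2 - H / (real N) ^ 3 + G / (real N)\<^sup>2)"
    using n0 by (intro mult_left_mono) auto
  also have "\<dots> = V / real N - (V + (H - V)) / (real N)\<^sup>2 + G / real N"
    using n0 by (simp add: power2_eq_square power3_eq_cube field_simps)
  finally have QB: "real N * ?Q \<le> V / real N - (V + (H - V)) / (real N)\<^sup>2 + G / real N" .
  obtain N' where N': "N = Suc N'" using N by (cases N) auto
  have "real N * ?Q \<le> (\<nu>\<^sup>2)\<^sup>2 + 4 * sqrt 2 * \<nu>\<^sup>2 * (\<nu> * \<Delta>)"
  proof (rule centering_bound_scaled[OF sigma_gamma(1,2,4) _ _ N _ _ _ _ QA QB])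
    show "V \<le> real N * \<sigma>\<^sup>2 + 2 * sqrt 2 * \<sigma> * (\<nu> * \<Delta>) * (real N - 1)"
      using R_norm[of N'] unfolding V_def N' by simp
    show "G \<le> real N * \<gamma>\<^sup>2 + sqrt 2 * \<gamma> * (\<nu> * \<Delta>) * (real N - 1)"
      using cSS_bound[of N'] unfolding G_def N' by simp
    show "0 \<le> \<rho> k \<and> (\<rho> k)\<^sup>2 \<le> real k * (\<sigma>\<^sup>2 + 2 * sqrt 2 * \<sigma> * (\<nu> * \<Delta>))" for k
      using rho[of k] by simp
    show "- (H - V) \<le> 2 * (\<nu> * \<Delta>) * (\<Sum>q = 1..N - 1. \<rho> (q - 1) + real q * \<sigma> +
        real (q - 1) * (sqrt 2 * \<nu>\<^sup>2) + (2 * \<nu>\<^sup>2 + \<sigma>))"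
      using cubic_bound[of N] unfolding H_def V_def cut_weight_def by (simp only: abs_le_iff)
  qed (use \<nu>(1) \<Delta>_nonneg in auto)
  then show "real N * ?Q \<le> \<nu> ^ 4 + 4 * sqrt 2 * \<nu> ^ 3 * \<Delta>"
    by (simp add: power2_eq_square power3_eq_cube mult_ac power4_eq_xxxx)
qed

end

section \<open>Orthonormal bases of separable inner product spaces\<close>

text \<open>
  Vectors are not normalized and zero vectors are kept, which makes the recursion total: for a zero
  vector the quotient is zero by the convention for division.
\<close>

fun gram_schmidt :: "(nat \<Rightarrow> 'a::real_inner) \<Rightarrow> nat \<Rightarrow> 'a" where
  "gram_schmidt g n = g n - (\<Sum>k<n. (inner (g n) (gram_schmidt g k) /
     inner (gram_schmidt g k) (gram_schmidt g k)) *\<^sub>R gram_schmidt g k)"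

declare gram_schmidt.simps[simp del]

lemma gram_schmidt_orthogonal_less: "m < n \<Longrightarrow> inner (gram_schmidt g n) (gram_schmidt g m) = 0"
proof (induction n arbitrary: m rule: less_induct)
  case (less n)
  let ?h = "gram_schmidt g"
  have orth: "inner (?h k) (?h m) = 0" if "k < n" "k \<noteq> m" for k
    using less.IH[of k m] less.IH[of m k] that less.prems by (cases "k < m") (auto simp: inner_commute)
  have "inner (?h n) (?h m) = inner (g n) (?h m) -
      (\<Sum>k<n. inner (g n) (?h k) / inner (?h k) (?h k) * inner (?h k) (?h m))"
    by (subst gram_schmidt.simps) (simp add: inner_diff_left inner_sum_left)
  also have "(\<Sum>k<n. inner (g n) (?h k) / inner (?h k) (?h k) * inner (?h k) (?h m)) =
      (\<Sum>k\<in>{m}. inner (g n) (?h k) / inner (?h k) (?h k) * inner (?h k) (?h m))"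
    using less.prems orth by (intro sum.mono_neutral_right) auto
  also have "\<dots> = inner (g n) (?h m)" by simp
  finally show ?case by simp
qed

lemma gram_schmidt_orthogonal: "m \<noteq> n \<Longrightarrow> inner (gram_schmidt g n) (gram_schmidt g m) = 0"
  using gram_schmidt_orthogonal_less[of m n g] gram_schmidt_orthogonal_less[of n m g]
  by (cases "m < n") (auto simp: inner_commute)

lemma orthonormal_basis_exists:
  fixes g :: "nat \<Rightarrow> 'a::real_inner"
  assumes dense: "closure (span (range g)) = UNIV"
  shows "\<exists>B :: 'a set. orthonormal_basis B"
proof -
  let ?h = "gram_schmidt g"
  define B where "B = (\<lambda>n. sgn (?h n)) ` {n. ?h n \<noteq> 0}"
  have h: "?h n \<in> span B" for n
  proof (cases "?h n = 0")
    case False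
    then have "norm (?h n) *\<^sub>R sgn (?h n) \<in> span B" by (intro span_scale span_base) (auto simp: B_def)
    then show ?thesis by (simp add: sgn_div_norm False)
  qed (simp add: span_zero)
  have "g n \<in> span B" for n
  proof -
    have "g n = ?h n + (\<Sum>k<n. (inner (g n) (?h k) / inner (?h k) (?h k)) *\<^sub>R ?h k)"
      by (subst gram_schmidt.simps) simp
    also have "\<dots> \<in> span B" by (intro span_add span_sum span_scale h)
    finally show ?thesis .
  qed
  then have "span (range g) \<subseteq> span B" by (intro span_minimal) auto
  then have "closure (span B) = UNIV" using closure_mono dense by blast
  moreover have "pairwise orthogonal B"
    unfolding pairwise_def B_def orthogonal_def
    by (auto simp: sgn_div_norm) (metis gram_schmidt_orthogonal)
  moreover have "\<forall>e\<in>B. norm e = 1" by (auto simp: B_def norm_sgn)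
  ultimately show ?thesis unfolding orthonormal_basis_def by blast
qed

locale orthonormal_family =
  fixes B :: "'a::real_inner set"
  assumes orth: "pairwise orthogonal B" and unit: "\<forall>e\<in>B. norm e = 1"
begin

lemma inner_basis: "e \<in> B \<Longrightarrow> e' \<in> B \<Longrightarrow> inner e e' = (if e = e' then 1 else 0)"
  using orth unit by (auto simp: pairwise_def orthogonal_def power2_norm_eq_inner[symmetric])

lemma projection_inner:
  assumes "finite F" "F \<subseteq> B" "e \<in> F"
  shows "inner (\<Sum>e'\<in>F. inner x e' *\<^sub>R e') e = inner x e"
proof -
  have "inner (\<Sum>e'\<in>F. inner x e' *\<^sub>R e') e = (\<Sum>e'\<in>F. inner x e' * (if e' = e then 1 else 0))"
    unfolding inner_sum_left
  proof (rule sum.cong[OF refl])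
    fix e' assume "e' \<in> F"
    then have "inner e' e = (if e' = e then 1 else 0)" using assms by (intro inner_basis) auto
    then show "inner (inner x e' *\<^sub>R e') e = inner x e' * (if e' = e then 1 else 0)" by simp
  qed
  then show ?thesis using assms by (simp add: if_distrib cong: if_cong)
qed

lemma norm_projection:
  assumes "finite F" "F \<subseteq> B"
  shows "(norm (\<Sum>e\<in>F. inner x e *\<^sub>R e))\<^sup>2 = (\<Sum>e\<in>F. (inner x e)\<^sup>2)"
proof -
  let ?p = "\<Sum>e\<in>F. inner x e *\<^sub>R e"
  have "(norm ?p)\<^sup>2 = inner ?p ?p" by (rule power2_norm_eq_inner)
  also have "\<dots> = (\<Sum>e\<in>F. inner x e * inner ?p e)" by (simp add: inner_sum_right)
  also have "\<dots> = (\<Sum>e\<in>F. (inner x e)\<^sup>2)"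
    using projection_inner[OF assms] by (simp add: power2_eq_square)
  finally show ?thesis .
qed

lemma norm_diff_projection:
  assumes "finite F" "F \<subseteq> B"
  shows "(norm (x - (\<Sum>e\<in>F. inner x e *\<^sub>R e)))\<^sup>2 = (norm x)\<^sup>2 - (\<Sum>e\<in>F. (inner x e)\<^sup>2)"
proof -
  let ?p = "\<Sum>e\<in>F. inner x e *\<^sub>R e"
  have "inner x ?p = (\<Sum>e\<in>F. (inner x e)\<^sup>2)" by (simp add: inner_sum_right power2_eq_square)
  then show ?thesis
    using norm_projection[OF assms, of x]
    by (simp add: power2_norm_eq_inner inner_diff_left inner_diff_right inner_commute)
qed

lemma Bessel: "finite F \<Longrightarrow> F \<subseteq> B \<Longrightarrow> (\<Sum>e\<in>F. (inner x e)\<^sup>2) \<le> (norm x)\<^sup>2"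
  using norm_diff_projection[of F x] zero_le_power2[of "norm (x - (\<Sum>e\<in>F. inner x e *\<^sub>R e))"] by simp

text \<open>
  The residual of the projection is orthogonal to \<open>span F\<close>, so Pythagoras applies.
\<close>

lemma best_approximation:
  assumes "finite F" "F \<subseteq> B" "y \<in> span F"
  shows "norm (x - (\<Sum>e\<in>F. inner x e *\<^sub>R e)) \<le> norm (x - y)"
proof (rule power2_le_imp_le)
  let ?p = "\<Sum>e\<in>F. inner x e *\<^sub>R e"
  have pF: "?p \<in> span F" by (intro span_sum span_scale span_base)
  have "inner (x - ?p) z = 0" if "z \<in> span F" for z
    using that
  proof (induction rule: span_induct_alt)
    case (step c e z)
    then show ?case using projection_inner[OF assms(1,2), of e x]
      by (simp add: inner_diff_left inner_add_right)
  qed simp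
  then have "inner (x - ?p) (?p - y) = 0" using pF assms(3) span_diff by blast
  then have "(norm ((x - ?p) + (?p - y)))\<^sup>2 = (norm (x - ?p))\<^sup>2 + (norm (?p - y))\<^sup>2"
    by (intro norm_add_Pythagorean) (simp add: orthogonal_def)
  then show "(norm (x - ?p))\<^sup>2 \<le> (norm (x - y))\<^sup>2" by simp
qed simp

lemma summable_inner: "(\<lambda>e. (inner x e)\<^sup>2) summable_on B"
  by (rule nonneg_bdd_above_summable_on) (auto intro!: bdd_aboveI2 Bessel)

end

lemma orthonormal_basis_family: "orthonormal_basis B \<Longrightarrow> orthonormal_family B"
  by (simp add: orthonormal_basis_def orthonormal_family_def)

text \<open>
  A finite combination of basis vectors that is close to \<open>x\<close> cannot be closer than the orthogonal
  projection onto any finite set of basis vectors containing those involved.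
\<close>

lemma Parseval_approximation:
  assumes B: "orthonormal_basis B" and \<epsilon>: "0 < (\<epsilon>::real)"
  obtains F where "finite F" "F \<subseteq> B"
    "\<And>F'. finite F' \<Longrightarrow> F \<subseteq> F' \<Longrightarrow> F' \<subseteq> B \<Longrightarrow> (norm x)\<^sup>2 - \<epsilon> \<le> (\<Sum>e\<in>F'. (inner x e)\<^sup>2)"
proof -
  interpret orthonormal_family B using B by (rule orthonormal_basis_family)
  have "x \<in> closure (span B)" using B by (simp add: orthonormal_basis_def)
  then obtain y where y: "y \<in> span B" "dist y x < sqrt \<epsilon>"
    using \<epsilon> closure_approachable[of x "span B"] by (meson real_sqrt_gt_zero)
  obtain F c where F: "finite F" "F \<subseteq> B" "y = (\<Sum>e\<in>F. c e *\<^sub>R e)"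
    using y(1) unfolding span_explicit by blast
  show ?thesis
  proof (rule that[OF F(1,2)])
    fix F' assume F': "finite F'" "F \<subseteq> F'" "F' \<subseteq> B"
    have "y \<in> span F'" unfolding F(3) using F'(2) by (intro span_sum span_scale span_base) auto
    then have "norm (x - (\<Sum>e\<in>F'. inner x e *\<^sub>R e)) \<le> norm (x - y)"
      by (rule best_approximation[OF F'(1,3)])
    also have "\<dots> \<le> sqrt \<epsilon>" using y(2) by (simp add: dist_norm norm_minus_commute)
    finally have "(norm (x - (\<Sum>e\<in>F'. inner x e *\<^sub>R e)))\<^sup>2 \<le> (sqrt \<epsilon>)\<^sup>2" by (intro power_mono) auto
    then show "(norm x)\<^sup>2 - \<epsilon> \<le> (\<Sum>e\<in>F'. (inner x e)\<^sup>2)"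
      using norm_diff_projection[OF F'(1,3), of x] \<epsilon> by simp
  qed
qed

text \<open>
  By Bessel's inequality each \<open>g n\<close> is orthogonal to all but countably many elements of \<open>B\<close>, and no
  element of \<open>B\<close> is orthogonal to every \<open>g n\<close>.
\<close>

lemma orthonormal_basis_countable:
  fixes g :: "nat \<Rightarrow> 'a::real_inner" and B :: "'a set"
  assumes B: "orthonormal_basis B" and dense: "closure (span (range g)) = UNIV"
  shows "countable B"
proof -
  interpret orthonormal_family B using B by (rule orthonormal_basis_family)
  have "B \<subseteq> (\<Union>n. {e\<in>B. (inner (g n) e)\<^sup>2 \<noteq> 0})"
  proof
    fix e assume e: "e \<in> B"
    have "\<exists>n. inner (g n) e \<noteq> 0"
    proof (rule ccontr)
      assume "\<not> ?thesis"
      then have z: "inner (g n) e = 0" for n by simp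
      have "span (range g) \<subseteq> {y. inner y e = 0}"
        using z by (intro span_minimal) (auto simp: subspace_def inner_add_left)
      moreover have "closed {y. inner y e = 0}"
        by (intro closed_Collect_eq continuous_intros)
      ultimately have "closure (span (range g)) \<subseteq> {y. inner y e = 0}" by (rule closure_minimal)
      then have "e \<in> {y. inner y e = 0}" unfolding dense by (rule subsetD) simp
      then show False using inner_basis[OF e e] by simp
    qed
    then show "e \<in> (\<Union>n. {e\<in>B. (inner (g n) e)\<^sup>2 \<noteq> 0})" using e by auto
  qed
  moreover have "countable {e\<in>B. (inner (g n) e)\<^sup>2 \<noteq> 0}" for n
    by (rule summable_countable_real[OF summable_inner])
  ultimately show ?thesis by (meson countable_UN countable_subset uncountable_def countableI_type)
qed

section \<open>Separability of the space of square integrable functions\<close>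

lemma square_integrableD: "square_integrable f \<Longrightarrow> f \<in> borel_measurable unit_interval"
  "square_integrable f \<Longrightarrow> integrable unit_interval (\<lambda>t. (f t)\<^sup>2)"
  by (simp_all add: square_integrable_def)

lemma square_integrable_rep: "square_integrable (rep_L2 h)"
  using Quotient3_rep_reflp[OF Quotient3_L2, of h] by simp

lemma abs_rep_L2: "abs_L2 (rep_L2 h) = h"
  by (rule Quotient3_abs_rep[OF Quotient3_L2])

lemma abs_L2_eqI:
  "square_integrable f \<Longrightarrow> square_integrable g \<Longrightarrow> (AE t in unit_interval. f t = g t) \<Longrightarrow> abs_L2 f = abs_L2 g"
  by (rule Quotient3_rel_abs[OF Quotient3_L2]) simp

lemma abs_L2_add: "square_integrable f \<Longrightarrow> square_integrable g \<Longrightarrow>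
    abs_L2 f + abs_L2 g = abs_L2 (\<lambda>t. f t + g t)"
  by (simp add: plus_L2.abs_eq)

lemma abs_L2_diff: "square_integrable f \<Longrightarrow> square_integrable g \<Longrightarrow>
    abs_L2 f - abs_L2 g = abs_L2 (\<lambda>t. f t - g t)"
  by (simp add: minus_L2.abs_eq)

lemma abs_L2_scale: "square_integrable f \<Longrightarrow> r *\<^sub>R abs_L2 f = abs_L2 (\<lambda>t. r * f t)"
  by (simp add: scaleR_L2.abs_eq)

lemma inner_abs_L2: "square_integrable f \<Longrightarrow> square_integrable g \<Longrightarrow>
    inner (abs_L2 f) (abs_L2 g) = (\<integral>t. f t * g t \<partial>unit_interval)"
  by (simp add: inner_L2.abs_eq)

lemma norm_abs_L2: "square_integrable f \<Longrightarrow> (norm (abs_L2 f))\<^sup>2 = (\<integral>t. (f t)\<^sup>2 \<partial>unit_interval)"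
  by (simp add: power2_norm_eq_inner inner_abs_L2) (simp add: power2_eq_square)

lemma square_integrable_sum:
  "(\<And>i. i \<in> I \<Longrightarrow> square_integrable (f i)) \<Longrightarrow> square_integrable (\<lambda>t. \<Sum>i\<in>I. f i t)"
  by (induction I rule: infinite_finite_induct)
     (auto intro: square_integrable_add simp: square_integrable_zero)

lemma abs_L2_zero: "abs_L2 (\<lambda>t. 0) = 0"
  by (simp add: zero_L2_def)

lemma abs_L2_sum:
  "finite I \<Longrightarrow> (\<And>i. i \<in> I \<Longrightarrow> square_integrable (f i)) \<Longrightarrow>
    (\<Sum>i\<in>I. abs_L2 (f i)) = abs_L2 (\<lambda>t. \<Sum>i\<in>I. f i t)"
  by (induction I rule: finite_induct)
     (auto simp: abs_L2_add abs_L2_zero square_integrable_sum)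

interpretation unit_interval: prob_space unit_interval
  by standard (simp add: emeasure_restrict_space)

lemma square_integrable_bounded:
  assumes "f \<in> borel_measurable unit_interval" "\<And>t. t \<in> {0..1} \<Longrightarrow> \<bar>f t\<bar> \<le> K"
  shows "square_integrable f"
proof -
  have "integrable unit_interval (\<lambda>t. (f t)\<^sup>2)"
  proof (rule unit_interval.integrable_const_bound)
    show "AE t in unit_interval. norm ((f t)\<^sup>2) \<le> K\<^sup>2"
    proof (rule AE_I2)
      fix t assume "t \<in> space unit_interval"
      then have "\<bar>f t\<bar> \<le> K" using assms(2) by (simp add: space_restrict_space)
      then show "norm ((f t)\<^sup>2) \<le> K\<^sup>2" using abs_le_square_iff[of "f t" K] by simp
    qed
  qed (use assms(1) in measurable)
  then show ?thesis using assms(1) by (simp add: square_integrable_def)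
qed

lemma square_integrable_dominated:
  assumes "f \<in> borel_measurable unit_interval" "square_integrable g"
    "\<And>t. t \<in> space unit_interval \<Longrightarrow> \<bar>f t\<bar> \<le> \<bar>g t\<bar>"
  shows "square_integrable f"
  unfolding square_integrable_def
proof
  show "integrable unit_interval (\<lambda>t. (f t)\<^sup>2)"
  proof (rule Bochner_Integration.integrable_bound[OF square_integrableD(2)[OF assms(2)]])
    show "AE t in unit_interval. norm ((f t)\<^sup>2) \<le> norm ((g t)\<^sup>2)"
      using assms(3) by (intro AE_I2) (simp add: abs_le_square_iff[symmetric])
  qed (use assms(1) in measurable)
qed fact

lemma L2_dominated_convergence:
  assumes U: "\<And>i. U i \<in> borel_measurable unit_interval" and u: "u \<in> borel_measurable unit_interval"
    and g: "square_integrable g"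
    and le: "\<And>i t. t \<in> space unit_interval \<Longrightarrow> \<bar>U i t\<bar> \<le> g t"
    and lim: "\<And>t. t \<in> space unit_interval \<Longrightarrow> (\<lambda>i. U i t) \<longlonglongrightarrow> u t"
  shows "(\<lambda>i. abs_L2 (U i)) \<longlonglongrightarrow> abs_L2 u"
proof -
  have leu: "\<bar>u t\<bar> \<le> g t" if "t \<in> space unit_interval" for t
    by (rule LIMSEQ_le_const2[OF tendsto_rabs[OF lim[OF that]]]) (use le that in auto)
  have si: "square_integrable (U i)" for i
    by (rule square_integrable_dominated[OF U g]) (use le in \<open>fastforce intro: order_trans abs_ge_self\<close>)
  have su: "square_integrable u"
    by (rule square_integrable_dominated[OF u g]) (use leu in \<open>fastforce intro: order_trans abs_ge_self\<close>)
  have n: "norm (abs_L2 (U i) - abs_L2 u) = sqrt (\<integral>t. (U i t - u t)\<^sup>2 \<partial>unit_interval)" for i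
    using norm_abs_L2[OF square_integrable_diff[OF si su], of i]
    by (simp add: abs_L2_diff[OF si su] real_sqrt_unique)
  have "(\<lambda>i. \<integral>t. (U i t - u t)\<^sup>2 \<partial>unit_interval) \<longlonglongrightarrow> (\<integral>t. 0 \<partial>unit_interval)"
  proof (rule integral_dominated_convergence)
    show "integrable unit_interval (\<lambda>t. 4 * (g t)\<^sup>2)" using g by (simp add: square_integrable_def)
    show "AE t in unit_interval. (\<lambda>i. (U i t - u t)\<^sup>2) \<longlonglongrightarrow> 0"
    proof (rule AE_I2)
      fix t assume "t \<in> space unit_interval"
      from tendsto_power[OF tendsto_diff[OF lim[OF this] tendsto_const], of "u t" 2]
      show "(\<lambda>i. (U i t - u t)\<^sup>2) \<longlonglongrightarrow> 0" by simp
    qed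
    show "AE t in unit_interval. norm ((U i t - u t)\<^sup>2) \<le> 4 * (g t)\<^sup>2" for i
    proof (rule AE_I2)
      fix t assume t: "t \<in> space unit_interval"
      have "\<bar>U i t - u t\<bar> \<le> \<bar>2 * g t\<bar>" using le[OF t, of i] leu[OF t] by linarith
      then have "(U i t - u t)\<^sup>2 \<le> (2 * g t)\<^sup>2" by (simp add: abs_le_square_iff)
      then show "norm ((U i t - u t)\<^sup>2) \<le> 4 * (g t)\<^sup>2" by (simp add: power_mult_distrib)
    qed
  qed (use U u in measurable)
  then have "(\<lambda>i. norm (abs_L2 (U i) - abs_L2 u)) \<longlonglongrightarrow> sqrt (\<integral>t. 0 \<partial>unit_interval)"
    unfolding n by (rule tendsto_real_sqrt)
  then show ?thesis by (simp add: LIM_zero_iff tendsto_norm_zero_iff)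
qed

definition rational_step :: "nat \<Rightarrow> L2" where
  "rational_step n = abs_L2 (indicator {..real_of_rat (from_nat n)})"

lemma subspace_closure_span: "subspace (closure (span (A :: 'a::real_normed_vector set)))"
proof (rule subspaceI)
  show "0 \<in> closure (span A)" by (rule subsetD[OF closure_subset span_zero])
next
  fix x y assume "x \<in> closure (span A)" "y \<in> closure (span A)"
  then obtain u v where "\<And>n::nat. u n \<in> span A" "u \<longlonglongrightarrow> x" "\<And>n::nat. v n \<in> span A" "v \<longlonglongrightarrow> y"
    unfolding closure_sequential by blast
  then show "x + y \<in> closure (span A)"
    unfolding closure_sequential
    by (intro exI[of _ "\<lambda>n. u n + v n"] conjI allI span_add tendsto_add)
next
  fix c x assume "x \<in> closure (span A)"
  then obtain u where "\<And>n::nat. u n \<in> span A" "u \<longlonglongrightarrow> x"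
    unfolding closure_sequential by blast
  then show "c *\<^sub>R x \<in> closure (span A)"
    unfolding closure_sequential
    by (intro exI[of _ "\<lambda>n. c *\<^sub>R u n"] conjI allI span_scale tendsto_scaleR tendsto_const)
qed

lemma indicator_measurable: "A \<in> sets borel \<Longrightarrow> (indicator A :: real \<Rightarrow> real) \<in> borel_measurable unit_interval"
  by (rule measurable_restrict_space1) simp

lemma square_integrable_indicator: "A \<in> sets borel \<Longrightarrow> square_integrable (indicator A)"
  by (rule square_integrable_bounded[of _ 1]) (auto intro: indicator_measurable simp: indicator_def)

text \<open>
  The closed span contains the indicators of all half-lines by monotone approximation of their end
  points, of all Borel sets because the sets with this property form a Dynkin system, and of
  all nonnegative square integrable functions because these are limits of increasing sequences of
  simple functions.
\<close>

lemma rational_step_dense: "closure (span (range rational_step)) = UNIV"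
proof -
  define V where "V = closure (span (range rational_step))"
  have sub: "subspace V" unfolding V_def by (rule subspace_closure_span)
  have cl: "closed V" by (simp add: V_def)
  note lim_in = closed_sequentially[OF cl]
  have atMost: "abs_L2 (indicator {..a}) \<in> V" for a :: real
  proof -
    have "\<exists>q. a < real_of_rat q \<and> real_of_rat q < a + 1 / (real i + 1)" for i :: nat
      using Rats_dense_in_real[of a "a + 1 / (real i + 1)"] by (auto elim!: Rats_cases)
    then obtain q where q: "\<And>i::nat. a < real_of_rat (q i) \<and> real_of_rat (q i) < a + 1 / (real i + 1)"
      by metis
    have "(\<lambda>i. abs_L2 (indicator {..real_of_rat (q i)})) \<longlonglongrightarrow> abs_L2 (indicator {..a})"
    proof (rule L2_dominated_convergence[where g = "\<lambda>_. 1"])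
      show "square_integrable (\<lambda>_. 1)" by (rule square_integrable_bounded[of _ 1]) auto
      fix t :: real
      show "(\<lambda>i. indicator {..real_of_rat (q i)} t :: real) \<longlonglongrightarrow> indicator {..a} t"
      proof (cases "t \<le> a")
        case True
        then have "t \<le> real_of_rat (q i)" for i using q[of i] by simp
        then show ?thesis using True by simp
      next
        case False
        obtain n :: nat where n: "1 / (real n + 1) < t - a"
          using False reals_Archimedean[of "t - a"] by (auto simp: inverse_eq_divide add.commute)
        have "\<forall>\<^sub>F i in sequentially. indicator {..real_of_rat (q i)} t = (0::real)"
        proof (rule eventually_sequentiallyI)
          fix i assume "n \<le> i"
          then have "1 / (real i + 1) \<le> 1 / (real n + 1)" by (intro divide_left_mono) auto
          then show "indicator {..real_of_rat (q i)} t = (0::real)" using n q[of i] by auto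
        qed
        then show ?thesis using False by (simp add: tendsto_eventually)
      qed
    qed (auto intro: indicator_measurable simp: indicator_def)
    moreover have "abs_L2 (indicator {..real_of_rat (q i)}) \<in> V" for i
    proof -
      have "abs_L2 (indicator {..real_of_rat (q i)}) = rational_step (to_nat (q i))"
        by (simp add: rational_step_def)
      then show ?thesis
        unfolding V_def by (simp only: subsetD[OF closure_subset span_base[OF rangeI]])
    qed
    ultimately show ?thesis by (rule lim_in[rotated])
  qed
  have borel_set: "abs_L2 (indicator A) \<in> V" if "A \<in> sets borel" for A :: "real set"
  proof -
    have "Int_stable (range (\<lambda>a::real. {..a}))"
      by (auto simp: Int_stable_def Int_atMost)
    moreover have "range (\<lambda>a::real. {..a}) \<subseteq> Pow UNIV" by simp
    moreover have "A \<in> sigma_sets UNIV (range (\<lambda>a::real. {..a}))"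
      using that by (simp add: borel_eq_atMost)
    ultimately show ?thesis
    proof (induction rule: sigma_sets_induct_disjoint)
      case (basic A)
      then show ?case by (auto intro: atMost)
    next
      case empty
      show ?case using subspace_0[OF sub] by (simp add: abs_L2_zero)
    next
      fix A assume "A \<in> sigma_sets UNIV (range (\<lambda>a::real. {..a}))" and IH: "abs_L2 (indicator A) \<in> V"
      then have A: "A \<in> sets borel" by (simp add: borel_eq_atMost)
      have "(\<lambda>i. abs_L2 (indicator {..real i})) \<longlonglongrightarrow> abs_L2 (\<lambda>_. 1)"
      proof (rule L2_dominated_convergence[where g = "\<lambda>_. 1"])
        show "square_integrable (\<lambda>_. 1)" by (rule square_integrable_bounded[of _ 1]) auto
        fix t :: real assume "t \<in> space unit_interval"
        then have "\<forall>\<^sub>F i in sequentially. indicator {..real i} t = (1::real)"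
          by (intro eventually_sequentiallyI[of 1]) (auto simp: space_restrict_space)
        then show "(\<lambda>i. indicator {..real i} t :: real) \<longlonglongrightarrow> 1" by (rule tendsto_eventually)
      qed (auto intro: indicator_measurable simp: indicator_def)
      then have one: "abs_L2 (\<lambda>_. 1) \<in> V"
        by (rule lim_in[rotated]) (rule atMost)
      have "abs_L2 (indicator (UNIV - A)) = abs_L2 (\<lambda>_. 1) - abs_L2 (indicator A)"
        using square_integrable_indicator[OF A] square_integrable_bounded[of "\<lambda>_. 1" 1]
        by (simp add: abs_L2_diff) (auto intro!: arg_cong[where f=abs_L2] simp: indicator_def)
      then show "abs_L2 (indicator (UNIV - A)) \<in> V" using subspace_diff[OF sub one IH] by simp
    next
      fix A :: "nat \<Rightarrow> real set"
      assume disj: "disjoint_family A" and rng: "range A \<subseteq> sigma_sets UNIV (range (\<lambda>a::real. {..a}))"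
        and IH: "\<And>i. abs_L2 (indicator (A i)) \<in> V"
      then have A: "A i \<in> sets borel" for i by (auto simp: borel_eq_atMost)
      have part: "(\<Sum>i<n. indicator (A i) t) = (indicator (\<Union>i<n. A i) t :: real)" for n t
        using disj by (intro indicator_UN_disjoint[symmetric]) (auto simp: disjoint_family_on_def)
      have "(\<lambda>n. abs_L2 (\<lambda>t. \<Sum>i<n. indicator (A i) t)) \<longlonglongrightarrow> abs_L2 (indicator (\<Union>i. A i))"
      proof (rule L2_dominated_convergence[where g = "\<lambda>_. 1"])
        show "square_integrable (\<lambda>_. 1)" by (rule square_integrable_bounded[of _ 1]) auto
        show "(\<lambda>t. \<Sum>i<n. indicator (A i) t :: real) \<in> borel_measurable unit_interval" for n
          by (intro borel_measurable_sum indicator_measurable A)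
        show "\<bar>\<Sum>i<n. indicator (A i) t :: real\<bar> \<le> 1" for n t unfolding part by (simp add: indicator_def)
        show "(\<lambda>n. \<Sum>i<n. indicator (A i) t :: real) \<longlonglongrightarrow> indicator (\<Union>i. A i) t" for t
          unfolding part by (rule LIMSEQ_indicator_UN)
      qed (use A in \<open>auto intro!: indicator_measurable\<close>)
      moreover have "abs_L2 (\<lambda>t. \<Sum>i<n. indicator (A i) t) \<in> V" for n
        using subspace_sum[OF sub, of "{..<n}" "\<lambda>i. abs_L2 (indicator (A i))"] IH
        by (simp add: abs_L2_sum square_integrable_indicator A)
      ultimately show "abs_L2 (indicator (\<Union>i. A i)) \<in> V"
        by (rule lim_in[rotated])
    qed
  qed
  have nonneg: "square_integrable u \<longrightarrow> abs_L2 u \<in> V"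
    if "u \<in> borel_measurable unit_interval" "\<And>t. 0 \<le> u t" for u
    using that
  proof (induction rule: borel_measurable_induct_real)
    case (set A)
    then have "A \<in> sets borel" by (auto simp: sets_restrict_space)
    then show ?case using borel_set by simp
  next
    case (mult u c)
    show ?case
    proof
      assume c: "square_integrable (\<lambda>t. c * u t)"
      show "abs_L2 (\<lambda>t. c * u t) \<in> V"
      proof (cases "c = 0")
        case True then show ?thesis using subspace_0[OF sub] by (simp add: abs_L2_zero)
      next
        case False
        then have "square_integrable u" using square_integrable_scale[OF c, of "1 / c"] by simp
        then show ?thesis using mult subspace_scale[OF sub, of "abs_L2 u" c] by (simp add: abs_L2_scale)
      qed
    qed
  next
    case (add u v)
    show ?case
    proof
      assume s: "square_integrable (\<lambda>t. v t + u t)"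
      have "square_integrable u" "square_integrable v"
        using add by (auto intro!: square_integrable_dominated[OF _ s])
      then show "abs_L2 (\<lambda>t. v t + u t) \<in> V"
        using add subspace_add[OF sub, of "abs_L2 v" "abs_L2 u"] by (simp add: abs_L2_add)
    qed
  next
    case (seq U)
    show ?case
    proof
      assume s: "square_integrable u"
      have le: "U i t \<le> u t" if "t \<in> space unit_interval" for i t
        using incseq_le[of "\<lambda>i. U i t"] seq that by (auto simp: incseq_def le_fun_def)
      have "square_integrable (U i)" for i
      proof (rule square_integrable_dominated[OF _ s])
        show "U i \<in> borel_measurable unit_interval" using seq by blast
        fix t assume "t \<in> space unit_interval"
        moreover have "0 \<le> U i t" using seq by blast
        ultimately show "\<bar>U i t\<bar> \<le> \<bar>u t\<bar>" using le[of t i] by linarith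
      qed
      then have "abs_L2 (U i) \<in> V" for i using seq by blast
      moreover have "(\<lambda>i. abs_L2 (U i)) \<longlonglongrightarrow> abs_L2 u"
        using seq le by (intro L2_dominated_convergence[OF _ square_integrableD(1)[OF s] s]) auto
      ultimately show "abs_L2 u \<in> V" by (rule lim_in)
    qed
  qed
  have "h \<in> V" for h
  proof -
    let ?f = "rep_L2 h"
    note f = square_integrableD(1)[OF square_integrable_rep[of h]]
    have m: "(\<lambda>t. max (?f t) 0) \<in> borel_measurable unit_interval"
      "(\<lambda>t. max (- ?f t) 0) \<in> borel_measurable unit_interval"
      using f by (auto intro!: borel_measurable_max)
    have s: "square_integrable (\<lambda>t. max (?f t) 0)" "square_integrable (\<lambda>t. max (- ?f t) 0)"
      by (rule square_integrable_dominated[OF m(1) square_integrable_rep[of h]], simp)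
         (rule square_integrable_dominated[OF m(2) square_integrable_rep[of h]], simp)
    have "abs_L2 (\<lambda>t. max (?f t) 0) - abs_L2 (\<lambda>t. max (- ?f t) 0) \<in> V"
      using nonneg[OF m(1)] nonneg[OF m(2)] s by (intro subspace_diff[OF sub]) auto
    also have "abs_L2 (\<lambda>t. max (?f t) 0) - abs_L2 (\<lambda>t. max (- ?f t) 0) = abs_L2 ?f"
      unfolding abs_L2_diff[OF s] by (intro arg_cong[where f=abs_L2] ext) auto
    finally show ?thesis by (simp add: abs_rep_L2)
  qed
  then show ?thesis by (auto simp: V_def)
qed

lemma some_basis_L2: "orthonormal_basis (some_basis :: L2 set)"
  unfolding some_basis_def by (rule someI_ex) (rule orthonormal_basis_exists[OF rational_step_dense])

lemma countable_some_basis: "countable (some_basis :: L2 set)"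
  by (rule orthonormal_basis_countable[OF some_basis_L2 rational_step_dense])

section \<open>Hilbert--Schmidt norms from matrix entries\<close>

text \<open>
  Countability of the basis is used here: along this sequence of finite blocks limits preserve measurability
  and monotone convergence applies.
\<close>

definition basis_upto :: "nat \<Rightarrow> L2 set" where
  "basis_upto n = {e \<in> some_basis. to_nat_on some_basis e < n}"

lemma basis_upto: "finite (basis_upto n)" "basis_upto n \<subseteq> some_basis" "n \<le> m \<Longrightarrow> basis_upto n \<subseteq> basis_upto m"
proof -
  have "inj_on (to_nat_on (some_basis :: L2 set)) (basis_upto n)"
    using inj_on_to_nat_on[OF countable_some_basis] by (rule inj_on_subset) (auto simp: basis_upto_def)
  moreover have "to_nat_on some_basis ` basis_upto n \<subseteq> {..<n}" by (auto simp: basis_upto_def)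
  ultimately show "finite (basis_upto n)" by (meson finite_lessThan inj_on_finite)
qed (auto simp: basis_upto_def)

lemma basis_upto_exhausts:
  assumes "finite F" "F \<subseteq> (some_basis :: L2 set)"
  obtains n where "F \<subseteq> basis_upto n"
proof -
  obtain n where "\<forall>e\<in>F. to_nat_on some_basis e < n"
    using finite_imageI[OF assms(1), of "to_nat_on some_basis"]
    unfolding finite_nat_set_iff_bounded by auto
  then have "F \<subseteq> basis_upto n" using assms(2) by (auto simp: basis_upto_def)
  then show ?thesis by (rule that)
qed

interpretation basis: orthonormal_family "some_basis :: L2 set"
  by (rule orthonormal_basis_family[OF some_basis_L2])

lemma Parseval_sequence: "(\<lambda>n. \<Sum>e\<in>basis_upto n. (inner x e)\<^sup>2) \<longlonglongrightarrow> (norm (x :: L2))\<^sup>2"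
proof (rule LIMSEQ_I)
  fix \<epsilon> :: real assume \<epsilon>: "0 < \<epsilon>"
  obtain F where F: "finite F" "F \<subseteq> some_basis"
    "\<And>F'. finite F' \<Longrightarrow> F \<subseteq> F' \<Longrightarrow> F' \<subseteq> some_basis \<Longrightarrow> (norm x)\<^sup>2 - \<epsilon> / 2 \<le> (\<Sum>e\<in>F'. (inner x e)\<^sup>2)"
    using Parseval_approximation[OF some_basis_L2, of "\<epsilon> / 2" x] \<epsilon> by auto
  obtain k where k: "F \<subseteq> basis_upto k" using basis_upto_exhausts[OF F(1,2)] .
  show "\<exists>k. \<forall>n\<ge>k. norm ((\<Sum>e\<in>basis_upto n. (inner x e)\<^sup>2) - (norm x)\<^sup>2) < \<epsilon>"
  proof (intro exI allI impI)
    fix n assume "k \<le> n"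
    then have "F \<subseteq> basis_upto n" using k basis_upto(3) by blast
    then have "(norm x)\<^sup>2 - \<epsilon> / 2 \<le> (\<Sum>e\<in>basis_upto n. (inner x e)\<^sup>2)"
      by (intro F(3) basis_upto)
    moreover have "(\<Sum>e\<in>basis_upto n. (inner x e)\<^sup>2) \<le> (norm x)\<^sup>2"
      by (intro basis.Bessel basis_upto)
    ultimately show "norm ((\<Sum>e\<in>basis_upto n. (inner x e)\<^sup>2) - (norm x)\<^sup>2) < \<epsilon>" using \<epsilon> by simp
  qed
qed

text \<open>
  By Parseval's identity the norm is a limit of functions of countably many coordinates, so weak
  measurability is enough.
\<close>

lemma borel_measurable_norm_L2:
  fixes z :: "'w \<Rightarrow> L2"
  assumes "\<And>e. (\<lambda>\<omega>. inner (z \<omega>) e) \<in> borel_measurable M"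
  shows "(\<lambda>\<omega>. norm (z \<omega>)) \<in> borel_measurable M"
proof -
  have "(\<lambda>\<omega>. (norm (z \<omega>))\<^sup>2) \<in> borel_measurable M"
    by (rule borel_measurable_LIMSEQ_real[OF Parseval_sequence])
       (intro borel_measurable_sum borel_measurable_power assms)
  then have "(\<lambda>\<omega>. sqrt ((norm (z \<omega>))\<^sup>2)) \<in> borel_measurable M" by measurable
  then show ?thesis by simp
qed

definition entries :: "L2 set \<Rightarrow> (L2 \<Rightarrow> L2) \<Rightarrow> real" where
  "entries F T = hs_inner F (\<lambda>e e'. inner (T e) e') (\<lambda>e e'. inner (T e) e')"

lemma entries_alt: "entries F T = (\<Sum>e\<in>F. \<Sum>e'\<in>F. (inner (T e) e')\<^sup>2)"
  by (simp add: entries_def hs_inner_self)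

lemma entries_mono: "incseq (\<lambda>n. entries (basis_upto n) T)"
proof (rule incseq_SucI)
  fix n
  have sub: "basis_upto n \<subseteq> basis_upto (Suc n)" by (rule basis_upto(3)) simp
  have "entries (basis_upto n) T \<le> (\<Sum>e\<in>basis_upto n. \<Sum>e'\<in>basis_upto (Suc n). (inner (T e) e')\<^sup>2)"
    unfolding entries_alt by (intro sum_mono sum_mono2 basis_upto sub) auto
  also have "\<dots> \<le> entries (basis_upto (Suc n)) T"
    unfolding entries_alt by (intro sum_mono2 basis_upto sub sum_nonneg) auto
  finally show "entries (basis_upto n) T \<le> entries (basis_upto (Suc n)) T" .
qed

text \<open>
  In the sum of squared entries over \<open>F \<times> basis_upto n\<close> the second index can be sent to infinity by
  Parseval's identity, while the sum is dominated by a square block as soon as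
  \<open>F \<subseteq> basis_upto n\<close>.
\<close>

lemma sum_norm_le_of_entries:
  assumes C: "\<And>n. entries (basis_upto n) T \<le> C" and F: "finite F" "F \<subseteq> some_basis"
  shows "(\<Sum>e\<in>F. (norm (T e))\<^sup>2) \<le> C"
proof (rule LIMSEQ_le_const2)
  show "(\<lambda>n. \<Sum>e\<in>F. \<Sum>e'\<in>basis_upto n. (inner (T e) e')\<^sup>2) \<longlonglongrightarrow> (\<Sum>e\<in>F. (norm (T e))\<^sup>2)"
    by (intro tendsto_sum Parseval_sequence)
  obtain k where k: "F \<subseteq> basis_upto k" using basis_upto_exhausts[OF F] .
  show "\<exists>k. \<forall>n\<ge>k. (\<Sum>e\<in>F. \<Sum>e'\<in>basis_upto n. (inner (T e) e')\<^sup>2) \<le> C"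
  proof (intro exI allI impI)
    fix n assume "k \<le> n"
    then have "F \<subseteq> basis_upto n" using k basis_upto(3) by blast
    then have "(\<Sum>e\<in>F. \<Sum>e'\<in>basis_upto n. (inner (T e) e')\<^sup>2) \<le> entries (basis_upto n) T"
      unfolding entries_alt by (intro sum_mono2 basis_upto sum_nonneg) auto
    then show "(\<Sum>e\<in>F. \<Sum>e'\<in>basis_upto n. (inner (T e) e')\<^sup>2) \<le> C" using C[of n] by linarith
  qed
qed

lemma Hilbert_Schmidt_entries:
  assumes T: "bounded_linear T" and C: "\<And>n. entries (basis_upto n) T \<le> C"
  shows "Hilbert_Schmidt T" and "(\<lambda>n. entries (basis_upto n) T) \<longlonglongrightarrow> (HS_norm T)\<^sup>2"
proof -
  have s: "(\<lambda>e. (norm (T e))\<^sup>2) summable_on (some_basis :: L2 set)"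
    by (rule nonneg_bdd_above_summable_on)
       (auto intro!: bdd_aboveI2[where M = C] sum_norm_le_of_entries C)
  then show "Hilbert_Schmidt T" using T by (simp add: Hilbert_Schmidt_def)
  have HS: "(HS_norm T)\<^sup>2 = (\<Sum>\<^sub>\<infinity>e\<in>(some_basis :: L2 set). (norm (T e))\<^sup>2)"
    by (simp add: HS_norm_def infsum_nonneg)
  have le: "entries (basis_upto n) T \<le> (HS_norm T)\<^sup>2" for n
  proof -
    have "entries (basis_upto n) T \<le> (\<Sum>e\<in>basis_upto n. (norm (T e))\<^sup>2)"
      unfolding entries_alt by (intro sum_mono basis.Bessel basis_upto)
    also have "\<dots> \<le> (HS_norm T)\<^sup>2"
      unfolding HS by (rule finite_sum_le_infsum[OF s]) (auto simp: basis_upto)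
    finally show ?thesis .
  qed
  obtain L where L: "(\<lambda>n. entries (basis_upto n) T) \<longlonglongrightarrow> L" "\<And>n. entries (basis_upto n) T \<le> L"
    using incseq_convergent[OF entries_mono[of T]] le by metis
  have "(HS_norm T)\<^sup>2 \<le> L"
    unfolding HS by (rule infsum_le_finite_sums[OF s]) (rule sum_norm_le_of_entries[OF L(2)])
  moreover have "L \<le> (HS_norm T)\<^sup>2" by (rule LIMSEQ_le_const2[OF L(1)]) (use le in auto)
  ultimately show "(\<lambda>n. entries (basis_upto n) T) \<longlonglongrightarrow> (HS_norm T)\<^sup>2" using L(1) by simp
qed

text \<open>
  The sums over square blocks increase to the squared Hilbert--Schmidt norm, so monotone convergence
  transfers a bound that is uniform in the block. The pathwise bound \<open>C\<close> serves to make every \<open>T \<omega>\<close>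
  a Hilbert--Schmidt operator.
\<close>

lemma HS_norm_integral:
  assumes T: "\<And>\<omega>. \<omega> \<in> space M \<Longrightarrow> bounded_linear (T \<omega>)"
    and C: "\<And>\<omega> n. \<omega> \<in> space M \<Longrightarrow> entries (basis_upto n) (T \<omega>) \<le> C \<omega>"
    and i: "\<And>n. integrable M (\<lambda>\<omega>. entries (basis_upto n) (T \<omega>))"
    and K: "\<And>n. (\<integral>\<omega>. entries (basis_upto n) (T \<omega>) \<partial>M) \<le> K"
  shows "integrable M (\<lambda>\<omega>. (HS_norm (T \<omega>))\<^sup>2)" and "(\<integral>\<omega>. (HS_norm (T \<omega>))\<^sup>2 \<partial>M) \<le> K"
proof -
  let ?a = "\<lambda>n \<omega>. entries (basis_upto n) (T \<omega>)"
  have lim: "(\<lambda>n. ?a n \<omega>) \<longlonglongrightarrow> (HS_norm (T \<omega>))\<^sup>2" if "\<omega> \<in> space M" for \<omega>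
    by (rule Hilbert_Schmidt_entries(2)[OF T C, OF that that])
  have m: "(\<lambda>\<omega>. (HS_norm (T \<omega>))\<^sup>2) \<in> borel_measurable M"
    by (rule borel_measurable_LIMSEQ_real[OF lim borel_measurable_integrable[OF i]])
  have "incseq (\<lambda>n. \<integral>\<omega>. ?a n \<omega> \<partial>M)"
    using entries_mono by (intro incseq_SucI integral_mono i) (auto simp: incseq_Suc_iff)
  then obtain L where L: "(\<lambda>n. \<integral>\<omega>. ?a n \<omega> \<partial>M) \<longlonglongrightarrow> L"
    using incseq_convergent[of "\<lambda>n. \<integral>\<omega>. ?a n \<omega> \<partial>M" K] K by metis
  have "has_bochner_integral M (\<lambda>\<omega>. (HS_norm (T \<omega>))\<^sup>2) L"
    using has_bochner_integral_monotone_convergence[OF i _ _ L m] lim entries_mono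
    by (auto simp: mono_def incseq_def)
  then show "integrable M (\<lambda>\<omega>. (HS_norm (T \<omega>))\<^sup>2)" "(\<integral>\<omega>. (HS_norm (T \<omega>))\<^sup>2 \<partial>M) \<le> K"
    using LIMSEQ_le_const2[OF L, of K] K by (auto simp: has_bochner_integral_iff)
qed

section \<open>Integral operators and the covariance operator\<close>

lemma inner_abs_rep: "square_integrable f \<Longrightarrow> inner (abs_L2 f) h = (\<integral>t. f t * rep_L2 h t \<partial>unit_interval)"
  using inner_abs_L2[OF _ square_integrable_rep[of h], of f] by (simp add: abs_rep_L2)

lemma integral_operator_finite_rank:
  fixes y :: "nat \<Rightarrow> real \<Rightarrow> real"
  assumes y: "\<And>n. square_integrable (y n)"
  shows "integral_operator (\<lambda>t s. (\<Sum>n=1..N. y n t * y n s) / real N) h =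
    (1 / real N) *\<^sub>R (\<Sum>n=1..N. inner (abs_L2 (y n)) h *\<^sub>R abs_L2 (y n))"
proof -
  have i: "integrable unit_interval (\<lambda>s. y n s * rep_L2 h s)" for n
    by (rule square_integrable_mult[OF y square_integrable_rep])
  have "(\<integral>s. (\<Sum>n=1..N. y n t * y n s) / real N * rep_L2 h s \<partial>unit_interval) =
      1 / real N * (\<Sum>n=1..N. inner (abs_L2 (y n)) h * y n t)" for t
  proof -
    have "(\<integral>s. (\<Sum>n=1..N. y n t * y n s) / real N * rep_L2 h s \<partial>unit_interval) =
        (\<integral>s. (1 / real N) * (\<Sum>n=1..N. y n t * (y n s * rep_L2 h s)) \<partial>unit_interval)"
      by (intro Bochner_Integration.integral_cong refl)
         (simp add: sum_distrib_right sum_distrib_left sum_divide_distrib mult_ac)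
    also have "\<dots> = 1 / real N * (\<Sum>n=1..N. y n t * (\<integral>s. y n s * rep_L2 h s \<partial>unit_interval))"
      by (simp only: integral_mult_right_zero Bochner_Integration.integral_sum
          Bochner_Integration.integrable_mult_right i)
    finally show ?thesis by (simp add: inner_abs_rep[OF y] mult.commute)
  qed
  then have "integral_operator (\<lambda>t s. (\<Sum>n=1..N. y n t * y n s) / real N) h =
      abs_L2 (\<lambda>t. 1 / real N * (\<Sum>n=1..N. inner (abs_L2 (y n)) h * y n t))"
    by (simp only: integral_operator_def)
  also have "\<dots> = (1 / real N) *\<^sub>R (\<Sum>n=1..N. inner (abs_L2 (y n)) h *\<^sub>R abs_L2 (y n))"
    by (simp add: abs_L2_scale abs_L2_sum y square_integrable_sum square_integrable_scale)
  finally show ?thesis .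
qed

lemma integral_abs_rep_le: "(\<integral>t. \<bar>rep_L2 h t\<bar> \<partial>unit_interval) \<le> norm h"
proof -
  have s: "second_moment unit_interval (rep_L2 h)"
    using square_integrable_rep[of h] by (simp add: square_integrable_def second_moment_def)
  have n: "(\<integral>t. (rep_L2 h t)\<^sup>2 \<partial>unit_interval) = (norm h)\<^sup>2"
    using norm_abs_L2[OF square_integrable_rep[of h]] by (simp add: abs_rep_L2)
  have "(\<integral>t. \<bar>rep_L2 h t * 1\<bar> \<partial>unit_interval) \<le> norm h * 1"
    by (rule Cauchy_Schwarz_integral[OF s _ _ unit_interval.second_moment_const])
       (simp_all add: n unit_interval.prob_space)
  then show ?thesis by simp
qed

text \<open>
  A random element \<open>Y\<close> of the Hilbert space with a jointly measurable version \<open>y\<close> whose pointwise second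
  moments are bounded. The bound justifies the interchanges of integrals and makes the
  covariance kernel bounded.
\<close>

locale second_order_process = prob_space M for M :: "'w measure" +
  fixes y :: "real \<Rightarrow> 'w \<Rightarrow> real" and Y :: "'w \<Rightarrow> L2" and \<kappa> :: real
  assumes joint: "(\<lambda>(t, \<omega>). y t \<omega>) \<in> borel_measurable (unit_interval \<Otimes>\<^sub>M M)"
    and path: "\<And>\<omega>. \<omega> \<in> space M \<Longrightarrow> square_integrable (\<lambda>t. y t \<omega>)"
    and path_class: "\<And>\<omega>. \<omega> \<in> space M \<Longrightarrow> Y \<omega> = abs_L2 (\<lambda>t. y t \<omega>)"
    and \<kappa>: "0 \<le> \<kappa>" "\<And>t. t \<in> {0..1} \<Longrightarrow> second_moment M (y t)"
      "\<And>t. t \<in> {0..1} \<Longrightarrow> (\<integral>\<omega>. (y t \<omega>)\<^sup>2 \<partial>M) \<le> \<kappa>\<^sup>2"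
    and inner_moment: "\<And>h. second_moment M (\<lambda>\<omega>. inner (Y \<omega>) h)"
begin

sublocale IM: pair_prob_space unit_interval M ..

text \<open>
  \<open>E \<bar>z t * V\<bar>\<close> is bounded in \<open>t\<close> by the Cauchy--Schwarz inequality, and \<open>rep_L2 h\<close> is integrable on the unit
  interval; hence the integrand is integrable on the product space.
\<close>

lemma Fubini_weighted:
  assumes z: "(\<lambda>(t, \<omega>). z t \<omega>) \<in> borel_measurable (unit_interval \<Otimes>\<^sub>M M)"
    and zt: "\<And>t. t \<in> {0..1} \<Longrightarrow> second_moment M (z t)"
    and z2: "\<And>t. t \<in> {0..1} \<Longrightarrow> (\<integral>\<omega>. (z t \<omega>)\<^sup>2 \<partial>M) \<le> \<kappa>\<^sup>2"
    and V: "second_moment M V"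
  shows "integrable unit_interval (\<lambda>t. (\<integral>\<omega>. z t \<omega> * V \<omega> \<partial>M) * rep_L2 h t)"
    and "(\<integral>t. (\<integral>\<omega>. z t \<omega> * V \<omega> \<partial>M) * rep_L2 h t \<partial>unit_interval) =
      (\<integral>\<omega>. (\<integral>t. z t \<omega> * rep_L2 h t \<partial>unit_interval) * V \<omega> \<partial>M)"
proof -
  let ?f = "\<lambda>(t, \<omega>). z t \<omega> * V \<omega> * rep_L2 h t"
  define \<beta> where "\<beta> = sqrt (\<integral>\<omega>. (V \<omega>)\<^sup>2 \<partial>M)"
  have \<beta>: "0 \<le> \<beta>" "(\<integral>\<omega>. (V \<omega>)\<^sup>2 \<partial>M) \<le> \<beta>\<^sup>2" by (simp_all add: \<beta>_def)
  note [measurable] = z second_momentD[OF V] square_integrableD(1)[OF square_integrable_rep]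
  have m: "?f \<in> borel_measurable (unit_interval \<Otimes>\<^sub>M M)"
  proof -
    have "(\<lambda>p. (case p of (t, \<omega>) \<Rightarrow> z t \<omega>) * V (snd p) * rep_L2 h (fst p)) \<in>
        borel_measurable (unit_interval \<Otimes>\<^sub>M M)"
      by (intro borel_measurable_times z measurable_compose[OF measurable_snd]
          measurable_compose[OF measurable_fst] second_momentD[OF V]
          square_integrableD(1)[OF square_integrable_rep])
    then show ?thesis by (simp add: case_prod_unfold)
  qed
  have bd: "(\<integral>\<omega>. \<bar>z t \<omega> * V \<omega>\<bar> \<partial>M) \<le> \<kappa> * \<beta>" if "t \<in> {0..1}" for t
    by (rule Cauchy_Schwarz_integral[OF zt[OF that] z2[OF that] \<kappa>(1) V \<beta>(2,1)])
  have ir: "integrable unit_interval (\<lambda>t. \<kappa> * \<beta> * \<bar>rep_L2 h t\<bar>)"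
  proof -
    have "second_moment unit_interval (rep_L2 h)"
      using square_integrable_rep[of h] by (simp add: square_integrable_def second_moment_def)
    then have "integrable unit_interval (rep_L2 h)" by (rule unit_interval.integrable_second)
    then show ?thesis by simp
  qed
  have f: "integrable (unit_interval \<Otimes>\<^sub>M M) ?f"
  proof (rule IM.Fubini_integrable[OF m])
    show "integrable unit_interval (\<lambda>t. \<integral>\<omega>. norm (?f (t, \<omega>)) \<partial>M)"
    proof (rule Bochner_Integration.integrable_bound[OF ir])
      have "(\<lambda>p. norm (?f p)) \<in> borel_measurable (unit_interval \<Otimes>\<^sub>M M)" using m by simp
      then show "(\<lambda>t. \<integral>\<omega>. norm (?f (t, \<omega>)) \<partial>M) \<in> borel_measurable unit_interval"
        using borel_measurable_lebesgue_integral[of "\<lambda>t \<omega>. norm (?f (t, \<omega>))" unit_interval]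
        by (simp add: case_prod_unfold)
      show "AE t in unit_interval. norm (\<integral>\<omega>. norm (?f (t, \<omega>)) \<partial>M) \<le> norm (\<kappa> * \<beta> * \<bar>rep_L2 h t\<bar>)"
      proof (rule AE_I2)
        fix t assume "t \<in> space unit_interval"
        then have "t \<in> {0..1}" by (simp add: space_restrict_space)
        from mult_right_mono[OF bd[OF this] abs_ge_zero[of "rep_L2 h t"]]
        show "norm (\<integral>\<omega>. norm (?f (t, \<omega>)) \<partial>M) \<le> norm (\<kappa> * \<beta> * \<bar>rep_L2 h t\<bar>)"
          using \<kappa>(1) \<beta>(1) by (simp add: abs_mult)
      qed
    qed
    show "AE t in unit_interval. integrable M (\<lambda>\<omega>. ?f (t, \<omega>))"
      using integrable_second_mult[OF zt V] by (intro AE_I2) (simp add: space_restrict_space)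
  qed
  show "integrable unit_interval (\<lambda>t. (\<integral>\<omega>. z t \<omega> * V \<omega> \<partial>M) * rep_L2 h t)"
    using IM.integrable_fst'[OF f] by simp
  have "(\<integral>t. (\<integral>\<omega>. z t \<omega> * V \<omega> \<partial>M) * rep_L2 h t \<partial>unit_interval) =
      (\<integral>t. (\<integral>\<omega>. ?f (t, \<omega>) \<partial>M) \<partial>unit_interval)" by simp
  also have "\<dots> = (\<integral>\<omega>. (\<integral>t. z t \<omega> * V \<omega> * rep_L2 h t \<partial>unit_interval) \<partial>M)"
    using IM.Fubini_integral[OF f] by simp
  also have "\<dots> = (\<integral>\<omega>. (\<integral>t. z t \<omega> * rep_L2 h t \<partial>unit_interval) * V \<omega> \<partial>M)"
  proof (rule Bochner_Integration.integral_cong[OF refl])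
    fix \<omega>
    have "(\<lambda>t. z t \<omega> * V \<omega> * rep_L2 h t) = (\<lambda>t. (z t \<omega> * rep_L2 h t) * V \<omega>)"
      by (simp add: mult_ac)
    then show "(\<integral>t. z t \<omega> * V \<omega> * rep_L2 h t \<partial>unit_interval) =
        (\<integral>t. z t \<omega> * rep_L2 h t \<partial>unit_interval) * V \<omega>" by simp
  qed
  finally show "(\<integral>t. (\<integral>\<omega>. z t \<omega> * V \<omega> \<partial>M) * rep_L2 h t \<partial>unit_interval) =
      (\<integral>\<omega>. (\<integral>t. z t \<omega> * rep_L2 h t \<partial>unit_interval) * V \<omega> \<partial>M)" .
qed

definition mean :: "real \<Rightarrow> real" where "mean t = (\<integral>\<omega>. y t \<omega> \<partial>M)"

definition z :: "real \<Rightarrow> 'w \<Rightarrow> real" where "z t \<omega> = y t \<omega> - mean t"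

lemma mean_measurable: "mean \<in> borel_measurable unit_interval"
  unfolding mean_def using borel_measurable_lebesgue_integral[OF joint] .

lemma z_measurable: "(\<lambda>(t, \<omega>). z t \<omega>) \<in> borel_measurable (unit_interval \<Otimes>\<^sub>M M)"
proof -
  have "(\<lambda>p. (case p of (t, \<omega>) \<Rightarrow> y t \<omega>) - mean (fst p)) \<in> borel_measurable (unit_interval \<Otimes>\<^sub>M M)"
    by (intro borel_measurable_diff joint measurable_compose[OF measurable_fst mean_measurable])
  then show ?thesis by (simp add: z_def case_prod_unfold)
qed

lemma z_moment:
  assumes "t \<in> {0..1}"
  shows "second_moment M (z t)" and "(\<integral>\<omega>. (z t \<omega>)\<^sup>2 \<partial>M) \<le> \<kappa>\<^sup>2"
proof -
  note s = \<kappa>(2)[OF assms]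
  show "second_moment M (z t)"
    unfolding z_def by (intro second_moment_diff s second_moment_const)
  have i: "integrable M (y t)" "integrable M (\<lambda>\<omega>. (y t \<omega>)\<^sup>2)"
    using integrable_second[OF s] s by (auto simp: second_moment_def)
  have "(\<integral>\<omega>. (z t \<omega>)\<^sup>2 \<partial>M) = (\<integral>\<omega>. (y t \<omega>)\<^sup>2 - 2 * mean t * y t \<omega> + (mean t)\<^sup>2 \<partial>M)"
    by (simp add: z_def power2_diff algebra_simps)
  also have "\<dots> = (\<integral>\<omega>. (y t \<omega>)\<^sup>2 \<partial>M) - 2 * mean t * mean t + (mean t)\<^sup>2"
    using i by (simp add: mean_def prob_space)
  also have "\<dots> \<le> \<kappa>\<^sup>2"
    using \<kappa>(3)[OF assms] zero_le_square[of "mean t"] unfolding power2_eq_square by linarith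
  finally show "(\<integral>\<omega>. (z t \<omega>)\<^sup>2 \<partial>M) \<le> \<kappa>\<^sup>2" .
qed

lemma inner_path:
  "\<omega> \<in> space M \<Longrightarrow> inner (Y \<omega>) h = (\<integral>t. y t \<omega> * rep_L2 h t \<partial>unit_interval)"
  by (simp add: path_class inner_abs_rep[OF path])

lemma integral_inner:
  "(\<integral>\<omega>. inner (Y \<omega>) h \<partial>M) = (\<integral>t. mean t * rep_L2 h t \<partial>unit_interval)"
  "integrable unit_interval (\<lambda>t. mean t * rep_L2 h t)"
proof -
  note F = Fubini_weighted[OF joint \<kappa>(2,3) second_moment_const[of 1], of h]
  show "integrable unit_interval (\<lambda>t. mean t * rep_L2 h t)" using F(1) by (simp add: mean_def)
  have "(\<integral>\<omega>. inner (Y \<omega>) h \<partial>M) = (\<integral>\<omega>. (\<integral>t. y t \<omega> * rep_L2 h t \<partial>unit_interval) \<partial>M)"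
    by (intro Bochner_Integration.integral_cong refl inner_path)
  then show "(\<integral>\<omega>. inner (Y \<omega>) h \<partial>M) = (\<integral>t. mean t * rep_L2 h t \<partial>unit_interval)"
    using F(2) by (simp add: mean_def)
qed

definition dev :: "L2 \<Rightarrow> 'w \<Rightarrow> real" where
  "dev h \<omega> = inner (Y \<omega>) h - (\<integral>\<omega>. inner (Y \<omega>) h \<partial>M)"

lemma dev_eq: "\<omega> \<in> space M \<Longrightarrow> (\<integral>t. z t \<omega> * rep_L2 h t \<partial>unit_interval) = dev h \<omega>"
  using square_integrable_mult[OF path square_integrable_rep] integral_inner(2)
  by (simp add: z_def dev_def inner_path integral_inner(1) left_diff_distrib)

lemma dev_moment: "second_moment M (dev h)"
  unfolding dev_def by (intro second_moment_diff inner_moment second_moment_const)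

lemma cov_operator_kernel:
  assumes "t \<in> {0..1}"
  shows "(\<integral>s. cov_kernel M y t s * rep_L2 h s \<partial>unit_interval) = (\<integral>\<omega>. z t \<omega> * dev h \<omega> \<partial>M)"
proof -
  have "(\<integral>s. cov_kernel M y t s * rep_L2 h s \<partial>unit_interval) =
      (\<integral>s. (\<integral>\<omega>. z s \<omega> * z t \<omega> \<partial>M) * rep_L2 h s \<partial>unit_interval)"
    by (simp add: cov_kernel_def z_def mean_def mult.commute)
  also have "\<dots> = (\<integral>\<omega>. (\<integral>s. z s \<omega> * rep_L2 h s \<partial>unit_interval) * z t \<omega> \<partial>M)"
    by (rule Fubini_weighted(2)[OF z_measurable z_moment z_moment(1)[OF assms]])
  also have "\<dots> = (\<integral>\<omega>. z t \<omega> * dev h \<omega> \<partial>M)"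
    by (intro Bochner_Integration.integral_cong refl) (subst dev_eq, assumption, rule mult.commute)
  finally show ?thesis .
qed

lemma square_integrable_cov:
  "square_integrable (\<lambda>t. \<integral>\<omega>. z t \<omega> * dev h \<omega> \<partial>M)"
proof (rule square_integrable_bounded)
  have "(\<lambda>p. (case p of (t, \<omega>) \<Rightarrow> z t \<omega>) * dev h (snd p)) \<in> borel_measurable (unit_interval \<Otimes>\<^sub>M M)"
    by (intro borel_measurable_times z_measurable measurable_compose[OF measurable_snd]
        second_momentD[OF dev_moment])
  then have "(\<lambda>(t, \<omega>). z t \<omega> * dev h \<omega>) \<in> borel_measurable (unit_interval \<Otimes>\<^sub>M M)"
    by (simp add: case_prod_unfold)
  then show "(\<lambda>t. \<integral>\<omega>. z t \<omega> * dev h \<omega> \<partial>M) \<in> borel_measurable unit_interval"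
    by (rule borel_measurable_lebesgue_integral)
  fix t :: real assume "t \<in> {0..1}"
  have "\<bar>\<integral>\<omega>. z t \<omega> * dev h \<omega> \<partial>M\<bar> \<le> (\<integral>\<omega>. \<bar>z t \<omega> * dev h \<omega>\<bar> \<partial>M)" by (rule integral_abs_bound)
  also have "\<dots> \<le> \<kappa> * sqrt (\<integral>\<omega>. (dev h \<omega>)\<^sup>2 \<partial>M)"
    by (rule Cauchy_Schwarz_integral[OF z_moment[OF \<open>t \<in> {0..1}\<close>] \<kappa>(1) dev_moment]) auto
  finally show "\<bar>\<integral>\<omega>. z t \<omega> * dev h \<omega> \<partial>M\<bar> \<le> \<kappa> * sqrt (\<integral>\<omega>. (dev h \<omega>)\<^sup>2 \<partial>M)" .
qed

lemma cov_operator_eq: "cov_operator M y h = abs_L2 (\<lambda>t. \<integral>\<omega>. z t \<omega> * dev h \<omega> \<partial>M)"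
proof -
  let ?k = "\<lambda>t. \<integral>s. cov_kernel M y t s * rep_L2 h s \<partial>unit_interval"
  let ?g = "\<lambda>t. \<integral>\<omega>. z t \<omega> * dev h \<omega> \<partial>M"
  have eq: "?k t = ?g t" if "t \<in> space unit_interval" for t
    using that cov_operator_kernel by (simp add: space_restrict_space)
  have "?k \<in> borel_measurable unit_interval"
    using square_integrableD(1)[OF square_integrable_cov[of h]] measurable_cong[of unit_interval ?k ?g] eq
    by blast
  then have "square_integrable ?k"
    by (rule square_integrable_dominated[OF _ square_integrable_cov[of h]]) (simp add: eq)
  then show ?thesis
    unfolding cov_operator_def integral_operator_def
    by (intro abs_L2_eqI square_integrable_cov AE_I2 eq)
qed

text \<open>
  Two applications of Fubini's theorem identify the integral operator of the covariance kernel with the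
  covariance form of the coordinates.
\<close>

lemma inner_cov_operator: "inner (cov_operator M y h) h' = (\<integral>\<omega>. dev h \<omega> * dev h' \<omega> \<partial>M)"
proof -
  have "inner (cov_operator M y h) h' =
      (\<integral>t. (\<integral>\<omega>. z t \<omega> * dev h \<omega> \<partial>M) * rep_L2 h' t \<partial>unit_interval)"
    unfolding cov_operator_eq by (rule inner_abs_rep[OF square_integrable_cov])
  also have "\<dots> = (\<integral>\<omega>. (\<integral>t. z t \<omega> * rep_L2 h' t \<partial>unit_interval) * dev h \<omega> \<partial>M)"
    by (rule Fubini_weighted(2)[OF z_measurable z_moment dev_moment])
  also have "\<dots> = (\<integral>\<omega>. dev h \<omega> * dev h' \<omega> \<partial>M)"
    by (intro Bochner_Integration.integral_cong refl) (subst dev_eq, assumption, rule mult.commute)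
  finally show ?thesis .
qed

lemma dev_add: "dev (h + h') \<omega> = dev h \<omega> + dev h' \<omega>"
  using integrable_second[OF inner_moment]
  by (simp add: dev_def inner_add_right)

lemma dev_scale: "dev (r *\<^sub>R h) \<omega> = r * dev h \<omega>"
  using integrable_second[OF inner_moment]
  by (simp add: dev_def right_diff_distrib)

text \<open>
  Linearity is read off from the covariance form; boundedness comes from the bounded kernel.
\<close>

lemma cov_operator_bounded_linear: "bounded_linear (cov_operator M y)"
proof (rule bounded_linear_intro)
  fix h h' :: L2 and r :: real
  have i: "integrable M (\<lambda>\<omega>. dev a \<omega> * dev b \<omega>)" for a b
    by (rule integrable_second_mult[OF dev_moment dev_moment])
  show "cov_operator M y (h + h') = cov_operator M y h + cov_operator M y h'"
    by (subst vector_eq_rdot[symmetric])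
       (simp add: inner_cov_operator inner_add_left dev_add distrib_right i)
  show "cov_operator M y (r *\<^sub>R h) = r *\<^sub>R cov_operator M y h"
    by (subst vector_eq_rdot[symmetric])
       (simp add: inner_cov_operator dev_scale mult.assoc)
  let ?C = "cov_operator M y h" and ?H = "\<lambda>t. \<integral>s. cov_kernel M y t s * rep_L2 h s \<partial>unit_interval"
  have ck: "\<bar>cov_kernel M y t s\<bar> \<le> \<kappa> * \<kappa>" if "t \<in> {0..1}" "s \<in> {0..1}" for t s
  proof -
    have "\<bar>\<integral>\<omega>. z t \<omega> * z s \<omega> \<partial>M\<bar> \<le> (\<integral>\<omega>. \<bar>z t \<omega> * z s \<omega>\<bar> \<partial>M)" by (rule integral_abs_bound)
    also have "\<dots> \<le> \<kappa> * \<kappa>"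
      by (rule Cauchy_Schwarz_integral[OF z_moment[OF that(1)] \<kappa>(1) z_moment[OF that(2)] \<kappa>(1)])
    finally show ?thesis by (simp add: cov_kernel_def z_def mean_def)
  qed
  have H: "\<bar>?H t\<bar> \<le> \<kappa> * \<kappa> * norm h" if t: "t \<in> {0..1}" for t
  proof -
    have s: "second_moment unit_interval (rep_L2 h)"
      using square_integrable_rep[of h] by (simp add: square_integrable_def second_moment_def)
    have ir: "integrable unit_interval (\<lambda>s. \<kappa> * \<kappa> * \<bar>rep_L2 h s\<bar>)"
      using unit_interval.integrable_second[OF s] by simp
    have "\<bar>?H t\<bar> \<le> (\<integral>s. \<kappa> * \<kappa> * \<bar>rep_L2 h s\<bar> \<partial>unit_interval)"
    proof (rule integral_abs_bound_integral)
      show "integrable unit_interval (\<lambda>s. cov_kernel M y t s * rep_L2 h s)"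
        using Fubini_weighted(1)[OF z_measurable z_moment z_moment(1)[OF t], of h]
        by (simp add: cov_kernel_def z_def mean_def mult.commute)
      fix s assume "s \<in> space unit_interval"
      then show "\<bar>cov_kernel M y t s * rep_L2 h s\<bar> \<le> \<kappa> * \<kappa> * \<bar>rep_L2 h s\<bar>"
        unfolding abs_mult by (intro mult_right_mono ck t) (simp_all add: space_restrict_space)
    qed fact
    also have "\<dots> \<le> \<kappa> * \<kappa> * norm h"
      using integral_abs_rep_le[of h] \<kappa>(1) by (simp add: mult_left_mono)
    finally show ?thesis .
  qed
  have "(norm ?C)\<^sup>2 = (\<integral>t. (\<integral>\<omega>. z t \<omega> * dev h \<omega> \<partial>M)\<^sup>2 \<partial>unit_interval)"
    unfolding cov_operator_eq by (rule norm_abs_L2[OF square_integrable_cov])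
  also have "\<dots> \<le> (\<integral>t. (\<kappa> * \<kappa> * norm h)\<^sup>2 \<partial>unit_interval)"
  proof (rule integral_mono)
    show "integrable unit_interval (\<lambda>t. (\<integral>\<omega>. z t \<omega> * dev h \<omega> \<partial>M)\<^sup>2)"
      by (rule square_integrableD(2)[OF square_integrable_cov])
    fix t assume "t \<in> space unit_interval"
    then have t: "t \<in> {0..1}" by (simp add: space_restrict_space)
    have "\<bar>\<integral>\<omega>. z t \<omega> * dev h \<omega> \<partial>M\<bar> \<le> \<bar>\<kappa> * \<kappa> * norm h\<bar>"
      using H[OF t] cov_operator_kernel[OF t] by simp
    then show "(\<integral>\<omega>. z t \<omega> * dev h \<omega> \<partial>M)\<^sup>2 \<le> (\<kappa> * \<kappa> * norm h)\<^sup>2"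
      by (rule abs_le_square_iff[THEN iffD1])
  qed simp
  also have "\<dots> = (norm h * (\<kappa> * \<kappa>))\<^sup>2" using unit_interval.prob_space by (simp add: mult_ac)
  finally show "norm ?C \<le> norm h * (\<kappa> * \<kappa>)"
    by (rule power2_le_imp_le) (use \<kappa>(1) in simp)
qed

end

section \<open>Coordinates of an approximable sequence\<close>

lemma nu_power4: "nu M 4 Z ^ 4 = (\<integral>\<omega>. norm (Z \<omega>) ^ 4 \<partial>M)"
proof -
  have "(\<integral>\<omega>. norm (Z \<omega>) powr 4 \<partial>M) = (\<integral>\<omega>. norm (Z \<omega>) ^ 4 \<partial>M)"
    by (simp add: powr_numeral)
  moreover have "((I::real) powr (1 / 4)) ^ 4 = I" if "0 \<le> I" for I
    using that by (cases "I = 0") (auto simp: powr_realpow[symmetric] powr_powr)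
  ultimately show ?thesis by (simp add: nu_def)
qed

lemma nu_nonneg: "0 \<le> nu M p Z"
  by (simp add: nu_def)

text \<open>
  The hypotheses of the theorem. All laws are transported to the product spaces over the marginal law
  \<open>D\<close> of the innovations, where the finite-dimensional results apply.
\<close>

locale approximable_process = prob_space M for M :: "'w measure" +
  fixes S :: "'s measure" and X :: "int \<Rightarrow> 'w \<Rightarrow> L2" and x :: "int \<Rightarrow> real \<Rightarrow> 'w \<Rightarrow> real"
    and f :: "(nat \<Rightarrow> 's) \<Rightarrow> L2"
    and \<epsilon> :: "int \<Rightarrow> 'w \<Rightarrow> 's" and \<epsilon>' :: "int \<Rightarrow> int \<Rightarrow> 'w \<Rightarrow> 's"
  assumes approximable: "Lp_m_approximable M 4 X S f \<epsilon> \<epsilon>'"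
    and version: "\<And>n. jointly_measurable_version M (x n) (X n)"
    and bounded_variance: "(SUP t\<in>{0..1}. \<integral>\<^sup>+\<omega>. ennreal (\<bar>x 1 t \<omega>\<bar>\<^sup>2) \<partial>M) < \<infinity>"
begin

lemma X_borel: "X n \<in> borel_measurable M"
  and X_integrable: "integrable M (\<lambda>\<omega>. norm (X n \<omega>) ^ 4)"
proof -
  have "X n \<in> L_H M 4" using approximable by (simp add: Lp_m_approximable_def)
  then show "X n \<in> borel_measurable M" "integrable M (\<lambda>\<omega>. norm (X n \<omega>) ^ 4)"
    by (auto simp: L_H_def powr_numeral)
qed

lemma eps_indep: "indep_vars (\<lambda>_. S) \<epsilon> UNIV" and eps_law: "distr M S (\<epsilon> i) = distr M S (\<epsilon> 0)"
  using approximable by (auto simp: Lp_m_approximable_def iid_def)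

lemma eps_measurable[measurable]: "\<epsilon> i \<in> M \<rightarrow>\<^sub>M S"
  using eps_indep by (simp add: indep_vars_def)

definition D :: "'s measure" where "D = distr M S (\<epsilon> 0)"

sublocale seq: iid_path D
  unfolding iid_path_def D_def by (rule prob_space_distr) (rule eps_measurable)

lemma sets_PiD: "sets (\<Pi>\<^sub>M i\<in>I. D) = sets (\<Pi>\<^sub>M i\<in>I. S)"
  by (intro sets_PiM_cong refl) (simp add: D_def)

abbreviation path :: "'w \<Rightarrow> int \<Rightarrow> 's" where "path \<omega> \<equiv> \<lambda>k. \<epsilon> k \<omega>"
abbreviation copy :: "int \<Rightarrow> 'w \<Rightarrow> int \<Rightarrow> 's" where "copy n \<omega> \<equiv> \<lambda>k. \<epsilon>' n k \<omega>"

lemma path_law_S: "distr M (\<Pi>\<^sub>M k\<in>UNIV. S) path = seq.P"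
proof -
  have "distr M (\<Pi>\<^sub>M i\<in>UNIV. S) (\<lambda>\<omega>. \<lambda>i\<in>UNIV. \<epsilon> i \<omega>) = (\<Pi>\<^sub>M i\<in>UNIV. distr M S (\<epsilon> i))"
    by (rule iffD1[OF indep_vars_iff_distr_eq_PiM eps_indep]) (rule UNIV_not_empty eps_measurable)+
  moreover have "distr M S (\<epsilon> i) = D" for i unfolding D_def by (rule eps_law)
  ultimately show ?thesis by (simp only: restrict_UNIV)
qed

lemma copies: "indep_vars (\<lambda>_. \<Pi>\<^sub>M k\<in>UNIV. S)
       (\<lambda>j \<omega> k. case j of None \<Rightarrow> \<epsilon> k \<omega> | Some n \<Rightarrow> \<epsilon>' n k \<omega>) (UNIV :: int option set)"
  and copy_law_S: "distr M (\<Pi>\<^sub>M k\<in>UNIV. S) (copy n) = seq.P"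
  using approximable path_law_S by (auto simp: Lp_m_approximable_def independent_copies_def)

lemma path_measurable_S: "path \<in> M \<rightarrow>\<^sub>M (\<Pi>\<^sub>M k\<in>UNIV. S)"
  and copy_measurable_S: "copy n \<in> M \<rightarrow>\<^sub>M (\<Pi>\<^sub>M k\<in>UNIV. S)"
proof -
  have m: "(\<lambda>\<omega> k. case j of None \<Rightarrow> \<epsilon> k \<omega> | Some n \<Rightarrow> \<epsilon>' n k \<omega>) \<in> M \<rightarrow>\<^sub>M (\<Pi>\<^sub>M k\<in>UNIV. S)" for j
    using copies by (simp add: indep_vars_def)
  show "path \<in> M \<rightarrow>\<^sub>M (\<Pi>\<^sub>M k\<in>UNIV. S)" using m[of None] by simp
  show "copy n \<in> M \<rightarrow>\<^sub>M (\<Pi>\<^sub>M k\<in>UNIV. S)" using m[of "Some n"] by simp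
qed

lemma path_measurable: "path \<in> M \<rightarrow>\<^sub>M seq.P" and copy_measurable: "copy n \<in> M \<rightarrow>\<^sub>M seq.P"
proof -
  show "path \<in> M \<rightarrow>\<^sub>M seq.P"
    using path_measurable_S unfolding measurable_cong_sets[OF refl sets_PiD] .
  show "copy n \<in> M \<rightarrow>\<^sub>M seq.P"
    using copy_measurable_S unfolding measurable_cong_sets[OF refl sets_PiD] .
qed

lemma path_law: "distr M seq.P path = seq.P" and copy_law: "distr M seq.P (copy n) = seq.P"
proof -
  have "distr M seq.P path = distr M (\<Pi>\<^sub>M k\<in>UNIV. S) path"
    by (intro distr_cong refl sets_PiD)
  then show "distr M seq.P path = seq.P" by (simp only: path_law_S)
  have "distr M seq.P (copy n) = distr M (\<Pi>\<^sub>M k\<in>UNIV. S) (copy n)"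
    by (intro distr_cong refl sets_PiD)
  then show "distr M seq.P (copy n) = seq.P" by (simp only: copy_law_S)
qed

lemma pair_measurable: "(\<lambda>\<omega>. (path \<omega>, copy n \<omega>)) \<in> M \<rightarrow>\<^sub>M seq.PP"
  by (intro measurable_Pair path_measurable copy_measurable)

text \<open>
  The innovations and their copy attached to one time \<open>n\<close> are independent with the same law. For a
  fixed \<open>n\<close> this is the only joint law that enters the coupling distance.
\<close>

lemma pair_law: "distr M seq.PP (\<lambda>\<omega>. (path \<omega>, copy n \<omega>)) = seq.PP"
proof -
  let ?Y = "\<lambda>j \<omega> k. case j of None \<Rightarrow> \<epsilon> k \<omega> | Some n \<Rightarrow> \<epsilon>' n k \<omega>" and ?Q = "\<Pi>\<^sub>M k\<in>(UNIV::int set). S"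
  have "indep_var (\<Pi>\<^sub>M i\<in>{None}. ?Q) (\<lambda>\<omega>. restrict (\<lambda>j. ?Y j \<omega>) {None})
      (\<Pi>\<^sub>M i\<in>{Some n}. ?Q) (\<lambda>\<omega>. restrict (\<lambda>j. ?Y j \<omega>) {Some n})"
    by (rule indep_var_restrict[OF copies]) auto
  from indep_var_compose[OF this measurable_component_singleton[of None] measurable_component_singleton[of "Some n"]]
  have "indep_var ?Q ((\<lambda>y. y None) \<circ> (\<lambda>\<omega>. restrict (\<lambda>j. ?Y j \<omega>) {None}))
      ?Q ((\<lambda>y. y (Some n)) \<circ> (\<lambda>\<omega>. restrict (\<lambda>j. ?Y j \<omega>) {Some n}))" by simp
  then have "indep_var ?Q path ?Q (copy n)" by (simp add: comp_def)
  then have "distr M ?Q path \<Otimes>\<^sub>M distr M ?Q (copy n) = distr M (?Q \<Otimes>\<^sub>M ?Q) (\<lambda>\<omega>. (path \<omega>, copy n \<omega>))"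
    by (simp add: indep_var_distribution_eq)
  also have "\<dots> = distr M seq.PP (\<lambda>\<omega>. (path \<omega>, copy n \<omega>))"
    by (intro distr_cong refl sets_pair_measure_cong sets_PiD[symmetric])
  finally show ?thesis by (simp only: path_law_S copy_law_S)
qed

abbreviation Q :: "(nat \<Rightarrow> 's) measure" where "Q \<equiv> \<Pi>\<^sub>M j\<in>UNIV. D"

lemma f_borel: "f \<in> borel_measurable Q"
proof -
  have "f \<in> borel_measurable (\<Pi>\<^sub>M j\<in>UNIV. S)" using approximable by (simp add: Lp_m_approximable_def)
  then show ?thesis unfolding measurable_cong_sets[OF sets_PiD refl] .
qed

lemma window_measurable_P: "(\<lambda>w j. w (n - int j)) \<in> seq.P \<rightarrow>\<^sub>M Q"
  by (rule seq.measurable_reindex)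

lemma window_law_P: "distr seq.P Q (\<lambda>w j. w (n - int j)) = Q"
  by (rule seq.distr_reindex) (auto simp: inj_on_def)

lemma window_measurable: "(\<lambda>\<omega> j. \<epsilon> (n - int j) \<omega>) \<in> M \<rightarrow>\<^sub>M Q"
  by (rule measurable_compose[OF path_measurable window_measurable_P])

lemma window_law: "distr M Q (\<lambda>\<omega> j. \<epsilon> (n - int j) \<omega>) = Q"
proof -
  have "distr M Q (\<lambda>\<omega> j. \<epsilon> (n - int j) \<omega>) = distr (distr M seq.P path) Q (\<lambda>w j. w (n - int j))"
    by (subst distr_distr[OF window_measurable_P path_measurable]) (simp add: comp_def)
  then show ?thesis by (simp only: path_law window_law_P)
qed

lemma X_eq: "\<omega> \<in> space M \<Longrightarrow> X n \<omega> = f (\<lambda>j. \<epsilon> (n - int j) \<omega>)"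
  using approximable by (simp add: Lp_m_approximable_def)

lemma f_norm_borel: "(\<lambda>v. norm (f v) ^ 4) \<in> borel_measurable Q"
  by (intro borel_measurable_power measurable_compose[OF f_borel] borel_measurable_continuous_onI
      continuous_intros)

lemma f_inner_borel: "(\<lambda>v. inner (f v) e) \<in> borel_measurable Q"
  by (intro measurable_compose[OF f_borel] borel_measurable_continuous_onI continuous_intros)

lemma f_norm4: "integrable Q (\<lambda>v. norm (f v) ^ 4)"
  and f_norm4_integral: "(\<integral>v. norm (f v) ^ 4 \<partial>Q) = nu M 4 (X n) ^ 4"
proof -
  have "integrable M (\<lambda>\<omega>. norm (f (\<lambda>j. \<epsilon> (n - int j) \<omega>)) ^ 4) \<longleftrightarrow> integrable M (\<lambda>\<omega>. norm (X n \<omega>) ^ 4)"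
    by (intro Bochner_Integration.integrable_cong refl) (simp add: X_eq)
  then show "integrable Q (\<lambda>v. norm (f v) ^ 4)"
    using X_integrable integrable_measure_preserving[OF window_measurable window_law f_norm_borel, of n]
    by blast
  have "(\<integral>v. norm (f v) ^ 4 \<partial>Q) = (\<integral>\<omega>. norm (f (\<lambda>j. \<epsilon> (n - int j) \<omega>)) ^ 4 \<partial>M)"
    by (rule integral_measure_preserving[OF window_measurable window_law f_norm_borel, symmetric])
  also have "\<dots> = (\<integral>\<omega>. norm (X n \<omega>) ^ 4 \<partial>M)"
    by (intro Bochner_Integration.integral_cong refl) (simp add: X_eq)
  finally show "(\<integral>v. norm (f v) ^ 4 \<partial>Q) = nu M 4 (X n) ^ 4" by (simp only: nu_power4)
qed

sublocale Q: prob_space Q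
  by (intro prob_space_PiM seq.D.prob_space_axioms)

lemma fourth_f_inner: "fourth_moment Q (\<lambda>v. inner (f v) e)"
  unfolding fourth_moment_def
proof (intro conjI f_inner_borel)
  show "integrable Q (\<lambda>v. (inner (f v) e) ^ 4)"
  proof (rule Bochner_Integration.integrable_bound)
    show "integrable Q (\<lambda>v. norm (f v) ^ 4 * norm e ^ 4)" using f_norm4 by simp
    show "AE v in Q. norm ((inner (f v) e) ^ 4) \<le> norm (norm (f v) ^ 4 * norm e ^ 4)"
    proof (rule AE_I2)
      fix v
      have "\<bar>inner (f v) e\<bar> ^ 4 \<le> (norm (f v) * norm e) ^ 4"
        by (intro power_mono Cauchy_Schwarz_ineq2) simp
      then show "norm ((inner (f v) e) ^ 4) \<le> norm (norm (f v) ^ 4 * norm e ^ 4)"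
        by (simp add: power_mult_distrib power_even_abs)
    qed
  qed (intro borel_measurable_power f_inner_borel)
qed

definition \<mu> :: "L2 \<Rightarrow> real" where "\<mu> e = (\<integral>v. inner (f v) e \<partial>Q)"

definition g :: "L2 \<Rightarrow> (nat \<Rightarrow> 's) \<Rightarrow> real" where "g e v = inner (f v) e - \<mu> e"

definition \<delta> :: "nat \<Rightarrow> real" where
  "\<delta> r = nu M 4 (\<lambda>\<omega>. X (int r) \<omega> - coupled f \<epsilon> \<epsilon>' r (int r) \<omega>)"

definition \<Delta> :: real where "\<Delta> = (\<Sum>r. \<delta> (Suc r))"

lemma delta_sum_le: "(\<Sum>r=1..k. \<delta> r) \<le> \<Delta>"
proof -
  have s: "summable (\<lambda>r. \<delta> (Suc r))"
    using approximable by (simp add: Lp_m_approximable_def \<delta>_def)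
  have "(\<Sum>r=1..k. \<delta> r) = (\<Sum>r<k. \<delta> (Suc r))"
    by (rule sum.reindex_bij_witness[of _ Suc "\<lambda>r. r - 1"]) auto
  also have "\<dots> \<le> \<Delta>"
    unfolding \<Delta>_def by (rule sum_le_suminf[OF s]) (auto simp: \<delta>_def nu_nonneg)
  finally show ?thesis .
qed

lemma fourth_g: "fourth_moment Q (g e)"
  unfolding g_def by (intro fourth_moment_diff fourth_f_inner Q.fourth_moment_const)

lemma mean_g: "(\<integral>v. g e v \<partial>Q) = 0"
  unfolding g_def
  by (subst Bochner_Integration.integral_diff)
     (simp_all add: \<mu>_def Q.prob_space Q.integrable_second Q.second_moment_fourth fourth_f_inner)

lemma coupling_law:
  "(\<lambda>\<omega> j. glue 0 (path \<omega>) (copy n \<omega>) (n - int j)) \<in> M \<rightarrow>\<^sub>M Q"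
  "distr M Q (\<lambda>\<omega> j. glue 0 (path \<omega>) (copy n \<omega>) (n - int j)) = Q"
proof -
  have m: "(\<lambda>\<omega>. glue 0 (path \<omega>) (copy n \<omega>)) \<in> M \<rightarrow>\<^sub>M seq.P"
    using measurable_compose[OF pair_measurable[of n] seq.measurable_glue[of 0]]
    unfolding prod.case .
  have l: "distr M seq.P (\<lambda>\<omega>. glue 0 (path \<omega>) (copy n \<omega>)) = seq.P"
  proof -
    have "distr M seq.P (\<lambda>\<omega>. glue 0 (path \<omega>) (copy n \<omega>)) =
        distr (distr M seq.PP (\<lambda>\<omega>. (path \<omega>, copy n \<omega>))) seq.P (\<lambda>(w, w'). glue 0 w w')"
      by (subst distr_distr[OF seq.measurable_glue pair_measurable]) (simp add: comp_def)
    then show ?thesis by (simp only: pair_law seq.distr_glue)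
  qed
  show "(\<lambda>\<omega> j. glue 0 (path \<omega>) (copy n \<omega>) (n - int j)) \<in> M \<rightarrow>\<^sub>M Q"
    by (rule measurable_compose[OF m window_measurable_P])
  have "distr M Q (\<lambda>\<omega> j. glue 0 (path \<omega>) (copy n \<omega>) (n - int j)) =
      distr (distr M seq.P (\<lambda>\<omega>. glue 0 (path \<omega>) (copy n \<omega>))) Q (\<lambda>w j. w (n - int j))"
    by (subst distr_distr[OF window_measurable_P m]) (simp add: comp_def)
  then show "distr M Q (\<lambda>\<omega> j. glue 0 (path \<omega>) (copy n \<omega>) (n - int j)) = Q"
    by (simp only: l window_law_P)
qed

text \<open>
  For lag \<open>r\<close> the coupled variable at time \<open>r\<close> keeps the innovations at times \<open>1, \<dots>, r\<close>, so it is a cut at zero.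
\<close>

lemma coupled_eq:
  "coupled f \<epsilon> \<epsilon>' r (int r) \<omega> = f (\<lambda>j. glue 0 (path \<omega>) (copy (int r) \<omega>) (int r - int j))"
  unfolding coupled_def glue_def by (intro arg_cong[where f=f] ext) auto

lemma inner_X_borel: "(\<lambda>\<omega>. inner (X n \<omega>) e) \<in> borel_measurable M"
  by (intro measurable_compose[OF X_borel] borel_measurable_continuous_onI continuous_intros)

lemma inner_coupled_borel:
  "(\<lambda>\<omega>. inner (coupled f \<epsilon> \<epsilon>' r (int r) \<omega>) e) \<in> borel_measurable M"
  unfolding coupled_eq by (rule measurable_compose[OF coupling_law(1) f_inner_borel])

text \<open>
  The coupled variable is distributed as \<open>X r\<close>, so the difference has a finite fourth moment. Without
  this integrability \<open>\<delta> r\<close> would not be an upper bound for the projected distances, because the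
  integral of a nonintegrable function is zero by convention.
\<close>

lemma coupling_difference:
  "integrable M (\<lambda>\<omega>. norm (X (int r) \<omega> - coupled f \<epsilon> \<epsilon>' r (int r) \<omega>) ^ 4)"
proof -
  let ?Y = "coupled f \<epsilon> \<epsilon>' r (int r)"
  have m: "(\<lambda>\<omega>. norm (X (int r) \<omega> - ?Y \<omega>)) \<in> borel_measurable M"
    by (rule borel_measurable_norm_L2) (simp only: inner_diff_left, intro borel_measurable_diff inner_X_borel inner_coupled_borel)
  have iY: "integrable M (\<lambda>\<omega>. norm (?Y \<omega>) ^ 4)"
    using integrable_measure_preserving[OF coupling_law f_norm_borel, of "int r"] f_norm4
    unfolding coupled_eq by blast
  show ?thesis
  proof (rule Bochner_Integration.integrable_bound)
    show "integrable M (\<lambda>\<omega>. 8 * (norm (X (int r) \<omega>) ^ 4 + norm (?Y \<omega>) ^ 4))"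
      using X_integrable[of "int r"] iY by simp
    show "AE \<omega> in M. norm (norm (X (int r) \<omega> - ?Y \<omega>) ^ 4) \<le> norm (8 * (norm (X (int r) \<omega>) ^ 4 + norm (?Y \<omega>) ^ 4))"
    proof (rule AE_I2)
      fix \<omega>
      have "norm (X (int r) \<omega> - ?Y \<omega>) ^ 4 \<le> (norm (X (int r) \<omega>) + norm (?Y \<omega>)) ^ 4"
        by (intro power_mono norm_triangle_ineq4) simp
      also have "\<dots> \<le> 8 * (norm (X (int r) \<omega>) ^ 4 + norm (?Y \<omega>) ^ 4)" by (rule power4_sum_le)
      finally show "norm (norm (X (int r) \<omega> - ?Y \<omega>) ^ 4) \<le> norm (8 * (norm (X (int r) \<omega>) ^ 4 + norm (?Y \<omega>) ^ 4))"
        by simp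
    qed
  qed (use m in measurable)
qed

text \<open>
  Bessel's inequality bounds the projected distance by the full one; the means cancel.
\<close>

lemma coupling_delta:
  assumes F: "finite F" "F \<subseteq> some_basis"
  shows "(\<integral>(w, w'). (\<Sum>e\<in>F. (g e (\<lambda>j. w (int r - int j)) -
          g e (\<lambda>j. glue 0 w w' (int r - int j)))\<^sup>2)\<^sup>2 \<partial>seq.PP) \<le> \<delta> r ^ 4"
proof -
  let ?h = "\<lambda>(w, w'). (\<Sum>e\<in>F. (g e (\<lambda>j. w (int r - int j)) - g e (\<lambda>j. glue 0 w w' (int r - int j)))\<^sup>2)\<^sup>2"
  let ?Y = "coupled f \<epsilon> \<epsilon>' r (int r)"
  have gb: "g e \<in> borel_measurable Q" for e by (rule fourth_momentD[OF fourth_g])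
  have a: "(\<lambda>p. g e (\<lambda>j. fst p (int r - int j))) \<in> borel_measurable seq.PP" for e
    by (intro measurable_compose[OF measurable_fst] measurable_compose[OF window_measurable_P gb])
  have b: "(\<lambda>p. g e (\<lambda>j. glue 0 (fst p) (snd p) (int r - int j))) \<in> borel_measurable seq.PP" for e
    using measurable_compose[OF seq.measurable_glue[of 0] measurable_compose[OF window_measurable_P gb]]
    by (simp add: case_prod_unfold)
  have m: "?h \<in> borel_measurable seq.PP"
    unfolding case_prod_unfold
    by (intro borel_measurable_power borel_measurable_sum borel_measurable_diff a b)
  have "(\<integral>p. ?h p \<partial>seq.PP) = (\<integral>\<omega>. ?h (path \<omega>, copy (int r) \<omega>) \<partial>M)"
    by (rule integral_measure_preserving[OF pair_measurable pair_law m, symmetric])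
  also have "\<dots> = (\<integral>\<omega>. (\<Sum>e\<in>F. (inner (X (int r) \<omega> - ?Y \<omega>) e)\<^sup>2)\<^sup>2 \<partial>M)"
    by (intro Bochner_Integration.integral_cong refl)
       (simp add: X_eq coupled_eq g_def inner_diff_left)
  also have "\<dots> \<le> (\<integral>\<omega>. norm (X (int r) \<omega> - ?Y \<omega>) ^ 4 \<partial>M)"
  proof (rule integral_mono_AE[OF _ coupling_difference AE_I2])
    have le: "(\<Sum>e\<in>F. (inner (X (int r) \<omega> - ?Y \<omega>) e)\<^sup>2)\<^sup>2 \<le> norm (X (int r) \<omega> - ?Y \<omega>) ^ 4" for \<omega>
    proof -
      have "(\<Sum>e\<in>F. (inner (X (int r) \<omega> - ?Y \<omega>) e)\<^sup>2)\<^sup>2 \<le> ((norm (X (int r) \<omega> - ?Y \<omega>))\<^sup>2)\<^sup>2"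
        by (intro power_mono basis.Bessel F sum_nonneg) simp
      then show ?thesis by simp
    qed
    then show "(\<Sum>e\<in>F. (inner (X (int r) \<omega> - ?Y \<omega>) e)\<^sup>2)\<^sup>2 \<le> norm (X (int r) \<omega> - ?Y \<omega>) ^ 4" for \<omega> .
    show "integrable M (\<lambda>\<omega>. (\<Sum>e\<in>F. (inner (X (int r) \<omega> - ?Y \<omega>) e)\<^sup>2)\<^sup>2)"
    proof (rule Bochner_Integration.integrable_bound[OF coupling_difference])
      show "(\<lambda>\<omega>. (\<Sum>e\<in>F. (inner (X (int r) \<omega> - ?Y \<omega>) e)\<^sup>2)\<^sup>2) \<in> borel_measurable M"
        unfolding inner_diff_left
        by (intro borel_measurable_power borel_measurable_sum borel_measurable_diff inner_X_borel inner_coupled_borel)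
    qed (use le in auto)
  qed
  also have "\<dots> = \<delta> r ^ 4" by (simp only: \<delta>_def nu_power4)
  finally show ?thesis .
qed

text \<open>
  Every finite set of basis vectors yields a finite-dimensional process with the same \<open>\<delta>\<close> and \<open>\<Delta>\<close>.
\<close>

lemma bernoulli_coordinates:
  assumes F: "finite F" "F \<subseteq> some_basis" and \<nu>: "0 \<le> \<nu>" "(\<integral>v. (\<Sum>e\<in>F. (g e v)\<^sup>2)\<^sup>2 \<partial>Q) \<le> \<nu> ^ 4"
  shows "bernoulli_process D F g \<nu> \<delta> \<Delta>"
  by unfold_locales
     (use F \<nu> fourth_g mean_g delta_sum_le coupling_delta in \<open>auto simp: \<delta>_def nu_nonneg\<close>)

section \<open>The error of the empirical covariance operator\<close>

lemma second_moment_inner_X: "second_moment M (\<lambda>\<omega>. inner (X n \<omega>) e)"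
proof -
  have "second_moment Q (\<lambda>v. inner (f v) e)" by (rule Q.second_moment_fourth[OF fourth_f_inner])
  from second_moment_measure_preserving[OF window_measurable window_law this, of n]
  have "integrable M (\<lambda>\<omega>. (inner (f (\<lambda>j. \<epsilon> (n - int j) \<omega>)) e)\<^sup>2)" by (simp add: second_moment_def)
  also have "?this \<longleftrightarrow> integrable M (\<lambda>\<omega>. (inner (X n \<omega>) e)\<^sup>2)"
    by (intro Bochner_Integration.integrable_cong refl) (simp add: X_eq)
  finally have "integrable M (\<lambda>\<omega>. (inner (X n \<omega>) e)\<^sup>2)" .
  then show ?thesis by (simp add: second_moment_def inner_X_borel)
qed

definition \<kappa> :: real where
  "\<kappa> = sqrt (enn2real (SUP t\<in>{0..1}. \<integral>\<^sup>+\<omega>. ennreal (\<bar>x 1 t \<omega>\<bar>\<^sup>2) \<partial>M))"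

lemma version_facts:
  "(\<lambda>(t, \<omega>). x n t \<omega>) \<in> borel_measurable (unit_interval \<Otimes>\<^sub>M M)"
  "\<omega> \<in> space M \<Longrightarrow> square_integrable (\<lambda>t. x n t \<omega>)"
  "\<omega> \<in> space M \<Longrightarrow> X n \<omega> = abs_L2 (\<lambda>t. x n t \<omega>)"
  using version[of n] by (auto simp: jointly_measurable_version_def)

lemma pointwise_moment:
  assumes "t \<in> {0..1}"
  shows "second_moment M (x 1 t)" "(\<integral>\<omega>. (x 1 t \<omega>)\<^sup>2 \<partial>M) \<le> \<kappa>\<^sup>2"
proof -
  let ?S = "SUP t\<in>{0..1}. \<integral>\<^sup>+\<omega>. ennreal (\<bar>x 1 t \<omega>\<bar>\<^sup>2) \<partial>M"
  have le: "(\<integral>\<^sup>+\<omega>. ennreal ((x 1 t \<omega>)\<^sup>2) \<partial>M) \<le> ?S"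
    using SUP_upper[OF assms, of "\<lambda>t. \<integral>\<^sup>+\<omega>. ennreal (\<bar>x 1 t \<omega>\<bar>\<^sup>2) \<partial>M"] by simp
  have "t \<in> space unit_interval" using assms by (simp add: space_restrict_space)
  from measurable_compose[OF measurable_Pair1'[OF this] version_facts(1)[of 1]]
  have m: "x 1 t \<in> borel_measurable M" by simp
  have i: "integrable M (\<lambda>\<omega>. (x 1 t \<omega>)\<^sup>2)"
  proof (rule integrableI_bounded)
    show "(\<integral>\<^sup>+\<omega>. ennreal (norm ((x 1 t \<omega>)\<^sup>2)) \<partial>M) < \<infinity>"
      using le bounded_variance by (simp add: le_less_trans)
  qed (use m in measurable)
  then show "second_moment M (x 1 t)" using m by (simp add: second_moment_def)
  have "ennreal (\<integral>\<omega>. (x 1 t \<omega>)\<^sup>2 \<partial>M) \<le> ?S" using le nn_integral_eq_integral[OF i] by simp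
  then have "(\<integral>\<omega>. (x 1 t \<omega>)\<^sup>2 \<partial>M) \<le> enn2real ?S"
    using bounded_variance enn2real_mono[of "ennreal (\<integral>\<omega>. (x 1 t \<omega>)\<^sup>2 \<partial>M)" ?S] by (simp add: less_top)
  then show "(\<integral>\<omega>. (x 1 t \<omega>)\<^sup>2 \<partial>M) \<le> \<kappa>\<^sup>2" by (simp add: \<kappa>_def enn2real_nonneg)
qed

sublocale so: second_order_process M "x 1" "X 1" \<kappa>
  by unfold_locales
     (use version_facts[where n=1] pointwise_moment second_moment_inner_X in \<open>auto simp: \<kappa>_def enn2real_nonneg\<close>)

lemma \<mu>_eq: "\<mu> e = (\<integral>\<omega>. inner (X 1 \<omega>) e \<partial>M)"
proof -
  have "\<mu> e = (\<integral>\<omega>. inner (f (\<lambda>j. \<epsilon> (1 - int j) \<omega>)) e \<partial>M)"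
    unfolding \<mu>_def
    by (rule integral_measure_preserving[OF window_measurable window_law f_inner_borel, symmetric])
  also have "\<dots> = (\<integral>\<omega>. inner (X 1 \<omega>) e \<partial>M)"
    by (intro Bochner_Integration.integral_cong refl) (simp add: X_eq)
  finally show ?thesis .
qed

lemma cov_entry: "inner (cov_operator M (x 1) e) e' = (\<integral>v. g e v * g e' v \<partial>Q)"
proof -
  have "(\<integral>v. g e v * g e' v \<partial>Q) = (\<integral>\<omega>. g e (\<lambda>j. \<epsilon> (1 - int j) \<omega>) * g e' (\<lambda>j. \<epsilon> (1 - int j) \<omega>) \<partial>M)"
    by (rule integral_measure_preserving[OF window_measurable window_law, symmetric])
       (intro borel_measurable_times fourth_momentD[OF fourth_g])
  also have "\<dots> = (\<integral>\<omega>. so.dev e \<omega> * so.dev e' \<omega> \<partial>M)"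
    by (intro Bochner_Integration.integral_cong refl) (simp add: X_eq g_def \<mu>_eq so.dev_def)
  finally show ?thesis by (simp add: so.inner_cov_operator)
qed

definition resid :: "nat \<Rightarrow> 'w \<Rightarrow> nat \<Rightarrow> L2" where
  "resid N \<omega> n = X (int n) \<omega> - (1 / real N) *\<^sub>R (\<Sum>i=1..N. X (int i) \<omega>)"

lemma emp_cov_operator_eq:
  assumes \<omega>: "\<omega> \<in> space M"
  shows "emp_cov_operator x N \<omega> h = (1 / real N) *\<^sub>R (\<Sum>n=1..N. inner (resid N \<omega> n) h *\<^sub>R resid N \<omega> n)"
proof -
  let ?y = "\<lambda>n t. x (int n) t \<omega> - sample_mean x N t \<omega>"
  have s: "square_integrable (\<lambda>t. x (int n) t \<omega>)" for n by (rule version_facts(2)[OF \<omega>])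
  have sm: "square_integrable (\<lambda>t. sample_mean x N t \<omega>)"
    using square_integrable_scale[OF square_integrable_sum[of "{1..N}" "\<lambda>i t. x (int i) t \<omega>", OF s],
        of "1 / real N"]
    by (simp add: sample_mean_def)
  have y: "square_integrable (?y n)" for n by (rule square_integrable_diff[OF s sm])
  have "abs_L2 (\<lambda>t. sample_mean x N t \<omega>) = (1 / real N) *\<^sub>R (\<Sum>i=1..N. X (int i) \<omega>)"
    using version_facts(3)[OF \<omega>]
    by (simp add: abs_L2_sum s abs_L2_scale square_integrable_sum sample_mean_def)
  then have r: "abs_L2 (?y n) = resid N \<omega> n" for n
    using abs_L2_diff[OF s sm, of n] version_facts(3)[OF \<omega>] by (simp add: resid_def)
  have "emp_cov_operator x N \<omega> h = integral_operator (\<lambda>t s. (\<Sum>n=1..N. ?y n t * ?y n s) / real N) h"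
    unfolding emp_cov_operator_def emp_cov_kernel_def ..
  also have "\<dots> = (1 / real N) *\<^sub>R (\<Sum>n=1..N. inner (resid N \<omega> n) h *\<^sub>R resid N \<omega> n)"
    using integral_operator_finite_rank[OF y, where N=N and h=h] by (simp only: r)
  finally show ?thesis .
qed

definition err :: "nat \<Rightarrow> 'w \<Rightarrow> L2 \<Rightarrow> L2" where
  "err N \<omega> h = emp_cov_operator x N \<omega> h - cov_operator M (x 1) h"

lemma err_bounded_linear:
  assumes \<omega>: "\<omega> \<in> space M"
  shows "bounded_linear (err N \<omega>)"
  unfolding err_def emp_cov_operator_eq[OF \<omega>]
  by (intro bounded_linear_sub so.cov_operator_bounded_linear bounded_linear_const_scaleR
      bounded_linear_sum bounded_linear_scaleR_const bounded_linear_inner_right)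

text \<open>
  The empirical covariance operator has finite rank, which gives a bound that is uniform in \<open>F\<close>.
\<close>

lemma entries_emp:
  assumes \<omega>: "\<omega> \<in> space M" and N: "1 \<le> N" and F: "finite F" "F \<subseteq> some_basis"
  shows "entries F (emp_cov_operator x N \<omega>) \<le> (\<Sum>n=1..N. norm (resid N \<omega> n) ^ 4) / real N"
proof -
  let ?r = "resid N \<omega>"
  have "entries F (emp_cov_operator x N \<omega>) \<le> (\<Sum>e\<in>F. (norm (emp_cov_operator x N \<omega> e))\<^sup>2)"
    unfolding entries_alt by (intro sum_mono basis.Bessel F)
  also have "\<dots> \<le> (\<Sum>e\<in>F. (\<Sum>n=1..N. (\<bar>inner (?r n) e\<bar> * norm (?r n))\<^sup>2) / real N)"
  proof (rule sum_mono)
    fix e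
    have "norm (emp_cov_operator x N \<omega> e) = norm (\<Sum>n=1..N. inner (?r n) e *\<^sub>R ?r n) / real N"
      unfolding emp_cov_operator_eq[OF \<omega>] by simp
    also have "\<dots> \<le> (\<Sum>n=1..N. \<bar>inner (?r n) e\<bar> * norm (?r n)) / real N"
      by (intro divide_right_mono order_trans[OF norm_sum]) auto
    finally have "(norm (emp_cov_operator x N \<omega> e))\<^sup>2 \<le> ((\<Sum>n=1..N. \<bar>inner (?r n) e\<bar> * norm (?r n)) / real N)\<^sup>2"
      by (intro power_mono) auto
    also have "\<dots> \<le> (\<Sum>n=1..N. (\<bar>inner (?r n) e\<bar> * norm (?r n))\<^sup>2) / real N"
      by (rule square_mean_le_mean_square[OF N])
    finally show "(norm (emp_cov_operator x N \<omega> e))\<^sup>2 \<le> (\<Sum>n=1..N. (\<bar>inner (?r n) e\<bar> * norm (?r n))\<^sup>2) / real N" .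
  qed
  also have "\<dots> = (\<Sum>n=1..N. (\<Sum>e\<in>F. (inner (?r n) e)\<^sup>2) * (norm (?r n))\<^sup>2) / real N"
    unfolding sum_divide_distrib[symmetric]
    by (subst sum.swap) (simp add: power_mult_distrib sum_distrib_right)
  also have "\<dots> \<le> (\<Sum>n=1..N. (norm (?r n))\<^sup>2 * (norm (?r n))\<^sup>2) / real N"
    by (intro divide_right_mono sum_mono mult_right_mono basis.Bessel F) auto
  finally show ?thesis by (simp add: power4_eq_xxxx power2_eq_square mult.assoc)
qed

text \<open>
  In coordinates the error operator is the error matrix of the finite-dimensional process, because the
  sample mean removes the difference between \<open>inner (f v) e\<close> and its centered version. The last
  statement is a crude pathwise bound whose only purpose is summability.
\<close>

lemma entries_error_bound:
  assumes F: "finite F" "F \<subseteq> some_basis" and \<nu>: "0 \<le> \<nu>" "(\<integral>v. (\<Sum>e\<in>F. (g e v)\<^sup>2)\<^sup>2 \<partial>Q) \<le> \<nu> ^ 4"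
    and N: "1 \<le> N"
  shows "integrable M (\<lambda>\<omega>. entries F (err N \<omega>))"
    and "real N * (\<integral>\<omega>. entries F (err N \<omega>) \<partial>M) \<le> \<nu> ^ 4 + 4 * sqrt 2 * \<nu> ^ 3 * \<Delta>"
    and "\<And>\<omega>. \<omega> \<in> space M \<Longrightarrow>
      entries F (err N \<omega>) \<le> 2 * ((\<Sum>n=1..N. norm (resid N \<omega> n) ^ 4) / real N) + 2 * \<nu> ^ 4"
proof -
  interpret b: bernoulli_process D F g \<nu> \<delta> \<Delta> by (rule bernoulli_coordinates[OF F \<nu>])
  let ?E = "\<lambda>w. hs_inner F (b.emp_error N w) (b.emp_error N w)"
  have entry: "inner (err N \<omega> e) e' = b.emp_error N (path \<omega>) e e'" if \<omega>: "\<omega> \<in> space M" for \<omega> e e'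
  proof -
    have Xb: "b.X n (path \<omega>) e = inner (X (int n) \<omega>) e - \<mu> e" for n e
      by (simp add: b.X_def g_def X_eq[OF \<omega>])
    have "(\<Sum>n=1..N. b.X n (path \<omega>) e) / real N = (\<Sum>n=1..N. inner (X (int n) \<omega>) e) / real N - \<mu> e" for e
      using N by (simp add: Xb sum_subtractf diff_divide_distrib)
    then have res: "b.X n (path \<omega>) e - (\<Sum>n=1..N. b.X n (path \<omega>) e) / real N = inner (resid N \<omega> n) e" for n e
      by (simp add: Xb resid_def inner_diff_left inner_sum_left)
    have "inner (err N \<omega> e) e' = (\<Sum>n=1..N. inner (resid N \<omega> n) e * inner (resid N \<omega> n) e') / real N - b.c e e'"
      unfolding err_def inner_diff_left emp_cov_operator_eq[OF \<omega>]
      by (simp add: inner_sum_left cov_entry b.c_def)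
    then show ?thesis unfolding b.emp_error_def res .
  qed
  have ent: "entries F (err N \<omega>) = ?E (path \<omega>)" if "\<omega> \<in> space M" for \<omega>
    unfolding entries_def hs_inner_def by (simp only: entry[OF that])
  note bd = b.emp_error_bound[OF N]
  have "integrable M (\<lambda>\<omega>. ?E (path \<omega>))"
    using bd(1) integrable_measure_preserving[OF path_measurable path_law borel_measurable_integrable[OF bd(1)]]
    by blast
  also have "?this \<longleftrightarrow> integrable M (\<lambda>\<omega>. entries F (err N \<omega>))"
    by (intro Bochner_Integration.integrable_cong refl) (simp add: ent)
  finally show "integrable M (\<lambda>\<omega>. entries F (err N \<omega>))" .
  have "(\<integral>\<omega>. entries F (err N \<omega>) \<partial>M) = (\<integral>\<omega>. ?E (path \<omega>) \<partial>M)"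
    by (intro Bochner_Integration.integral_cong refl ent)
  also have "\<dots> = (\<integral>w. ?E w \<partial>seq.P)"
    by (rule integral_measure_preserving[OF path_measurable path_law borel_measurable_integrable[OF bd(1)]])
  finally show "real N * (\<integral>\<omega>. entries F (err N \<omega>) \<partial>M) \<le> \<nu> ^ 4 + 4 * sqrt 2 * \<nu> ^ 3 * \<Delta>"
    using bd(2) by simp
  fix \<omega> assume \<omega>: "\<omega> \<in> space M"
  have "entries F (err N \<omega>) \<le> (\<Sum>e\<in>F. \<Sum>e'\<in>F. 2 * (inner (emp_cov_operator x N \<omega> e) e')\<^sup>2 +
      2 * (inner (cov_operator M (x 1) e) e')\<^sup>2)"
    unfolding entries_alt err_def inner_diff_left
  proof (intro sum_mono)
    fix e e'
    let ?p = "inner (emp_cov_operator x N \<omega> e) e'" and ?q = "inner (cov_operator M (x 1) e) e'"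
    show "(?p - ?q)\<^sup>2 \<le> 2 * ?p\<^sup>2 + 2 * ?q\<^sup>2"
      using zero_le_power2[of "?p + ?q"] unfolding power2_sum power2_diff by linarith
  qed
  also have "\<dots> = 2 * entries F (emp_cov_operator x N \<omega>) + 2 * hs_inner F b.c b.c"
    unfolding entries_alt hs_inner_self b.c_def cov_entry
    by (simp add: sum.distrib sum_distrib_left)
  also have "\<dots> \<le> 2 * ((\<Sum>n=1..N. norm (resid N \<omega> n) ^ 4) / real N) + 2 * \<nu> ^ 4"
  proof -
    have "(\<nu>\<^sup>2)\<^sup>2 = \<nu> ^ 4" by simp
    then have "hs_inner F b.c b.c \<le> \<nu> ^ 4"
      using b.sigma_gamma(3,4) zero_le_power2[of b.\<sigma>] by linarith
    then show ?thesis using entries_emp[OF \<omega> N F] by simp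
  qed
  finally show "entries F (err N \<omega>) \<le> 2 * ((\<Sum>n=1..N. norm (resid N \<omega> n) ^ 4) / real N) + 2 * \<nu> ^ 4" .
qed

lemma Hilbert_Schmidt_error_bound:
  assumes \<nu>: "0 \<le> \<nu>" "\<And>n. (\<integral>v. (\<Sum>e\<in>basis_upto n. (g e v)\<^sup>2)\<^sup>2 \<partial>Q) \<le> \<nu> ^ 4" and N: "1 \<le> N"
  shows "\<And>\<omega>. \<omega> \<in> space M \<Longrightarrow> Hilbert_Schmidt (err N \<omega>)"
    and "integrable M (\<lambda>\<omega>. (HS_norm (err N \<omega>))\<^sup>2)"
    and "real N * (\<integral>\<omega>. (HS_norm (err N \<omega>))\<^sup>2 \<partial>M) \<le> \<nu> ^ 4 + 4 * sqrt 2 * \<nu> ^ 3 * \<Delta>"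
proof -
  let ?U = "\<nu> ^ 4 + 4 * sqrt 2 * \<nu> ^ 3 * \<Delta>"
  note e = entries_error_bound[OF basis_upto(1,2) \<nu> N]
  show "Hilbert_Schmidt (err N \<omega>)" if "\<omega> \<in> space M" for \<omega>
    by (rule Hilbert_Schmidt_entries(1)[OF err_bounded_linear[OF that] e(3)[OF that]])
  have "(\<integral>\<omega>. entries (basis_upto n) (err N \<omega>) \<partial>M) \<le> ?U / real N" for n
    using e(2)[of n] N by (simp add: field_simps)
  note H = HS_norm_integral[OF err_bounded_linear e(3) e(1) this]
  show "integrable M (\<lambda>\<omega>. (HS_norm (err N \<omega>))\<^sup>2)" by (rule H(1))
  show "real N * (\<integral>\<omega>. (HS_norm (err N \<omega>))\<^sup>2 \<partial>M) \<le> ?U"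
    using H(2) N by (simp add: field_simps)
qed

lemma norm_sq_integrable: "integrable Q (\<lambda>v. (norm (f v))\<^sup>2)"
  and norm_sq_le: "(\<integral>v. (norm (f v))\<^sup>2 \<partial>Q) \<le> (nu M 4 (X 1))\<^sup>2"
proof -
  have m: "(\<lambda>v. (norm (f v))\<^sup>2) \<in> borel_measurable Q"
    by (intro borel_measurable_power measurable_compose[OF f_borel] borel_measurable_continuous_onI
      continuous_intros)
  then have s: "second_moment Q (\<lambda>v. (norm (f v))\<^sup>2)"
    using f_norm4 by (simp add: second_moment_def)
  show "integrable Q (\<lambda>v. (norm (f v))\<^sup>2)" by (rule Q.integrable_second[OF s])
  have "(\<integral>v. \<bar>(norm (f v))\<^sup>2 * 1\<bar> \<partial>Q) \<le> (nu M 4 (X 1))\<^sup>2 * 1"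
    by (rule Cauchy_Schwarz_integral[OF s _ _ Q.second_moment_const])
       (simp_all add: f_norm4_integral[of 1] Q.prob_space)
  then show "(\<integral>v. (norm (f v))\<^sup>2 \<partial>Q) \<le> (nu M 4 (X 1))\<^sup>2" by simp
qed

lemma integrable_g_sq:
  assumes "finite F" shows "integrable Q (\<lambda>v. (\<Sum>e\<in>F. (g e v)\<^sup>2)\<^sup>2)"
proof -
  have "second_moment Q (\<lambda>v. \<Sum>e\<in>F. g e v * g e v)"
    by (intro second_moment_sum second_moment_mult fourth_g)
  then show ?thesis by (simp add: second_moment_def power2_eq_square)
qed

text \<open>
  After centering, the squared norm is at most \<open>(\<parallel>f\<parallel> + \<nu>)\<^sup>2 \<le> 2 (\<parallel>f\<parallel>\<^sup>2 + \<nu>\<^sup>2)\<close>, since the norm of the mean is at most \<open>\<nu>\<close>.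
\<close>

lemma centered_moment:
  assumes F: "finite F" "F \<subseteq> some_basis"
  shows "(\<integral>v. (\<Sum>e\<in>F. (g e v)\<^sup>2)\<^sup>2 \<partial>Q) \<le> (2 * nu M 4 (X 1)) ^ 4"
proof -
  let ?\<nu> = "nu M 4 (X 1)"
  have mu: "(\<Sum>e\<in>F. (\<mu> e)\<^sup>2) \<le> ?\<nu>\<^sup>2"
  proof -
    have s: "second_moment Q (\<lambda>v. inner (f v) e)" for e by (rule Q.second_moment_fourth[OF fourth_f_inner])
    have i: "integrable Q (\<lambda>v. (inner (f v) e)\<^sup>2)" for e using s by (simp add: second_moment_def)
    have "(\<mu> e)\<^sup>2 \<le> (\<integral>v. (inner (f v) e)\<^sup>2 \<partial>Q)" for e
    proof -
      have "0 \<le> (\<integral>v. (inner (f v) e - \<mu> e)\<^sup>2 \<partial>Q)" by simp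
      also have "\<dots> = (\<integral>v. (inner (f v) e)\<^sup>2 - 2 * \<mu> e * inner (f v) e + (\<mu> e)\<^sup>2 \<partial>Q)"
        by (simp add: power2_diff algebra_simps)
      also have "\<dots> = (\<integral>v. (inner (f v) e)\<^sup>2 \<partial>Q) - 2 * \<mu> e * \<mu> e + (\<mu> e)\<^sup>2"
        using i[of e] Q.integrable_second[OF s[of e]] by (simp add: \<mu>_def Q.prob_space)
      finally show ?thesis by (simp add: power2_eq_square)
    qed
    then have "(\<Sum>e\<in>F. (\<mu> e)\<^sup>2) \<le> (\<Sum>e\<in>F. \<integral>v. (inner (f v) e)\<^sup>2 \<partial>Q)" by (intro sum_mono)
    also have "\<dots> = (\<integral>v. (\<Sum>e\<in>F. (inner (f v) e)\<^sup>2) \<partial>Q)"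
      by (rule Bochner_Integration.integral_sum[symmetric]) (rule i)
    also have "\<dots> \<le> (\<integral>v. (norm (f v))\<^sup>2 \<partial>Q)"
      by (intro integral_mono Bochner_Integration.integrable_sum i norm_sq_integrable basis.Bessel F)
    also have "\<dots> \<le> ?\<nu>\<^sup>2" by (rule norm_sq_le)
    finally show ?thesis .
  qed
  have pw: "(\<Sum>e\<in>F. (g e v)\<^sup>2)\<^sup>2 \<le> 8 * norm (f v) ^ 4 + 8 * ?\<nu> ^ 4" for v
  proof -
    have "(g e v)\<^sup>2 \<le> 2 * ((inner (f v) e)\<^sup>2 + (\<mu> e)\<^sup>2)" for e
      using power2_sum_le[of "inner (f v) e" "- \<mu> e"] by (simp add: g_def)
    then have "(\<Sum>e\<in>F. (g e v)\<^sup>2) \<le> (\<Sum>e\<in>F. 2 * ((inner (f v) e)\<^sup>2 + (\<mu> e)\<^sup>2))" by (intro sum_mono)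
    also have "\<dots> = 2 * ((\<Sum>e\<in>F. (inner (f v) e)\<^sup>2) + (\<Sum>e\<in>F. (\<mu> e)\<^sup>2))"
      by (simp add: sum_distrib_left sum.distrib)
    also have "\<dots> \<le> 2 * ((norm (f v))\<^sup>2 + ?\<nu>\<^sup>2)"
      by (intro mult_left_mono add_mono basis.Bessel F mu) simp
    finally have "(\<Sum>e\<in>F. (g e v)\<^sup>2)\<^sup>2 \<le> (2 * ((norm (f v))\<^sup>2 + ?\<nu>\<^sup>2))\<^sup>2"
      by (intro power_mono sum_nonneg) auto
    also have "\<dots> = 4 * ((norm (f v))\<^sup>2 + ?\<nu>\<^sup>2)\<^sup>2" unfolding power_mult_distrib by simp
    also have "\<dots> \<le> 4 * (2 * (((norm (f v))\<^sup>2)\<^sup>2 + (?\<nu>\<^sup>2)\<^sup>2))"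
      by (intro mult_left_mono power2_sum_le) simp
    finally show ?thesis by simp
  qed
  have "(\<integral>v. (\<Sum>e\<in>F. (g e v)\<^sup>2)\<^sup>2 \<partial>Q) \<le> (\<integral>v. 8 * norm (f v) ^ 4 + 8 * ?\<nu> ^ 4 \<partial>Q)"
    using f_norm4 by (intro integral_mono integrable_g_sq F pw) simp
  also have "\<dots> = 16 * ?\<nu> ^ 4" using f_norm4 by (simp add: f_norm4_integral[of 1] Q.prob_space)
  finally show ?thesis by (simp add: power_mult_distrib)
qed

text \<open>
  If the pointwise means vanish almost everywhere, so do the means of all coordinates, and Bessel's
  inequality gives the constant \<open>\<nu>\<close> itself.
\<close>

lemma zero_mean_moment:
  assumes zero: "AE t in unit_interval. (\<integral>\<omega>. x 1 t \<omega> \<partial>M) = 0" and F: "finite F" "F \<subseteq> some_basis"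
  shows "(\<integral>v. (\<Sum>e\<in>F. (g e v)\<^sup>2)\<^sup>2 \<partial>Q) \<le> nu M 4 (X 1) ^ 4"
proof -
  have "\<mu> e = 0" for e
  proof -
    have "\<mu> e = (\<integral>t. so.mean t * rep_L2 e t \<partial>unit_interval)" by (simp add: \<mu>_eq so.integral_inner(1))
    also have "\<dots> = 0"
      by (rule integral_eq_zero_AE) (use zero in \<open>auto simp: so.mean_def\<close>)
    finally show ?thesis .
  qed
  then have "(\<Sum>e\<in>F. (g e v)\<^sup>2)\<^sup>2 \<le> ((norm (f v))\<^sup>2)\<^sup>2" for v
    using basis.Bessel[OF F, of "f v"] by (intro power_mono) (simp_all add: g_def sum_nonneg)
  then have "(\<integral>v. (\<Sum>e\<in>F. (g e v)\<^sup>2)\<^sup>2 \<partial>Q) \<le> (\<integral>v. norm (f v) ^ 4 \<partial>Q)"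
    by (intro integral_mono integrable_g_sq F f_norm4) simp
  then show ?thesis by (simp only: f_norm4_integral[of 1])
qed

end

theorem theorem3p1:
  fixes M :: "'w measure" and S :: "'s measure"
    and X :: "int \<Rightarrow> 'w \<Rightarrow> L2" and x :: "int \<Rightarrow> real \<Rightarrow> 'w \<Rightarrow> real"
    and f :: "(nat \<Rightarrow> 's) \<Rightarrow> L2"
    and \<epsilon> :: "int \<Rightarrow> 'w \<Rightarrow> 's" and \<epsilon>' :: "int \<Rightarrow> int \<Rightarrow> 'w \<Rightarrow> 's"
  assumes "prob_space M"
    and "Lp_m_approximable M 4 X S f \<epsilon> \<epsilon>'"
    and "\<And>n. jointly_measurable_version M (x n) (X n)"
    and "(SUP t\<in>{0..1}. \<integral>\<^sup>+\<omega>. ennreal (\<bar>x 1 t \<omega>\<bar>\<^sup>2) \<partial>M) < \<infinity>"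
  defines "\<Delta> \<equiv> \<lambda>N \<omega> h. emp_cov_operator x N \<omega> h - cov_operator M (x 1) h"
  shows "(\<forall>N\<ge>1. \<forall>\<omega>\<in>space M. Hilbert_Schmidt (\<Delta> N \<omega>)) \<and>
    (\<forall>N\<ge>1. integrable M (\<lambda>\<omega>. (HS_norm (\<Delta> N \<omega>))\<^sup>2)) \<and>
    (\<exists>U::real. \<forall>N\<ge>1. real N * (\<integral>\<omega>. (HS_norm (\<Delta> N \<omega>))\<^sup>2 \<partial>M) \<le> U) \<and>
    ((\<forall>n. AE t in unit_interval. (\<integral>\<omega>. x n t \<omega> \<partial>M) = 0) \<longrightarrow>
      (\<forall>N\<ge>1. real N * (\<integral>\<omega>. (HS_norm (\<Delta> N \<omega>))\<^sup>2 \<partial>M) \<le>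
        nu M 4 (X 1) ^ 4 + 4 * sqrt 2 * nu M 4 (X 1) ^ 3 *
          (\<Sum>r. nu M 4 (\<lambda>\<omega>. X (int (Suc r)) \<omega> -
                             coupled f \<epsilon> \<epsilon>' (Suc r) (int (Suc r)) \<omega>))))"
proof -
  interpret approximable_process M S X x f \<epsilon> \<epsilon>'
    using assms(1-4) by (simp add: approximable_process_def approximable_process_axioms_def)
  have \<Delta>: "\<Delta> N \<omega> = err N \<omega>" for N \<omega> by (simp add: assms(5) err_def fun_eq_iff)
  note general = Hilbert_Schmidt_error_bound[OF _ centered_moment[OF basis_upto(1,2)]]
  have "real N * (\<integral>\<omega>. (HS_norm (err N \<omega>))\<^sup>2 \<partial>M) \<le> nu M 4 (X 1) ^ 4 + 4 * sqrt 2 * nu M 4 (X 1) ^ 3 *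
      (\<Sum>r. nu M 4 (\<lambda>\<omega>. X (int (Suc r)) \<omega> - coupled f \<epsilon> \<epsilon>' (Suc r) (int (Suc r)) \<omega>))"
    if "\<forall>n. AE t in unit_interval. (\<integral>\<omega>. x n t \<omega> \<partial>M) = 0" "1 \<le> N" for N
    using Hilbert_Schmidt_error_bound(3)[OF nu_nonneg zero_mean_moment[OF _ basis_upto(1,2)] that(2)] that(1)
    unfolding \<Delta>_def \<delta>_def by blast
  then show ?thesis
    unfolding \<Delta> using general nu_nonneg[of M 4 "X 1"] by (intro conjI allI impI ballI exI) auto
qed

end
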